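(* For $w>0$ and a finite frame $[-B_L,B_R]$, let $\gamma=\mathcal T(w;B_L,B_R)$ be the (unique) finite-frame traveling wave shape. Then: (i) $\gamma=\mathcal T(w;B_L,B_R)$, as an element of $\Gamma$ (with its $\Gamma$-topology), is continuous in $(w;B_L,B_R)\in(0,\infty)^3$. (ii) $\gamma=\mathcal T(w;B_L,B_R)$, as a probability distribution, is monotone with respect to the stochastic order $\preceq$ in each of the parameters $w,B_L,B_R$ when the other two are fixed: it is monotone non-increasing in $w$ and in $B_L$, and monotone non-decreasing in $B_R$. (iii) Let $B_L,B_R>0$ be fixed. As $w\uparrow\infty$ [resp. $w\downarrow0$], $\gamma=\mathcal T(w;B_L,B_R)$ converges weakly to the Dirac distribution at $-B_L$ [resp. at $B_R$]. Consequently, for any fixed $B_L,B_R>0$, any $y\in(-B_L,B_R)$ and any $\nu\in(0,1)$, there exists $w>0$ such that $\gamma^{-1}(\nu)=y$. (iv) For any fixed parameters $w,B_L,B_R$ and any $c\in\mathbb{R}$, $\gamma=\mathcal T(w;B_L,B_R)$ implies $\theta_c\gamma=\mathcal T(w;B_L-c,B_R+c)$, where $\theta_c\gamma(x)=\gamma(x-c)$.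
   Context: RCLL means right-continuous with left limits. A distribution function is a non-decreasing RCLL function on $\mathbb{R}$ with limits $0$ and $1$ at $-\infty$ and $+\infty$. Quantiles: $\gamma^{-1}(\nu)=\inf\{y:\gamma(y)\ge\nu\}$. Stochastic order: $g\preceq\gamma$ iff $g(x)\ge\gamma(x)$ for all $x\in\mathbb{R}$. Standing assumptions: $\eta:[0,1]\to[0,1]$ is continuous and strictly decreasing with $\eta(0)=1$, $\eta(1)=0$; $J$ is the CDF of a probability distribution on $[0,\infty)$ with $\int_0^\infty y^\ell\,dJ(y)<\infty$ for some integer $\ell\ge2$ and normalized mean $\int_0^\infty y\,dJ(y)=1$. For a distribution function $\gamma$ and $y\in\mathbb{R}$, $\bar\eta(y,\gamma)=\eta(\gamma(y))$ if $\gamma$ is continuous at $y$, and otherwise $\bar\eta(y,\gamma)=(\nu_2-\nu_1)^{-1}\int_{\nu_1}^{\nu_2}\eta(\nu)\,d\nu$ with $\nu_1=\gamma(y-)$, $\nu_2=\gamma(y)$. Operator $A^{(w;B_L,B_R)}$: let $\gamma$ be a distribution concentrated on $[-B_L,B_R]$. Consider the Markov process $X(\cdot)$ on $[-B_L,B_R]$ (location of a single particle): between jumps it moves left at constant speed $w>0$ until it reaches $-B_L$, where it stays until its next jump; it gets urges to jump at the points of a rate $1$ Poisson process; at an urge at time $t$ it actually jumps with probability $\bar\eta(X(t),\gamma)$; a jump displaces it to the right by an amount drawn from $J$ (jump sizes i.i.d.), except that if this would take it to the right of $B_R$ it lands at $B_R$. $A^{(w;B_L,B_R)}\gamma$ is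 the unique stationary distribution of this process. $\mathcal T(w;B_L,B_R)$ denotes the unique distribution $\gamma$ concentrated on $[-B_L,B_R]$ with $\gamma=A^{(w;B_L,B_R)}\gamma$ (the finite-frame traveling wave shape); existence and uniqueness are known. The parameters are $w,B_L,B_R>0$; in (iv) the same definitions are used verbatim for any real $B_L,B_R$ with $-B_L<B_R$. Space $\Gamma$: for $w,B_L,B_R>0$, $\Gamma(w;B_L,B_R)$ is the set of distribution functions concentrated on $[-B_L,B_R]$ and $1/w$-Lipschitz on $[-B_L,B_R]$ (so an atom is possible only at $-B_L$), with the parameters $w,B_L,B_R$ regarded as attached to $\gamma$; $\Gamma=\bigcup_{w,B_L,B_R>0}\Gamma(w;B_L,B_R)$. Convergence $\gamma^{(k)}\to\gamma$ in $\Gamma$ means: $w^{(k)}\to w$, $B_L^{(k)}\to B_L$, $B_R^{(k)}\to B_R$ for the attached parameters, and $\gamma^{(k)}(y)\to\gamma(y)$ for all $y\in(-B_L,B_R)$. The distribution $\mathcal T(w;B_L,B_R)$ belongs to $\Gamma(w;B_L,B_R)$. *)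

theory Defs
  imports "HOL-Probability.Probability"
begin

section \<open>Distribution functions\<close>

text \<open>A probability distribution on the line is represented by its distribution function
  \<open>F\<close>; the associated measure is \<open>interval_measure F\<close>. The left limits in
  ``right-continuous with left limits'' are automatic for a monotone function.\<close>

definition distribution_function :: "(real \<Rightarrow> real) \<Rightarrow> bool" where
  "distribution_function F \<longleftrightarrow>
     mono F \<and> (\<forall>x. continuous (at_right x) F) \<and>
     (F \<longlongrightarrow> 0) at_bot \<and> (F \<longlongrightarrow> 1) at_top"

definition concentrated_on :: "(real \<Rightarrow> real) \<Rightarrow> real set \<Rightarrow> bool" where
  "concentrated_on F S \<longleftrightarrow> measure (interval_measure F) S = 1"

definition quantile :: "(real \<Rightarrow> real) \<Rightarrow> real \<Rightarrow> real" where
  "quantile F \<nu> = Inf {y. F y \<ge> \<nu>}"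

definition stoch_le :: "(real \<Rightarrow> real) \<Rightarrow> (real \<Rightarrow> real) \<Rightarrow> bool" (infix \<open>\<preceq>\<close> 50) where
  "F \<preceq> G \<longleftrightarrow> (\<forall>x. F x \<ge> G x)"

definition translate :: "real \<Rightarrow> (real \<Rightarrow> real) \<Rightarrow> real \<Rightarrow> real" where
  "translate c F = (\<lambda>x. F (x - c))"


section \<open>Standing assumptions on the jump probability and the jump size\<close>

definition jump_prob :: "(real \<Rightarrow> real) \<Rightarrow> bool" where
  "jump_prob \<eta> \<longleftrightarrow>
     \<eta> ` {0..1} \<subseteq> {0..1} \<and> continuous_on {0..1} \<eta> \<and> strict_antimono_on {0..1} \<eta> \<and>
     \<eta> 0 = 1 \<and> \<eta> 1 = 0"

definition jump_size_cdf :: "(real \<Rightarrow> real) \<Rightarrow> bool" where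
  "jump_size_cdf J \<longleftrightarrow>
     distribution_function J \<and> concentrated_on J {0..} \<and>
     (\<exists>l::nat. l \<ge> 2 \<and> integrable (interval_measure J) (\<lambda>y. y ^ l)) \<and>
     (LINT y|interval_measure J. y) = 1"

definition eta_bar :: "(real \<Rightarrow> real) \<Rightarrow> real \<Rightarrow> (real \<Rightarrow> real) \<Rightarrow> real" where
  "eta_bar \<eta> y \<gamma> =
     (if isCont \<gamma> y then \<eta> (\<gamma> y)
      else let \<nu>1 = Lim (at_left y) \<gamma>; \<nu>2 = \<gamma> y
           in (LBINT \<nu>:{\<nu>1..\<nu>2}. \<eta> \<nu>) / (\<nu>2 - \<nu>1))"


section \<open>The single-particle Markov process in a finite frame\<close>

text \<open>The process is driven by an i.i.d. sequence of triples (time since the previous urge,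
  acceptance variable, jump size), with laws Exp(1), uniform on \<open>[0,1]\<close>, and \<open>J\<close>, and
  independent components. The urges thus form a rate 1 Poisson process, and an urge at position
  \<open>y\<close> is followed by a jump iff the acceptance variable is at most \<open>eta_bar \<eta> y \<gamma>\<close>,
  that is, with probability \<open>eta_bar \<eta> y \<gamma>\<close>.\<close>

type_synonym urge = "real \<times> real \<times> real"

definition urge_law :: "(real \<Rightarrow> real) \<Rightarrow> urge measure" where
  "urge_law J =
     density lborel (exponential_density 1) \<Otimes>\<^sub>M
       (uniform_measure lborel {0..1} \<Otimes>\<^sub>M interval_measure J)"

definition driving_space :: "(real \<Rightarrow> real) \<Rightarrow> urge stream measure" where
  "driving_space J = stream_space (urge_law J)"

definition drift :: "real \<Rightarrow> real \<Rightarrow> real \<Rightarrow> real \<Rightarrow> real" where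
  "drift w BL s x = max (- BL) (x - w * s)"

definition urge_step ::
    "(real \<Rightarrow> real) \<Rightarrow> (real \<Rightarrow> real) \<Rightarrow> real \<Rightarrow> real \<Rightarrow> real \<Rightarrow> urge \<Rightarrow> real \<Rightarrow> real" where
  "urge_step \<eta> \<gamma> w BL BR e x =
     (case e of (s, u, z) \<Rightarrow>
        let y = drift w BL s x in if u \<le> eta_bar \<eta> y \<gamma> then min BR (y + z) else y)"

text \<open>\<open>urge_time \<omega> n\<close> is the time of the \<open>n\<close>-th urge (with \<open>urge_time \<omega> 0 = 0\<close>),
  and \<open>urge_pos \<dots> \<omega> n\<close> is the position just after it when the process starts at \<open>x\<close>.\<close>

primrec urge_time :: "urge stream \<Rightarrow> nat \<Rightarrow> real" where
  "urge_time \<omega> 0 = 0"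
| "urge_time \<omega> (Suc n) = urge_time \<omega> n + fst (\<omega> !! n)"

primrec urge_pos ::
    "(real \<Rightarrow> real) \<Rightarrow> (real \<Rightarrow> real) \<Rightarrow> real \<Rightarrow> real \<Rightarrow> real \<Rightarrow> real \<Rightarrow> urge stream \<Rightarrow> nat \<Rightarrow> real"
where
  "urge_pos \<eta> \<gamma> w BL BR x \<omega> 0 = x"
| "urge_pos \<eta> \<gamma> w BL BR x \<omega> (Suc n) =
     urge_step \<eta> \<gamma> w BL BR (\<omega> !! n) (urge_pos \<eta> \<gamma> w BL BR x \<omega> n)"

text \<open>The number of urges during \<open>[0,t]\<close>. Almost surely the interarrival times are positive and
  the urge times tend to infinity, so that the set below is nonempty.\<close>

definition urge_count :: "urge stream \<Rightarrow> real \<Rightarrow> nat" where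
  "urge_count \<omega> t = (LEAST n. t < urge_time \<omega> (Suc n))"

definition particle ::
    "(real \<Rightarrow> real) \<Rightarrow> (real \<Rightarrow> real) \<Rightarrow> real \<Rightarrow> real \<Rightarrow> real \<Rightarrow> real \<Rightarrow> urge stream \<Rightarrow> real \<Rightarrow> real"
where
  "particle \<eta> \<gamma> w BL BR x \<omega> t =
     (let n = urge_count \<omega> t
      in drift w BL (t - urge_time \<omega> n) (urge_pos \<eta> \<gamma> w BL BR x \<omega> n))"

text \<open>\<open>\<pi>\<close> is stationary if, started from a position with law \<open>\<pi>\<close> independent of the driving
  sequence, the process has law \<open>\<pi>\<close> at every time \<open>t \<ge> 0\<close>.\<close>

definition stationary_distribution ::
    "(real \<Rightarrow> real) \<Rightarrow> (real \<Rightarrow> real) \<Rightarrow> (real \<Rightarrow> real) \<Rightarrow> real \<Rightarrow> real \<Rightarrow> real \<Rightarrow> (real \<Rightarrow> real) \<Rightarrow> bool"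
where
  "stationary_distribution \<eta> J \<gamma> w BL BR \<pi> \<longleftrightarrow>
     distribution_function \<pi> \<and> concentrated_on \<pi> {- BL..BR} \<and>
     (\<forall>t\<ge>0. distr (interval_measure \<pi> \<Otimes>\<^sub>M driving_space J) borel
                (\<lambda>(x, \<omega>). particle \<eta> \<gamma> w BL BR x \<omega> t)
              = interval_measure \<pi>)"

definition frame_operator ::
    "(real \<Rightarrow> real) \<Rightarrow> (real \<Rightarrow> real) \<Rightarrow> real \<Rightarrow> real \<Rightarrow> real \<Rightarrow> (real \<Rightarrow> real) \<Rightarrow> (real \<Rightarrow> real)" where
  "frame_operator \<eta> J w BL BR \<gamma> = (THE \<pi>. stationary_distribution \<eta> J \<gamma> w BL BR \<pi>)"

definition traveling_wave ::
    "(real \<Rightarrow> real) \<Rightarrow> (real \<Rightarrow> real) \<Rightarrow> real \<Rightarrow> real \<Rightarrow> real \<Rightarrow> (real \<Rightarrow> real)" where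
  "traveling_wave \<eta> J w BL BR =
     (THE \<gamma>. distribution_function \<gamma> \<and> concentrated_on \<gamma> {- BL..BR} \<and>
             \<gamma> = frame_operator \<eta> J w BL BR \<gamma>)"


section \<open>The space \<open>\<Gamma>\<close>\<close>

definition Gamma_frame :: "real \<Rightarrow> real \<Rightarrow> real \<Rightarrow> (real \<Rightarrow> real) set" where
  "Gamma_frame w BL BR =
     {\<gamma>. distribution_function \<gamma> \<and> concentrated_on \<gamma> {- BL..BR} \<and>
          (1 / w)-lipschitz_on {- BL..BR} \<gamma>}"

text \<open>An element of \<open>\<Gamma>\<close> carries its parameters, as \<open>(w, BL, BR, \<gamma>)\<close>.\<close>

type_synonym framed = "real \<times> real \<times> real \<times> (real \<Rightarrow> real)"

definition Gamma_space :: "framed set" where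
  "Gamma_space = {(w, BL, BR, \<gamma>). w > 0 \<and> BL > 0 \<and> BR > 0 \<and> \<gamma> \<in> Gamma_frame w BL BR}"

definition Gamma_converges :: "(nat \<Rightarrow> framed) \<Rightarrow> framed \<Rightarrow> bool" where
  "Gamma_converges g g0 \<longleftrightarrow>
     (\<forall>k. g k \<in> Gamma_space) \<and> g0 \<in> Gamma_space \<and>
     (case g0 of (w, BL, BR, \<gamma>) \<Rightarrow>
        (\<lambda>k. fst (g k)) \<longlonglongrightarrow> w \<and>
        (\<lambda>k. fst (snd (g k))) \<longlonglongrightarrow> BL \<and>
        (\<lambda>k. fst (snd (snd (g k)))) \<longlonglongrightarrow> BR \<and>
        (\<forall>y\<in>{- BL<..<BR}. (\<lambda>k. snd (snd (snd (g k))) y) \<longlonglongrightarrow> \<gamma> y))"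

definition framed_wave ::
    "(real \<Rightarrow> real) \<Rightarrow> (real \<Rightarrow> real) \<Rightarrow> real \<times> real \<times> real \<Rightarrow> framed" where
  "framed_wave \<eta> J p = (case p of (w, BL, BR) \<Rightarrow> (w, BL, BR, traveling_wave \<eta> J w BL BR))"

end

theory Submission
  imports Defs
begin

text \<open>Write \<open>b = - BL\<close>, \<open>R = BR\<close>, let \<open>Z\<close> have law \<open>J\<close>, and let \<open>H\<close> be the primitive of
  \<open>\<eta>\<close> with \<open>H 0 = 0\<close>. A law \<open>M\<close> on \<open>[b, R]\<close> that consists of an atom at \<open>b\<close> and the density
  \<open>\<Phi> / w\<close>, where \<open>\<Phi> s\<close> is the rate at which jumps cross the level \<open>s\<close> under \<open>M\<close>, is invariant for
  the chain of positions just before the urges, and a renewal identity turns this into stationarity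
  at all times. Such a law is obtained from a linear Volterra equation, and stationary laws are unique
  by Doeblin's argument: without an urge during \<open>(R - b) / w\<close> the particle is at \<open>b\<close>. As
  \<open>eta_bar d\<gamma> = d(H \<circ> \<gamma>)\<close>, the fixed points of the frame operator are the solutions of the
  delay equation \<open>w \<gamma>' = H(\<gamma>) - E H(\<gamma>(\<cdot> - Z))\<close> on \<open>[b, R]\<close> with \<open>\<gamma> = 0\<close> on the left and
  \<open>\<gamma>(R) = 1\<close>. Shooting with the atom \<open>\<gamma>(b)\<close> yields a solution. If \<open>f\<close> is a supersolution and
  \<open>g\<close> a subsolution, then \<open>w (f - g)\<^sup>+\<close> grows at least by the mass of \<open>(H f - H g)\<^sup>+\<close> that is
  carried across the current level; read from the right end of the frame this gives uniqueness and
  all the monotonicity statements. The same flux estimate gives \<open>\<gamma> \<rightarrow> 0\<close> below \<open>R\<close> as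
  \<open>w \<rightarrow> 0\<close>.\<close>

section \<open>Stationarity of the single-particle process\<close>

text \<open>The process is given by its paths, and \<open>frame_operator\<close> and
  \<open>traveling_wave\<close> are \<open>THE\<close> terms; so stationarity, existence and
  uniqueness have to be proved for the path construction itself. Passing to the chain seen just
  before the urges replaces the generator by identities between integrals of nonnegative functions,
  where every exchange of integrals is free. \<open>J\<close> may have atoms, sit on a lattice or
  charge 0, so looking at a first crossing point of two solutions need not give a strict inequality.
  The quantitative steps therefore use integrated fluxes and one length \<delta> > 0 with P(Z \<ge>
  \<delta>) > 0, which a jump law of mean 1 always has. The delay equation is causal from the left,
  whereas the condition that singles out the wave sits at the right end. Hence existence is proved
  by varying the left value, and comparison by moving leftwards from the value 1 at
  \<open>R\<close>.\<close>

abbreviation window :: "real \<Rightarrow> real \<Rightarrow> ennreal" where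
  "window u r \<equiv> indicator {0<..} r * indicator {0<..} (u - r)"

lemma nn_integral_shift:
  fixes f :: "real \<Rightarrow> ennreal"
  assumes [measurable]: "f \<in> borel_measurable borel"
  shows "(\<integral>\<^sup>+x. f (x + c) \<partial>lborel) = (\<integral>\<^sup>+x. f x \<partial>lborel)"
  using nn_integral_real_affine[of f 1 c] by (simp add: add.commute)

lemma nn_integral_reflect:
  fixes f :: "real \<Rightarrow> ennreal"
  assumes [measurable]: "f \<in> borel_measurable borel"
  shows "(\<integral>\<^sup>+x. f (c - x) \<partial>lborel) = (\<integral>\<^sup>+x. f x \<partial>lborel)"
  using nn_integral_real_affine[of f "-1" c] by simp

text \<open>Applied with \<open>p u = \<rho> P\<^sub>u f\<close>, where \<open>\<rho>\<close> is the law just after an urge: the first hypothesis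
  splits according to the first urge time \<open>r\<close>, the second one expresses that \<open>\<rho>\<close> is invariant
  under waiting for the next urge and performing it.\<close>

lemma renewal_identity:
  fixes \<sigma> p :: "real \<Rightarrow> ennreal" and \<psi> :: "real \<Rightarrow> real \<Rightarrow> ennreal"
  assumes [measurable]: "\<sigma> \<in> borel_measurable borel"
    and \<psi>[measurable]: "(\<lambda>(u, r). \<psi> u r) \<in> borel_measurable (borel \<Otimes>\<^sub>M borel)"
    and p1: "\<And>u. 0 < u \<Longrightarrow> u < t \<Longrightarrow> p u = \<sigma> u + (\<integral>\<^sup>+r. \<psi> (u - r) r * window u r \<partial>lborel)"
    and p2: "\<And>u. 0 < u \<Longrightarrow> u < t \<Longrightarrow> p u = (\<integral>\<^sup>+r. \<psi> u r * indicator {0<..} r \<partial>lborel)"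
    and p3: "\<And>u. 0 < u \<Longrightarrow> u < t \<Longrightarrow> p u \<le> 1"
    and t: "0 \<le> t"
  shows "(\<integral>\<^sup>+s. (\<sigma> (s + t) + (\<integral>\<^sup>+r. \<psi> (t - r) (s + r) * indicator {0<..<t} r \<partial>lborel)) * indicator {0<..} s \<partial>lborel)
    = (\<integral>\<^sup>+s. \<sigma> s * indicator {0<..} s \<partial>lborel)"
proof -
  \<comment> \<open>With \<open>Y\<close> the integral of \<open>p\<close> over (0, t), the second
    formula for \<open>p\<close> gives \<open>A2 + X = Y\<close> and the first gives
    \<open>Y = B + X\<close>. Cancelling \<open>X\<close> yields \<open>A2 = B\<close>, and the
    claim reads \<open>A1 + A2 = A1 + B\<close>.\<close>
  define A1 where "A1 = (\<integral>\<^sup>+s. \<sigma> s * indicator {t<..} s \<partial>lborel)"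
  define B where "B = (\<integral>\<^sup>+s. \<sigma> s * indicator {0<..<t} s \<partial>lborel)"
  define A2 where "A2 = (\<integral>\<^sup>+r. (\<integral>\<^sup>+q. \<psi> (t - r) q * indicator {0<..} (q - r) \<partial>lborel) * indicator {0<..<t} r \<partial>lborel)"
  define X where "X = (\<integral>\<^sup>+r. (\<integral>\<^sup>+q. \<psi> (t - r) q * window r q \<partial>lborel) * indicator {0<..<t} r \<partial>lborel)"
  define Y where "Y = (\<integral>\<^sup>+u. p u * indicator {0<..<t} u \<partial>lborel)"
  have "(\<integral>\<^sup>+s. \<sigma> (s + t) * indicator {0<..} s \<partial>lborel) = (\<integral>\<^sup>+s. \<sigma> (s + t) * indicator {t<..} (s + t) \<partial>lborel)"
    by (intro nn_integral_cong) (auto split: split_indicator)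
  also have "\<dots> = A1"
    unfolding A1_def by (rule nn_integral_shift[where f="\<lambda>s. \<sigma> s * indicator {t<..} s"]) simp
  finally have L1: "(\<integral>\<^sup>+s. \<sigma> (s + t) * indicator {0<..} s \<partial>lborel) = A1" .
  have "(\<integral>\<^sup>+s. (\<integral>\<^sup>+r. \<psi> (t - r) (s + r) * indicator {0<..<t} r \<partial>lborel) * indicator {0<..} s \<partial>lborel)
      = (\<integral>\<^sup>+s. (\<integral>\<^sup>+r. \<psi> (t - r) (s + r) * indicator {0<..<t} r * indicator {0<..} s \<partial>lborel) \<partial>lborel)"
    by (simp add: nn_integral_multc)
  also have "\<dots> = (\<integral>\<^sup>+r. (\<integral>\<^sup>+s. \<psi> (t - r) (s + r) * indicator {0<..<t} r * indicator {0<..} s \<partial>lborel) \<partial>lborel)"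
    by (rule lborel_pair.Fubini') simp
  also have "\<dots> = (\<integral>\<^sup>+r. (\<integral>\<^sup>+s. (\<lambda>q. \<psi> (t - r) q * indicator {0<..} (q - r)) (s + r) \<partial>lborel) * indicator {0<..<t} r \<partial>lborel)"
    by (subst nn_integral_multc[symmetric]) (auto intro!: nn_integral_cong split: split_indicator)
  also have "\<dots> = A2"
    unfolding A2_def by (subst nn_integral_shift) simp_all
  finally have L2: "(\<integral>\<^sup>+s. (\<integral>\<^sup>+r. \<psi> (t - r) (s + r) * indicator {0<..<t} r \<partial>lborel) * indicator {0<..} s \<partial>lborel) = A2" .
  have "A2 + X = (\<integral>\<^sup>+r. ((\<integral>\<^sup>+q. \<psi> (t - r) q * indicator {0<..} (q - r) \<partial>lborel) + (\<integral>\<^sup>+q. \<psi> (t - r) q * window r q \<partial>lborel)) * indicator {0<..<t} r \<partial>lborel)"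
    unfolding A2_def X_def by (subst nn_integral_add[symmetric]) (simp_all add: distrib_right)
  also have "\<dots> = (\<integral>\<^sup>+r. (\<lambda>u. p u * indicator {0<..<t} u) (t - r) \<partial>lborel)"
  proof (intro nn_integral_cong)
    fix r :: real
    show "((\<integral>\<^sup>+q. \<psi> (t - r) q * indicator {0<..} (q - r) \<partial>lborel) + (\<integral>\<^sup>+q. \<psi> (t - r) q * window r q \<partial>lborel)) * indicator {0<..<t} r
      = p (t - r) * indicator {0<..<t} (t - r)"
    proof (cases "0 < r \<and> r < t")
      case True
      have "(\<integral>\<^sup>+q. \<psi> (t - r) q * indicator {0<..} (q - r) \<partial>lborel) + (\<integral>\<^sup>+q. \<psi> (t - r) q * window r q \<partial>lborel)
        = (\<integral>\<^sup>+q. \<psi> (t - r) q * indicator {0<..} (q - r) + \<psi> (t - r) q * window r q \<partial>lborel)"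
        by (rule nn_integral_add[symmetric]) simp_all
      also have "\<dots> = (\<integral>\<^sup>+q. \<psi> (t - r) q * indicator {0<..} q \<partial>lborel)"
        by (rule nn_integral_cong_AE)
          (use AE_lborel_singleton[of r] True in \<open>auto split: split_indicator\<close>)
      finally show ?thesis using p2[of "t - r"] True by simp
    qed auto
  qed
  also have "\<dots> = Y"
  proof -
    let ?g = "\<lambda>u. (\<integral>\<^sup>+r. \<psi> u r * indicator {0<..} r \<partial>lborel) * indicator {0<..<t} u"
    have e: "p u * indicator {0<..<t} u = ?g u" for u
      using p2[of u] by (auto split: split_indicator)
    show ?thesis unfolding Y_def e
      by (rule nn_integral_reflect) simp
  qed
  finally have L3: "A2 + X = Y" .
  have "Y = (\<integral>\<^sup>+u. (\<sigma> u + (\<integral>\<^sup>+r. \<psi> (u - r) r * window u r \<partial>lborel)) * indicator {0<..<t} u \<partial>lborel)"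
    unfolding Y_def by (intro nn_integral_cong) (use p1 in \<open>auto split: split_indicator\<close>)
  also have "\<dots> = B + (\<integral>\<^sup>+u. (\<integral>\<^sup>+r. \<psi> (u - r) r * window u r \<partial>lborel) * indicator {0<..<t} u \<partial>lborel)"
    unfolding B_def by (subst nn_integral_add[symmetric]) (simp_all add: distrib_right)
  also have "(\<integral>\<^sup>+u. (\<integral>\<^sup>+r. \<psi> (u - r) r * window u r \<partial>lborel) * indicator {0<..<t} u \<partial>lborel) = X"
  proof -
    \<comment> \<open>The substitution v = u - r turns 0 < r < u < t into the triangle v, r > 0, v +
      r < t. Writing the triangle as a product of indicators makes both changes of variable plain
      shifts.\<close>
    let ?h = "\<lambda>v q. \<psi> v q * indicator {0<..} v * indicator {0<..} q * indicator {..<t} (v + q)"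
    have "(\<integral>\<^sup>+u. (\<integral>\<^sup>+r. \<psi> (u - r) r * window u r \<partial>lborel) * indicator {0<..<t} u \<partial>lborel)
       = (\<integral>\<^sup>+u. (\<integral>\<^sup>+r. ?h (u - r) r \<partial>lborel) \<partial>lborel)"
      by (subst nn_integral_multc[symmetric]) (auto intro!: nn_integral_cong split: split_indicator)
    also have "\<dots> = (\<integral>\<^sup>+r. (\<integral>\<^sup>+u. ?h (u - r) r \<partial>lborel) \<partial>lborel)"
      by (rule lborel_pair.Fubini') simp
    also have "\<dots> = (\<integral>\<^sup>+r. (\<integral>\<^sup>+v. ?h v r \<partial>lborel) \<partial>lborel)"
    proof (rule nn_integral_cong)
      fix r :: real
      show "(\<integral>\<^sup>+u. ?h (u - r) r \<partial>lborel) = (\<integral>\<^sup>+v. ?h v r \<partial>lborel)"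
        using nn_integral_shift[of "\<lambda>v. ?h v r" "- r"] by simp
    qed
    also have "\<dots> = (\<integral>\<^sup>+v. (\<integral>\<^sup>+r. ?h v r \<partial>lborel) \<partial>lborel)"
      by (rule lborel_pair.Fubini') simp
    also have "\<dots> = (\<integral>\<^sup>+v. (\<lambda>v. \<integral>\<^sup>+r. ?h v r \<partial>lborel) (t - v) \<partial>lborel)"
      by (rule nn_integral_reflect[symmetric]) simp
    also have "\<dots> = X"
      unfolding X_def
      by (subst nn_integral_multc[symmetric]) (auto intro!: nn_integral_cong split: split_indicator)
    finally show ?thesis .
  qed
  finally have L4: "Y = B + X" .
  \<comment> \<open>This is where \<open>p3\<close> enters: \<open>X\<close> can be cancelled in
    \<open>ennreal\<close> only if it is finite.\<close>
  have "Y \<le> (\<integral>\<^sup>+u. indicator {0<..<t} u \<partial>lborel)"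
    unfolding Y_def by (intro nn_integral_mono) (use p3 in \<open>auto split: split_indicator\<close>)
  also have "\<dots> < \<infinity>" using t by simp
  finally have "Y < \<infinity>" .
  then have X: "X \<noteq> \<infinity>" using L3 by (auto simp: ennreal_add_eq_top)
  have A2B: "A2 = B" using L3 L4 X by (metis ennreal_add_left_cancel add.commute infinity_ennreal_def)
  have "(\<integral>\<^sup>+s. (\<sigma> (s + t) + (\<integral>\<^sup>+r. \<psi> (t - r) (s + r) * indicator {0<..<t} r \<partial>lborel)) * indicator {0<..} s \<partial>lborel) = A1 + A2"
    unfolding L1[symmetric] L2[symmetric]
    by (subst nn_integral_add[symmetric]) (simp_all add: distrib_right)
  also have "\<dots> = (\<integral>\<^sup>+s. \<sigma> s * indicator {t<..} s + \<sigma> s * indicator {0<..<t} s \<partial>lborel)"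
    unfolding A2B A1_def B_def by (rule nn_integral_add[symmetric]) simp_all
  also have "\<dots> = (\<integral>\<^sup>+s. \<sigma> s * indicator {0<..} s \<partial>lborel)"
    by (rule nn_integral_cong_AE)
       (use AE_lborel_singleton[of t] t in \<open>auto split: split_indicator\<close>)
  finally show ?thesis .
qed

section \<open>Integration against the law of the driving sequence\<close>

abbreviation "urge_sets \<equiv> (borel \<Otimes>\<^sub>M (borel \<Otimes>\<^sub>M borel) :: urge measure)"
abbreviation "waiting_law \<equiv> density lborel (exponential_density 1) :: real measure"
abbreviation "mark_law J \<equiv> uniform_measure lborel {0..1::real} \<Otimes>\<^sub>M interval_measure J"

lemma sets_urge_law [measurable_cong]: "sets (urge_law J) = sets urge_sets"
  unfolding urge_law_def by (intro sets_pair_measure_cong) auto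

lemma sets_driving_space [measurable_cong]: "sets (driving_space J) = sets (stream_space urge_sets)"
  unfolding driving_space_def by (rule sets_stream_space_cong) (rule sets_urge_law)

lemma prob_space_waiting_law: "prob_space waiting_law"
  by (rule prob_space_exponential_density) simp

lemma prob_space_mark_law:
  assumes "prob_space (interval_measure J)" shows "prob_space (mark_law J)"
proof -
  interpret J: prob_space "interval_measure J" by fact
  interpret U: prob_space "uniform_measure lborel {0..1::real}"
    by (rule prob_space_uniform_measure) auto
  interpret pair_prob_space "uniform_measure lborel {0..1::real}" "interval_measure J" ..
  show ?thesis by unfold_locales
qed

lemma prob_space_urge_law:
  assumes "prob_space (interval_measure J)" shows "prob_space (urge_law J)"
proof -
  interpret K: prob_space "mark_law J" by (rule prob_space_mark_law) fact
  interpret E: prob_space waiting_law by (rule prob_space_waiting_law)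
  interpret pair_prob_space waiting_law "mark_law J" ..
  show ?thesis unfolding urge_law_def by unfold_locales
qed

lemma prob_space_driving_space:
  assumes "prob_space (interval_measure J)" shows "prob_space (driving_space J)"
  unfolding driving_space_def
  by (rule prob_space.prob_space_stream_space) (rule prob_space_urge_law[OF assms])

lemma nn_integral_urge_law:
  assumes "prob_space (interval_measure J)" "f \<in> borel_measurable urge_sets"
  shows "(\<integral>\<^sup>+e. f e \<partial>urge_law J) = (\<integral>\<^sup>+s. \<integral>\<^sup>+m. f (s, m) \<partial>mark_law J \<partial>waiting_law)"
proof -
  interpret K: prob_space "mark_law J" by (rule prob_space_mark_law) fact
  interpret E: prob_space waiting_law by (rule prob_space_waiting_law)
  interpret P: pair_prob_space waiting_law "mark_law J" ..
  have "f \<in> borel_measurable (urge_law J)" using assms(2) measurable_cong_sets[OF sets_urge_law refl] by blast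
  then show ?thesis unfolding urge_law_def by (intro K.nn_integral_fst[symmetric])
qed

lemma nn_integral_driving_space:
  assumes "prob_space (interval_measure J)" "f \<in> borel_measurable (stream_space urge_sets)"
  shows "(\<integral>\<^sup>+\<omega>. f \<omega> \<partial>driving_space J)
     = (\<integral>\<^sup>+s. \<integral>\<^sup>+m. \<integral>\<^sup>+\<omega>. f ((s, m) ## \<omega>) \<partial>driving_space J \<partial>mark_law J \<partial>waiting_law)"
proof -
  interpret U: prob_space "urge_law J" by (rule prob_space_urge_law) fact
  interpret D: prob_space "driving_space J" by (rule prob_space_driving_space) fact
  note [measurable] = assms(2)
  have "f \<in> borel_measurable (stream_space (urge_law J))"
    using assms(2) sets_driving_space[of J] unfolding driving_space_def by (simp cong: measurable_cong_sets)
  then have "(\<integral>\<^sup>+\<omega>. f \<omega> \<partial>driving_space J) = (\<integral>\<^sup>+e. \<integral>\<^sup>+\<omega>. f (e ## \<omega>) \<partial>driving_space J \<partial>urge_law J)"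
    unfolding driving_space_def by (rule U.nn_integral_stream_space)
  also have "\<dots> = (\<integral>\<^sup>+s. \<integral>\<^sup>+m. \<integral>\<^sup>+\<omega>. f ((s, m) ## \<omega>) \<partial>driving_space J \<partial>mark_law J \<partial>waiting_law)"
    by (rule nn_integral_urge_law) (use assms(1) in simp_all)
  finally show ?thesis .
qed

lemma nn_integral_waiting_law:
  assumes [measurable]: "h \<in> borel_measurable borel"
  shows "(\<integral>\<^sup>+s. h s \<partial>waiting_law) = (\<integral>\<^sup>+s. ennreal (exp (- s)) * h s * indicator {0<..} s \<partial>lborel)"
proof -
  have "(\<integral>\<^sup>+s. h s \<partial>waiting_law) = (\<integral>\<^sup>+s. ennreal (exponential_density 1 s) * h s \<partial>lborel)"
    by (rule nn_integral_density) auto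
  also have "\<dots> = (\<integral>\<^sup>+s. ennreal (exp (- s)) * h s * indicator {0<..} s \<partial>lborel)"
    by (rule nn_integral_cong_AE)
       (use AE_lborel_singleton[of 0] in \<open>auto simp: exponential_density_def split: split_indicator\<close>)
  finally show ?thesis .
qed

lemma emeasure_waiting_law_greaterThan:
  assumes "0 \<le> t" shows "emeasure waiting_law {t<..} = ennreal (exp (- t))"
proof -
  interpret E: prob_space waiting_law by (rule prob_space_waiting_law)
  have d: "distributed waiting_law lborel (\<lambda>x. x) (exponential_density 1)"
    unfolding distributed_def by (auto simp: distr_id2)
  have "emeasure waiting_law {x \<in> space waiting_law. t < x} = ennreal (exp (- t))"
    unfolding E.emeasure_eq_measure using E.exponential_distributedD_gt[OF d assms] by simp
  then show ?thesis by (simp add: greaterThan_def)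
qed

text \<open>The form needed for conditioning on the first urge: if it comes after \<open>u\<close>,
  the integrand no longer depends on when, and \<open>exp (- u)\<close> is the probability of that
  event.\<close>

lemma nn_integral_waiting_law_split:
  assumes [measurable]: "h \<in> borel_measurable borel" and u: "0 \<le> u"
  shows "(\<integral>\<^sup>+s. (if u < s then c else h s) \<partial>waiting_law)
    = ennreal (exp (- u)) * c + (\<integral>\<^sup>+s. ennreal (exp (- s)) * h s * window u s \<partial>lborel)"
proof -
  have "(\<integral>\<^sup>+s. (if u < s then c else h s) \<partial>waiting_law) = (\<integral>\<^sup>+s. c * indicator {u<..} s + h s * indicator {..u} s \<partial>waiting_law)"
    by (intro nn_integral_cong) (auto split: split_indicator)
  also have "\<dots> = (\<integral>\<^sup>+s. c * indicator {u<..} s \<partial>waiting_law) + (\<integral>\<^sup>+s. h s * indicator {..u} s \<partial>waiting_law)"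
    by (rule nn_integral_add) simp_all
  also have "(\<integral>\<^sup>+s. c * indicator {u<..} s \<partial>waiting_law) = ennreal (exp (- u)) * c"
    by (subst nn_integral_cmult) (simp_all add: emeasure_waiting_law_greaterThan[OF u] mult.commute)
  also have "(\<integral>\<^sup>+s. h s * indicator {..u} s \<partial>waiting_law)
     = (\<integral>\<^sup>+s. ennreal (exp (- s)) * h s * window u s \<partial>lborel)"
    by (subst nn_integral_waiting_law, simp, rule nn_integral_cong_AE)
       (use AE_lborel_singleton[of u] in \<open>auto split: split_indicator\<close>)
  finally show ?thesis .
qed

section \<open>Urge times and the restart at the first urge\<close>

lemma urge_time_measurable [measurable]: "(\<lambda>\<omega>. urge_time \<omega> n) \<in> borel_measurable (stream_space urge_sets)"
  by (induction n) simp_all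

lemma urge_time_Stream: "urge_time (e ## \<omega>) (Suc n) = fst e + urge_time \<omega> n"
  by (induction n) simp_all

lemma urge_count_measurable [measurable (raw)]:
  assumes [measurable]: "\<omega> \<in> measurable M (stream_space urge_sets)" "t \<in> borel_measurable M"
  shows "(\<lambda>x. urge_count (\<omega> x) (t x)) \<in> measurable M (count_space UNIV)"
  unfolding urge_count_def by (rule measurable_Least) measurable

text \<open>The Laplace transform at 1 of a sum of \<open>n\<close> independent Exp(1) times;
  peeling off the head of the stream contributes a factor 1/2 each time.\<close>

lemma nn_integral_exp_urge_time:
  assumes "prob_space (interval_measure J)"
  shows "(\<integral>\<^sup>+\<omega>. ennreal (exp (- urge_time \<omega> n)) \<partial>driving_space J) = ennreal ((1/2) ^ n)"
proof (induction n)
  case 0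
  interpret D: prob_space "driving_space J" by (rule prob_space_driving_space) fact
  show ?case by (simp add: D.emeasure_space_1)
next
  case (Suc n)
  interpret K: prob_space "mark_law J" by (rule prob_space_mark_law) fact
  interpret D: prob_space "driving_space J" by (rule prob_space_driving_space) fact
  have i: "(\<integral>\<^sup>+s. ennreal (exp (- s)) \<partial>waiting_law) = ennreal (1/2)"
  proof -
    \<comment> \<open>The product of \<open>exp (- s)\<close> with the Exp(1) density is half the
      Exp(2) density, so its integral is 1/2.\<close>
    interpret E: prob_space "density lborel (exponential_density 2)"
      by (rule prob_space_exponential_density) simp
    have "(\<integral>\<^sup>+s. ennreal (exp (- s)) \<partial>waiting_law) = (\<integral>\<^sup>+s. ennreal (1/2) * ennreal (exponential_density 2 s) \<partial>lborel)"
      by (subst nn_integral_waiting_law, simp, rule nn_integral_cong_AE)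
        (use AE_lborel_singleton[of 0] in eventually_elim,
         auto simp: exponential_density_def ennreal_mult'[symmetric] exp_add[symmetric] mult_ac simp del: ennreal_half split: split_indicator)
    also have "\<dots> = ennreal (1/2) * (\<integral>\<^sup>+s. ennreal (exponential_density 2 s) \<partial>lborel)"
      by (rule nn_integral_cmult) simp
    also have "(\<integral>\<^sup>+s. ennreal (exponential_density 2 s) \<partial>lborel) = 1"
      using E.emeasure_space_1 by (simp add: emeasure_density)
    finally show ?thesis by simp
  qed
  have "(\<integral>\<^sup>+\<omega>. ennreal (exp (- urge_time \<omega> (Suc n))) \<partial>driving_space J)
    = (\<integral>\<^sup>+s. \<integral>\<^sup>+m. \<integral>\<^sup>+\<omega>. ennreal (exp (- urge_time ((s, m) ## \<omega>) (Suc n))) \<partial>driving_space J \<partial>mark_law J \<partial>waiting_law)"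
    by (rule nn_integral_driving_space[OF assms]) (simp del: urge_time.simps)
  also have "\<dots> = (\<integral>\<^sup>+s. \<integral>\<^sup>+m. ennreal (exp (- s)) * ennreal ((1/2)^n) \<partial>mark_law J \<partial>waiting_law)"
  proof (rule nn_integral_cong, rule nn_integral_cong)
    fix s m
    have "(\<integral>\<^sup>+\<omega>. ennreal (exp (- urge_time ((s, m) ## \<omega>) (Suc n))) \<partial>driving_space J)
       = (\<integral>\<^sup>+\<omega>. ennreal (exp (- s)) * ennreal (exp (- urge_time \<omega> n)) \<partial>driving_space J)"
      unfolding urge_time_Stream by (simp add: ennreal_mult'[symmetric] exp_add[symmetric])
    also have "\<dots> = ennreal (exp (- s)) * ennreal ((1/2)^n)"
      by (subst nn_integral_cmult) (simp_all add: Suc)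
    finally show "(\<integral>\<^sup>+\<omega>. ennreal (exp (- urge_time ((s, m) ## \<omega>) (Suc n))) \<partial>driving_space J) = \<dots>" .
  qed
  also have "\<dots> = ennreal (1/2) * ennreal ((1/2)^n)"
    by (simp add: K.emeasure_space_1 nn_integral_multc i)
  finally show ?case by (simp add: ennreal_mult'[symmetric] del: ennreal_half urge_time.simps)
qed

text \<open>Markov's inequality: where all urge times stay below \<open>t\<close>, the variable
  \<open>exp (- urge_time \<omega> (Suc n))\<close> is at least \<open>exp (- t)\<close>, but its
  mean tends to 0. Outside this null set the \<open>LEAST\<close> in \<open>urge_count\<close> is
  attained.\<close>

lemma AE_urge_time_unbounded:
  assumes J: "prob_space (interval_measure J)"
  shows "AE \<omega> in driving_space J. \<exists>n. t < urge_time \<omega> (Suc n)"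
proof -
  let ?A = "{\<omega> \<in> space (driving_space J). \<not> (\<exists>n. t < urge_time \<omega> (Suc n))}"
  have [measurable]: "?A \<in> sets (driving_space J)" by measurable
  have le: "ennreal (exp (- t)) * emeasure (driving_space J) ?A \<le> ennreal ((1/2)^Suc n)" for n
  proof -
    have "ennreal (exp (- t)) * emeasure (driving_space J) ?A = (\<integral>\<^sup>+\<omega>. ennreal (exp (- t)) * indicator ?A \<omega> \<partial>driving_space J)"
      by (rule nn_integral_cmult_indicator[symmetric]) simp
    also have "\<dots> \<le> (\<integral>\<^sup>+\<omega>. ennreal (exp (- urge_time \<omega> (Suc n))) \<partial>driving_space J)"
      by (intro nn_integral_mono) (auto split: split_indicator simp: not_less simp del: urge_time.simps intro!: ennreal_leI)
    finally show ?thesis unfolding nn_integral_exp_urge_time[OF J] .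
  qed
  have "ennreal (exp (- t)) * emeasure (driving_space J) ?A \<le> 0"
  proof (rule LIMSEQ_le_const)
    show "(\<lambda>n. ennreal ((1/2)^Suc n)) \<longlonglongrightarrow> 0"
      unfolding ennreal_0[symmetric]
      by (intro tendsto_ennrealI LIMSEQ_Suc LIMSEQ_power_zero) simp
  qed (use le in auto)
  then have "emeasure (driving_space J) ?A = 0" by simp
  then show ?thesis by (intro AE_I[of _ _ ?A]) auto
qed

text \<open>The part of \<open>urge_step\<close> that follows the drift. Separating it from the
  waiting time makes it possible to speak of the position just before and just after an
  urge.\<close>

definition mark_step :: "(real \<Rightarrow> real) \<Rightarrow> (real \<Rightarrow> real) \<Rightarrow> real \<Rightarrow> real \<times> real \<Rightarrow> real \<Rightarrow> real" where
  "mark_step \<eta> \<gamma> BR m y = (if fst m \<le> eta_bar \<eta> y \<gamma> then min BR (y + snd m) else y)"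

lemma urge_step_eq: "urge_step \<eta> \<gamma> w BL BR (s, m) x = mark_step \<eta> \<gamma> BR m (drift w BL s x)"
  by (simp add: urge_step_def mark_step_def Let_def case_prod_beta)

lemma drift_drift:
  assumes "0 \<le> w" "0 \<le> s" "0 \<le> t"
  shows "drift w BL t (drift w BL s x) = drift w BL (s + t) x"
  using mult_nonneg_nonneg[OF assms(1,2)] mult_nonneg_nonneg[OF assms(1,3)]
  by (auto simp: drift_def algebra_simps max_def)

lemma urge_pos_Stream:
  "urge_pos \<eta> \<gamma> w BL BR x (e ## \<omega>) (Suc n) = urge_pos \<eta> \<gamma> w BL BR (urge_step \<eta> \<gamma> w BL BR e x) \<omega> n"
  by (induction n) simp_all

text \<open>Dropping the head of the stream lowers all urge indices by one. For the
  \<open>LEAST\<close> in \<open>urge_count\<close> this shift is legitimate where it is attained,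
  hence the hypothesis.\<close>

lemma particle_Stream:
  assumes "\<exists>n. t - s < urge_time \<omega> (Suc n)"
  shows "particle \<eta> \<gamma> w BL BR x ((s, m) ## \<omega>) t =
    (if t < s then drift w BL t x else particle \<eta> \<gamma> w BL BR (mark_step \<eta> \<gamma> BR m (drift w BL s x)) \<omega> (t - s))"
proof (cases "t < s")
  case True
  then have "urge_count ((s, m) ## \<omega>) t = 0"
    unfolding urge_count_def by (intro Least_eq_0) simp
  then show ?thesis using True by (simp add: particle_def)
next
  case False
  from assms obtain n where "t - s < urge_time \<omega> (Suc n)" by blast
  then have n: "t < urge_time ((s, m) ## \<omega>) (Suc (Suc n))"
    unfolding urge_time_Stream by simp
  have "urge_count ((s, m) ## \<omega>) t = Suc (LEAST n. t < urge_time ((s, m) ## \<omega>) (Suc (Suc n)))"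
    unfolding urge_count_def by (rule Least_Suc[where n="Suc n"]) (use n False in simp_all)
  also have "(LEAST n. t < urge_time ((s, m) ## \<omega>) (Suc (Suc n))) = urge_count \<omega> (t - s)"
    unfolding urge_count_def urge_time_Stream by (simp add: algebra_simps del: urge_time.simps)
  finally show ?thesis using False
    by (simp add: particle_def urge_pos_Stream urge_time_Stream urge_step_eq Let_def algebra_simps del: urge_pos.simps urge_time.simps)
qed

text \<open>Here \<gamma> is frozen and enters only through the acceptance rate, so the process is a
  linear object. The fixed point condition comes in when the delay equation is derived.\<close>

locale frame_process =
  fixes \<eta> J \<gamma> :: "real \<Rightarrow> real" and w BL BR :: real
  assumes eta_bar_measurable [measurable]: "(\<lambda>y. eta_bar \<eta> y \<gamma>) \<in> borel_measurable borel"
    and J: "prob_space (interval_measure J)"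
    and w: "0 < w" and frame: "- BL < BR"
begin

abbreviation "flow \<equiv> drift w BL"
abbreviation "step \<equiv> mark_step \<eta> \<gamma> BR"
abbreviation "position \<equiv> particle \<eta> \<gamma> w BL BR"
abbreviation "rate y \<equiv> eta_bar \<eta> y \<gamma>"
abbreviation "jump_law \<equiv> interval_measure J"
abbreviation "law_at M t \<equiv> distr (M \<Otimes>\<^sub>M driving_space J) borel (\<lambda>(x, \<omega>). position x \<omega> t)"

lemma mark_step_measurable [measurable (raw)]:
  assumes [measurable]: "m \<in> M \<rightarrow>\<^sub>M (borel \<Otimes>\<^sub>M borel)" "y \<in> borel_measurable M"
  shows "(\<lambda>a. step (m a) (y a)) \<in> borel_measurable M"
proof -
  have [measurable]: "(\<lambda>a. eta_bar \<eta> (y a) \<gamma>) \<in> borel_measurable M"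
    using measurable_compose[OF assms(2) eta_bar_measurable] .
  show ?thesis unfolding mark_step_def by measurable
qed

lemma drift_measurable [measurable (raw)]:
  assumes [measurable]: "s \<in> borel_measurable M" "x \<in> borel_measurable M"
  shows "(\<lambda>a. flow (s a) (x a)) \<in> borel_measurable M"
  unfolding drift_def by measurable

lemma urge_pos_measurable:
  assumes [measurable]: "x \<in> borel_measurable M" "\<omega> \<in> M \<rightarrow>\<^sub>M stream_space urge_sets"
  shows "(\<lambda>a. urge_pos \<eta> \<gamma> w BL BR (x a) (\<omega> a) n) \<in> borel_measurable M"
proof (induction n)
  case (Suc n)
  note [measurable] = Suc
  have e: "urge_step \<eta> \<gamma> w BL BR e z = step (snd e) (flow (fst e) z)" for e z
    using urge_step_eq[of _ _ _ _ _ "fst e" "snd e"] by simp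
  show ?case unfolding urge_pos.simps e by measurable
qed simp

lemma particle_measurable [measurable (raw)]:
  assumes [measurable]: "x \<in> borel_measurable M" "\<omega> \<in> M \<rightarrow>\<^sub>M stream_space urge_sets" "t \<in> borel_measurable M"
  shows "(\<lambda>a. position (x a) (\<omega> a) (t a)) \<in> borel_measurable M"
proof -
  note [measurable] = urge_pos_measurable
  have "(\<lambda>a. (\<lambda>n a. flow (t a - urge_time (\<omega> a) n) (urge_pos \<eta> \<gamma> w BL BR (x a) (\<omega> a) n)) (urge_count (\<omega> a) (t a)) a)
     \<in> borel_measurable M"
    by (rule measurable_compose_countable) measurable
  then show ?thesis by (simp add: particle_def Let_def)
qed

sublocale mk: prob_space "mark_law J" by (rule prob_space_mark_law) (rule J)
sublocale dr: prob_space "driving_space J" by (rule prob_space_driving_space) (rule J)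

section \<open>Transition semigroup, and stationarity from invariance before urges\<close>

definition semigroup :: "(real \<Rightarrow> ennreal) \<Rightarrow> real \<Rightarrow> real \<Rightarrow> ennreal" where
  "semigroup f t x = (\<integral>\<^sup>+\<omega>. f (position x \<omega> t) \<partial>driving_space J)"

lemma semigroup_measurable [measurable (raw)]:
  assumes [measurable]: "f \<in> borel_measurable borel" "t \<in> borel_measurable M" "x \<in> borel_measurable M"
  shows "(\<lambda>a. semigroup f (t a) (x a)) \<in> borel_measurable M"
proof -
  have [measurable]: "(\<lambda>p. \<integral>\<^sup>+\<omega>. f (position (snd p) \<omega> (fst p)) \<partial>driving_space J) \<in> borel_measurable (borel \<Otimes>\<^sub>M borel)"
    by (rule dr.borel_measurable_nn_integral) measurable
  have "(\<lambda>a. (\<lambda>p. \<integral>\<^sup>+\<omega>. f (position (snd p) \<omega> (fst p)) \<partial>driving_space J) (t a, x a)) \<in> borel_measurable M"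
    by measurable
  then show ?thesis by (simp add: semigroup_def)
qed

definition urge_op :: "(real \<Rightarrow> ennreal) \<Rightarrow> real \<Rightarrow> ennreal" where
  "urge_op g y = (\<integral>\<^sup>+m. g (step m y) \<partial>mark_law J)"

lemma urge_op_measurable [measurable (raw)]:
  assumes g[measurable]: "(\<lambda>(a, z). g a z) \<in> borel_measurable (M \<Otimes>\<^sub>M borel)" and [measurable]: "y \<in> borel_measurable M"
  shows "(\<lambda>a. urge_op (g a) (y a)) \<in> borel_measurable M"
  unfolding urge_op_def by (rule mk.borel_measurable_nn_integral) measurable

lemma semigroup_le_1: "(\<And>x. f x \<le> 1) \<Longrightarrow> semigroup f t x \<le> 1"
  unfolding semigroup_def
  by (rule order_trans[OF nn_integral_mono[where v="\<lambda>_. 1"]]) (simp_all add: dr.emeasure_space_1)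

text \<open>Conditioning on the first urge time and restarting there by
  \<open>particle_Stream\<close>, whose hypothesis holds almost surely by
  \<open>AE_urge_time_unbounded\<close>.\<close>

lemma semigroup_first_urge:
  assumes [measurable]: "f \<in> borel_measurable borel" and t: "0 \<le> t"
  shows "semigroup f t x = ennreal (exp (- t)) * f (flow t x)
    + (\<integral>\<^sup>+s. ennreal (exp (- s)) * urge_op (semigroup f (t - s)) (flow s x)
          * window t s \<partial>lborel)"
proof -
  have "semigroup f t x = (\<integral>\<^sup>+s. \<integral>\<^sup>+m. \<integral>\<^sup>+\<omega>. f (position x ((s, m) ## \<omega>) t) \<partial>driving_space J \<partial>mark_law J \<partial>waiting_law)"
    unfolding semigroup_def by (rule nn_integral_driving_space[OF J]) simp
  also have "\<dots> = (\<integral>\<^sup>+s. \<integral>\<^sup>+m. \<integral>\<^sup>+\<omega>. (if t < s then f (flow t x) else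
      f (position (step m (flow s x)) \<omega> (t - s))) \<partial>driving_space J \<partial>mark_law J \<partial>waiting_law)"
  proof (rule nn_integral_cong, rule nn_integral_cong)
    fix s m
    show "(\<integral>\<^sup>+\<omega>. f (position x ((s, m) ## \<omega>) t) \<partial>driving_space J) =
      (\<integral>\<^sup>+\<omega>. (if t < s then f (flow t x) else
      f (position (step m (flow s x)) \<omega> (t - s))) \<partial>driving_space J)"
      by (rule nn_integral_cong_AE, use AE_urge_time_unbounded[OF J, of "t - s"] in eventually_elim)
         (simp add: particle_Stream)
  qed
  also have "\<dots> = (\<integral>\<^sup>+s. (if t < s then f (flow t x) else urge_op (semigroup f (t - s)) (flow s x)) \<partial>waiting_law)"
    by (intro nn_integral_cong) (auto simp: dr.emeasure_space_1 mk.emeasure_space_1 urge_op_def semigroup_def)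
  also have "\<dots> = ennreal (exp (- t)) * f (flow t x)
    + (\<integral>\<^sup>+s. ennreal (exp (- s)) * urge_op (semigroup f (t - s)) (flow s x)
          * window t s \<partial>lborel)"
    by (rule nn_integral_waiting_law_split) (use t in simp_all)
  finally show ?thesis .
qed

lemma emeasure_distr_particle:
  assumes "real_distribution M" and B[measurable]: "B \<in> sets borel"
  shows "emeasure (law_at M t) B
    = (\<integral>\<^sup>+x. semigroup (indicator B) t x \<partial>M)"
proof -
  interpret M: real_distribution M by fact
  interpret P: pair_prob_space M "driving_space J" ..
  have "emeasure (law_at M t) B
     = (\<integral>\<^sup>+y. indicator B y \<partial>law_at M t)"
    by simp
  also have "\<dots> = (\<integral>\<^sup>+p. indicator B (position (fst p) (snd p) t) \<partial>(M \<Otimes>\<^sub>M driving_space J))"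
    by (subst nn_integral_distr) (simp_all add: case_prod_beta)
  also have "\<dots> = (\<integral>\<^sup>+x. \<integral>\<^sup>+\<omega>. indicator B (position x \<omega> t) \<partial>driving_space J \<partial>M)"
    by (subst dr.nn_integral_fst[symmetric]) simp_all
  finally show ?thesis by (simp add: semigroup_def)
qed

text \<open>\<open>M\<close> is the law just before an urge; let \<open>\<rho>\<close> be the law
  just after it. Then \<open>M\<close> is \<open>\<rho>\<close> after an Exp(1) time of drift, so
  the law at time \<open>t\<close> is an integral over that time, and conditioning on the next urge
  brings it into the shape treated by \<open>renewal_identity\<close>.\<close>

theorem stationary_of_urge_invariant:
  assumes M: "real_distribution M"
    and inv: "\<And>f. f \<in> borel_measurable borel \<Longrightarrow> (\<integral>\<^sup>+x. f x \<partial>M) =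
      (\<integral>\<^sup>+x. \<integral>\<^sup>+m. \<integral>\<^sup>+s. f (flow s (step m x)) \<partial>waiting_law \<partial>mark_law J \<partial>M)"
    and t: "0 \<le> t"
  shows "law_at M t = M"
proof (rule measure_eqI)
  interpret M: real_distribution M by fact
  interpret MK: pair_prob_space M "mark_law J" ..
  interpret E: prob_space waiting_law by (rule prob_space_waiting_law)
  fix B assume "B \<in> sets (law_at M t)"
  then have [measurable]: "B \<in> sets borel" by simp
  define f where "f = (indicator B :: real \<Rightarrow> ennreal)"
  have [measurable]: "f \<in> borel_measurable borel" unfolding f_def by simp
  define \<rho> where "\<rho> = distr (M \<Otimes>\<^sub>M mark_law J) borel (\<lambda>p. step (snd p) (fst p))"
  have [measurable_cong]: "sets \<rho> = sets borel" by (simp add: \<rho>_def)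
  interpret R: prob_space \<rho> unfolding \<rho>_def by (rule MK.prob_space_distr) simp
  have \<rho>: "(\<integral>\<^sup>+y. g y \<partial>\<rho>) = (\<integral>\<^sup>+x. urge_op g x \<partial>M)" if [measurable]: "g \<in> borel_measurable borel" for g
    unfolding \<rho>_def urge_op_def
    by (subst nn_integral_distr) (simp_all add: mk.nn_integral_fst[symmetric])
  have D: "(\<integral>\<^sup>+x. g x \<partial>M) = (\<integral>\<^sup>+y. \<integral>\<^sup>+s. g (flow s y) \<partial>waiting_law \<partial>\<rho>)"
    if [measurable]: "g \<in> borel_measurable borel" for g
    by (subst \<rho>) (simp_all add: inv[OF that] urge_op_def[abs_def])
  have D': "(\<integral>\<^sup>+x. g x \<partial>M) = (\<integral>\<^sup>+s. ennreal (exp (- s)) * (\<integral>\<^sup>+y. g (flow s y) \<partial>\<rho>) * indicator {0<..} s \<partial>lborel)"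
    if [measurable]: "g \<in> borel_measurable borel" for g
  proof -
    interpret P: pair_sigma_finite lborel \<rho> ..
    have "(\<integral>\<^sup>+x. g x \<partial>M) = (\<integral>\<^sup>+y. \<integral>\<^sup>+s. ennreal (exp (- s)) * g (flow s y) * indicator {0<..} s \<partial>lborel \<partial>\<rho>)"
      by (simp add: D nn_integral_waiting_law)
    also have "\<dots> = (\<integral>\<^sup>+s. \<integral>\<^sup>+y. ennreal (exp (- s)) * g (flow s y) * indicator {0<..} s \<partial>\<rho> \<partial>lborel)"
      by (rule P.Fubini') simp
    also have "\<dots> = (\<integral>\<^sup>+s. ennreal (exp (- s)) * (\<integral>\<^sup>+y. g (flow s y) \<partial>\<rho>) * indicator {0<..} s \<partial>lborel)"
      by (simp add: nn_integral_multc nn_integral_cmult)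
    finally show ?thesis .
  qed
  \<comment> \<open>All three start from \<open>\<rho>\<close>: \<open>\<sigma> s\<close> is the
    contribution of no urge up to \<open>s\<close>, \<open>\<psi> u r\<close> the density for a
    first urge at \<open>r\<close> with time \<open>u\<close> left after it, and \<open>p u\<close>
    the full expectation at \<open>u\<close>.\<close>
  define \<sigma> where "\<sigma> s = ennreal (exp (- s)) * (\<integral>\<^sup>+y. f (flow s y) \<partial>\<rho>)" for s
  define \<psi> where "\<psi> u r = ennreal (exp (- r)) * (\<integral>\<^sup>+y. urge_op (semigroup f u) (flow r y) \<partial>\<rho>)" for u r
  define p where "p u = (\<integral>\<^sup>+y. semigroup f u y \<partial>\<rho>)" for u
  have [measurable]: "\<sigma> \<in> borel_measurable borel" unfolding \<sigma>_def by measurable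
  have [measurable]: "(\<lambda>(u, r). \<psi> u r) \<in> borel_measurable (borel \<Otimes>\<^sub>M borel)"
    unfolding \<psi>_def by measurable
  interpret RP: pair_sigma_finite lborel \<rho> ..
  let ?Q = "\<lambda>u r y. urge_op (semigroup f u) (flow r y)"
  \<comment> \<open>The map \<open>h\<close> serves two uses: the identity for \<open>p\<close>, and
    \<open>flow s\<close> for \<open>M\<close>, where a time \<open>s\<close> of the waiting period
    has already passed.\<close>
  have first_urge: "(\<integral>\<^sup>+y. semigroup f u (h y) \<partial>\<rho>) = ennreal (exp (- u)) * (\<integral>\<^sup>+y. f (flow u (h y)) \<partial>\<rho>)
      + (\<integral>\<^sup>+r. ennreal (exp (- r)) * (\<integral>\<^sup>+y. ?Q (u - r) r (h y) \<partial>\<rho>) * window u r \<partial>lborel)"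
    if u: "0 \<le> u" and [measurable]: "h \<in> borel_measurable borel" for u h
  proof -
    have "(\<integral>\<^sup>+y. semigroup f u (h y) \<partial>\<rho>) = (\<integral>\<^sup>+y. ennreal (exp (- u)) * f (flow u (h y))
       + (\<integral>\<^sup>+r. ennreal (exp (- r)) * ?Q (u - r) r (h y) * window u r \<partial>lborel) \<partial>\<rho>)"
      by (rule nn_integral_cong, rule semigroup_first_urge) (use u in simp_all)
    also have "\<dots> = (\<integral>\<^sup>+y. ennreal (exp (- u)) * f (flow u (h y)) \<partial>\<rho>)
       + (\<integral>\<^sup>+y. \<integral>\<^sup>+r. ennreal (exp (- r)) * ?Q (u - r) r (h y) * window u r \<partial>lborel \<partial>\<rho>)"
      by (rule nn_integral_add) simp_all
    also have "(\<integral>\<^sup>+y. \<integral>\<^sup>+r. ennreal (exp (- r)) * ?Q (u - r) r (h y) * window u r \<partial>lborel \<partial>\<rho>)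
       = (\<integral>\<^sup>+r. \<integral>\<^sup>+y. ennreal (exp (- r)) * ?Q (u - r) r (h y) * window u r \<partial>\<rho> \<partial>lborel)"
      by (rule RP.Fubini') simp
    finally show ?thesis by (simp add: nn_integral_cmult nn_integral_multc)
  qed
  have "(\<integral>\<^sup>+s. (\<sigma> (s + t) + (\<integral>\<^sup>+r. \<psi> (t - r) (s + r) * indicator {0<..<t} r \<partial>lborel)) * indicator {0<..} s \<partial>lborel)
    = (\<integral>\<^sup>+s. \<sigma> s * indicator {0<..} s \<partial>lborel)"
  proof (rule renewal_identity[where p=p])
    fix u :: real assume u: "0 < u"
    show "p u = \<sigma> u + (\<integral>\<^sup>+r. \<psi> (u - r) r * window u r \<partial>lborel)"
      using first_urge[of u "\<lambda>y. y"] u unfolding p_def \<sigma>_def \<psi>_def by simp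
    show "p u = (\<integral>\<^sup>+r. \<psi> u r * indicator {0<..} r \<partial>lborel)"
      unfolding p_def \<psi>_def by (subst \<rho>) (simp_all add: D')
    show "p u \<le> 1"
      unfolding p_def
      by (rule order_trans[OF nn_integral_mono[where v="\<lambda>_. 1"]])
        (auto intro!: semigroup_le_1 simp: f_def R.emeasure_space_1 split: split_indicator)
  qed (use t in simp_all)
  moreover have "(\<integral>\<^sup>+x. semigroup f t x \<partial>M) = (\<integral>\<^sup>+s. (\<sigma> (s + t) + (\<integral>\<^sup>+r. \<psi> (t - r) (s + r) * indicator {0<..<t} r \<partial>lborel)) * indicator {0<..} s \<partial>lborel)"
  proof (subst D', simp, rule nn_integral_cong)
    fix s :: real
    show "ennreal (exp (- s)) * (\<integral>\<^sup>+y. semigroup f t (flow s y) \<partial>\<rho>) * indicator {0<..} s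
      = (\<sigma> (s + t) + (\<integral>\<^sup>+r. \<psi> (t - r) (s + r) * indicator {0<..<t} r \<partial>lborel)) * indicator {0<..} s"
    proof (cases "0 < s")
      case True
      have split: "ennreal (exp (- (s + x))) = ennreal (exp (- s)) * ennreal (exp (- x))" for x
        by (simp add: ennreal_mult'[symmetric] exp_add[symmetric])
      have "\<psi> (t - r) (s + r) * indicator {0<..<t} r = ennreal (exp (- s)) *
          (ennreal (exp (- r)) * (\<integral>\<^sup>+y. ?Q (t - r) r (flow s y) \<partial>\<rho>) * window t r)" for r
        unfolding \<psi>_def split using w True by (auto simp: drift_drift mult_ac split: split_indicator)
      moreover have "\<sigma> (s + t) = ennreal (exp (- s)) * (ennreal (exp (- t)) * (\<integral>\<^sup>+y. f (flow t (flow s y)) \<partial>\<rho>))"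
        unfolding \<sigma>_def split using w True t by (simp add: drift_drift mult_ac)
      ultimately show ?thesis
        using True by (simp add: first_urge[OF t] distrib_left nn_integral_cmult)
    qed simp
  qed
  moreover have "emeasure M B = (\<integral>\<^sup>+x. f x \<partial>M)" unfolding f_def by simp
  then have "emeasure M B = (\<integral>\<^sup>+s. \<sigma> s * indicator {0<..} s \<partial>lborel)"
    by (simp add: D' \<sigma>_def)
  ultimately show "emeasure (law_at M t) B = emeasure M B"
    by (simp add: emeasure_distr_particle[OF M] f_def)
qed (use M in \<open>simp add: real_distribution.events_eq_borel\<close>)

section \<open>Uniqueness of the stationary law\<close>

lemma ennreal_add_diff_add_cancel:
  fixes a b c :: ennreal
  assumes "c \<noteq> \<top>" shows "(c + a) - (c + b) = a - b"
  using assms by (simp add: diff_add_eq_diff_diff_swap_ennreal)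

text \<open>The bound \<open>x \<le> BR\<close> is recorded because it forces the particle to
  \<open>- BL\<close> after a time \<open>(BR + BL) / w\<close> without urges.\<close>

definition stationary_law :: "real measure \<Rightarrow> bool" where
  "stationary_law M \<longleftrightarrow> real_distribution M \<and> (AE x in M. x \<le> BR) \<and>
     (\<forall>t\<ge>0. law_at M t = M)"

text \<open>Doeblin's argument: at time \<open>T\<close> a mass \<open>\<epsilon>\<close> sits at \<open>- BL\<close> whatever the start, hence
  the largest discrepancy between two stationary laws shrinks by the factor \<open>1 - \<epsilon>\<close>.\<close>

lemma stationary_unique_aux:
  assumes S1: "stationary_law M1" and S2: "stationary_law M2" and B: "B \<in> sets borel"
  shows "emeasure M1 B \<le> emeasure M2 B"
proof -
  interpret M1: real_distribution M1 using S1 by (simp add: stationary_law_def)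
  interpret M2: real_distribution M2 using S2 by (simp add: stationary_law_def)
  define T where "T = (BR + BL) / w"
  have T: "0 < T" unfolding T_def using w frame by simp
  define \<epsilon> where "\<epsilon> = exp (- T)"
  have \<epsilon>: "0 < \<epsilon>" "\<epsilon> < 1" unfolding \<epsilon>_def using T by simp_all
  define r where "r h x = (\<integral>\<^sup>+s. ennreal (exp (- s)) * urge_op (semigroup h (T - s)) (flow s x)
          * window T s \<partial>lborel)" for h x
  have [measurable]: "r h \<in> borel_measurable borel" if [measurable]: "h \<in> borel_measurable borel" for h
    unfolding r_def by measurable
  have sg: "semigroup h T x = ennreal \<epsilon> * h (flow T x) + r h x"
    if "h \<in> borel_measurable borel" for h x
    unfolding r_def \<epsilon>_def using semigroup_first_urge[OF that] T by simp
  have r_mono: "r h x \<le> r (\<lambda>_. 1) x" if "\<And>x. h x \<le> 1" for h x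
    unfolding r_def urge_op_def semigroup_def
    by (intro nn_integral_mono mult_right_mono mult_left_mono that) auto
  have r1: "r h x \<le> ennreal (1 - \<epsilon>)" if "\<And>x. h x \<le> 1" for h x
  proof -
    have "ennreal \<epsilon> + r (\<lambda>_. 1) x \<le> 1"
      using sg[of "\<lambda>_. 1" x] semigroup_le_1[of "\<lambda>_. 1" T x] by simp
    also have "1 = ennreal \<epsilon> + ennreal (1 - \<epsilon>)"
      using \<epsilon> by (simp add: ennreal_plus[symmetric] del: ennreal_plus)
    finally have "r (\<lambda>_. 1) x \<le> ennreal (1 - \<epsilon>)" by simp
    then show ?thesis using r_mono[of h x] that order_trans by blast
  qed
  have dT: "flow T x = - BL" if "x \<le> BR" for x
    using that w unfolding drift_def T_def by simp
  have int_eq: "(\<integral>\<^sup>+x. h x \<partial>M) = ennreal \<epsilon> * h (- BL) + (\<integral>\<^sup>+x. r h x \<partial>M)"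
    if S: "stationary_law M" and h[measurable]: "h \<in> borel_measurable borel" for M h
  proof -
    have c: "AE x in M. x \<le> BR"
      and s: "law_at M T = M"
      using S T by (auto simp: stationary_law_def)
    interpret M: real_distribution M using S by (simp add: stationary_law_def)
    interpret P: pair_prob_space M "driving_space J" ..
    have "(\<integral>\<^sup>+x. h x \<partial>M) = (\<integral>\<^sup>+x. h x \<partial>law_at M T)"
      by (simp add: s)
    also have "\<dots> = (\<integral>\<^sup>+p. h (position (fst p) (snd p) T) \<partial>(M \<Otimes>\<^sub>M driving_space J))"
      by (subst nn_integral_distr) (simp_all add: case_prod_beta)
    also have "\<dots> = (\<integral>\<^sup>+x. semigroup h T x \<partial>M)"
      by (subst dr.nn_integral_fst[symmetric]) (simp_all add: semigroup_def[abs_def])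
    also have "\<dots> = (\<integral>\<^sup>+x. ennreal \<epsilon> * h (- BL) + r h x \<partial>M)"
      by (rule nn_integral_cong_AE) (use c in \<open>eventually_elim, simp add: sg dT\<close>)
    also have "\<dots> = ennreal \<epsilon> * h (- BL) + (\<integral>\<^sup>+x. r h x \<partial>M)"
      by (subst nn_integral_add) (simp_all add: M.emeasure_space_1[simplified])
    finally show ?thesis .
  qed
  \<comment> \<open>Test functions with values in [0,1]: this class is stable under passing from
    \<open>h\<close> to \<open>r h / (1 - \<epsilon>)\<close>, which closes the contraction.
    Subtraction in \<open>ennreal\<close> makes \<open>\<Delta>\<close> a one-sided discrepancy;
    exchanging the two laws gives the other side.\<close>
  define H where "H = {h :: real \<Rightarrow> ennreal. h \<in> borel_measurable borel \<and> (\<forall>x. h x \<le> 1)}"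
  define \<Delta> where "\<Delta> = (SUP h\<in>H. (\<integral>\<^sup>+x. h x \<partial>M1) - (\<integral>\<^sup>+x. h x \<partial>M2))"
  have contr: "(\<integral>\<^sup>+x. h x \<partial>M1) - (\<integral>\<^sup>+x. h x \<partial>M2) \<le> ennreal (1 - \<epsilon>) * \<Delta>" if h: "h \<in> H" for h
  proof -
    from h have [measurable]: "h \<in> borel_measurable borel" and h1: "\<And>x. h x \<le> 1" by (auto simp: H_def)
    define k where "k x = r h x / ennreal (1 - \<epsilon>)" for x
    have [measurable]: "k \<in> borel_measurable borel" unfolding k_def by measurable
    have "k x \<le> 1" for x
    proof -
      have "k x \<le> ennreal (1 - \<epsilon>) / ennreal (1 - \<epsilon>)" unfolding k_def by (intro divide_right_mono_ennreal r1 h1)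
      also have "\<dots> = 1" using \<epsilon> by (intro ennreal_divide_self) auto
      finally show ?thesis .
    qed
    then have kH: "k \<in> H" by (simp add: H_def)
    have rk: "r h x = ennreal (1 - \<epsilon>) * k x" for x
      using \<epsilon> unfolding k_def
      by (simp add: ennreal_times_divide mult.commute[of "ennreal (1 - \<epsilon>)"] ennreal_mult_divide_eq)
    have "(\<integral>\<^sup>+x. h x \<partial>M1) - (\<integral>\<^sup>+x. h x \<partial>M2) = (\<integral>\<^sup>+x. r h x \<partial>M1) - (\<integral>\<^sup>+x. r h x \<partial>M2)"
    proof -
      have "ennreal \<epsilon> * h (- BL) \<le> 1 * 1" using h1 \<epsilon> by (intro mult_mono) auto
      then have "ennreal \<epsilon> * h (- BL) < \<top>" by (rule le_less_trans) simp
      then have "ennreal \<epsilon> * h (- BL) \<noteq> \<top>" by simp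
      then show ?thesis
        using T by (simp add: int_eq[OF S1, of h] int_eq[OF S2, of h] ennreal_add_diff_add_cancel)
    qed
    also have "\<dots> = ennreal (1 - \<epsilon>) * ((\<integral>\<^sup>+x. k x \<partial>M1) - (\<integral>\<^sup>+x. k x \<partial>M2))"
      by (simp add: rk nn_integral_cmult ennreal_right_diff_distrib)
    also have "\<dots> \<le> ennreal (1 - \<epsilon>) * \<Delta>"
      unfolding \<Delta>_def using kH by (intro mult_left_mono SUP_upper) auto
    finally show ?thesis .
  qed
  then have le: "\<Delta> \<le> ennreal (1 - \<epsilon>) * \<Delta>"
    by (subst \<Delta>_def) (rule SUP_least)
  \<comment> \<open>The value \<infinity> would also satisfy the contraction inequality
    \<open>le\<close>, so finiteness has to be known first.\<close>
  have "\<Delta> \<le> 1"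
    unfolding \<Delta>_def
  proof (rule SUP_least)
    fix h assume "h \<in> H"
    then have "(\<integral>\<^sup>+x. h x \<partial>M1) \<le> (\<integral>\<^sup>+x. 1 \<partial>M1)" by (intro nn_integral_mono) (auto simp: H_def)
    also have "\<dots> = 1" using M1.emeasure_space_1 by simp
    finally show "(\<integral>\<^sup>+x. h x \<partial>M1) - (\<integral>\<^sup>+x. h x \<partial>M2) \<le> 1"
      by (rule order_trans[OF diff_le_self_ennreal])
  qed
  then obtain \<delta> where \<delta>: "0 \<le> \<delta>" "\<Delta> = ennreal \<delta>"
    by (cases \<Delta>) (auto simp: top_unique)
  have "\<delta> \<le> (1 - \<epsilon>) * \<delta>"
    using le \<epsilon> \<delta> by (simp add: ennreal_mult'[symmetric])
  then have "\<epsilon> * \<delta> \<le> 0" by (simp add: algebra_simps)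
  then have "\<delta> = 0" using \<epsilon> \<delta>(1) by (simp add: mult_le_0_iff)
  then have "\<Delta> = 0" using \<delta> by simp
  moreover have "(\<integral>\<^sup>+x. indicator B x \<partial>M1) - (\<integral>\<^sup>+x. indicator B x \<partial>M2) \<le> \<Delta>"
    unfolding \<Delta>_def using B by (intro SUP_upper) (auto simp: H_def split: split_indicator)
  ultimately show ?thesis using B by (simp add: diff_eq_0_iff_ennreal)
qed

theorem stationary_unique:
  assumes "stationary_law M1" and "stationary_law M2"
  shows "M1 = M2"
proof (rule measure_eqI)
  show s: "sets M1 = sets M2" using assms by (simp add: stationary_law_def real_distribution.events_eq_borel)
  fix B assume "B \<in> sets M1"
  then have "B \<in> sets borel" using assms(1) by (simp add: stationary_law_def real_distribution.events_eq_borel)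
  then show "emeasure M1 B = emeasure M2 B"
    by (intro antisym stationary_unique_aux assms)
qed

end

section \<open>Laws in which drift and jumps balance\<close>

text \<open>An atom of mass \<open>a\<close> at \<open>b\<close> plus the density \<open>\<phi>\<close> on \<open>[b, R]\<close>; the atom arises by
  collapsing the interval \<open>(b - 1, b)\<close>.\<close>

definition boundary_mixture :: "real \<Rightarrow> real \<Rightarrow> ennreal \<Rightarrow> (real \<Rightarrow> ennreal) \<Rightarrow> real measure" where
  "boundary_mixture b R a \<phi> =
     distr (density lborel (\<lambda>x. a * indicator {b - 1<..<b} x + \<phi> x * indicator {b..R} x)) borel (max b)"

lemma sets_boundary_mixture [measurable_cong, simp]: "sets (boundary_mixture b R a \<phi>) = sets borel"
  by (simp add: boundary_mixture_def)

lemma nn_integral_boundary_mixture: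
  assumes [measurable]: "\<phi> \<in> borel_measurable borel" "f \<in> borel_measurable borel"
  shows "(\<integral>\<^sup>+x. f x \<partial>boundary_mixture b R a \<phi>) = a * f b + (\<integral>\<^sup>+x. f x * \<phi> x * indicator {b..R} x \<partial>lborel)"
proof -
  have "(\<integral>\<^sup>+x. f x \<partial>boundary_mixture b R a \<phi>)
    = (\<integral>\<^sup>+x. (a * indicator {b - 1<..<b} x + \<phi> x * indicator {b..R} x) * f (max b x) \<partial>lborel)"
    unfolding boundary_mixture_def by (simp add: nn_integral_distr nn_integral_density)
  also have "\<dots> = (\<integral>\<^sup>+x. a * f b * indicator {b - 1<..<b} x + f x * \<phi> x * indicator {b..R} x \<partial>lborel)"
    by (intro nn_integral_cong) (auto split: split_indicator simp: mult.commute)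
  also have "\<dots> = a * f b + (\<integral>\<^sup>+x. f x * \<phi> x * indicator {b..R} x \<partial>lborel)"
    by (subst nn_integral_add) (simp_all add: nn_integral_cmult)
  finally show ?thesis .
qed

locale frame_kernel = frame_process +
  assumes eta_bar_01: "\<And>y. 0 \<le> rate y" "\<And>y. rate y \<le> 1"
    and J_nonneg: "AE z in jump_law. 0 \<le> z"
begin

sublocale J: real_distribution jump_law
  by (intro real_distribution.intro real_distribution_axioms.intro J) simp

text \<open>The probability that an urge at \<open>x\<close> carries the particle across \<open>s\<close>; the cut-off at
  \<open>BR\<close> can be ignored here because it does not affect levels \<open>s < BR\<close>.\<close>

definition jump_over :: "real \<Rightarrow> real \<Rightarrow> ennreal" where
  "jump_over x s = ennreal (rate x) * (\<integral>\<^sup>+z. indicator {0..} (s - x) * indicator {0<..} (x + z - s) \<partial>jump_law)"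

definition crossing_rate :: "real measure \<Rightarrow> real \<Rightarrow> ennreal" where
  "crossing_rate M s = (\<integral>\<^sup>+x. jump_over x s \<partial>M)"

lemma jump_over_measurable [measurable (raw)]:
  assumes [measurable]: "f \<in> borel_measurable M" "g \<in> borel_measurable M"
  shows "(\<lambda>a. jump_over (f a) (g a)) \<in> borel_measurable M"
proof -
  have [measurable]: "(\<lambda>p. jump_over (fst p) (snd p)) \<in> borel_measurable (borel \<Otimes>\<^sub>M borel)"
    unfolding jump_over_def by measurable
  have "(\<lambda>a. (\<lambda>p. jump_over (fst p) (snd p)) (f a, g a)) \<in> borel_measurable M" by measurable
  then show ?thesis by simp
qed

lemma jump_over_le_1: "jump_over x s \<le> 1"
proof -
  have "(\<integral>\<^sup>+z. indicator {0..} (s - x) * indicator {0<..} (x + z - s) \<partial>jump_law) \<le> (\<integral>\<^sup>+z. 1 \<partial>jump_law)"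
    by (intro nn_integral_mono) (auto split: split_indicator)
  then have "(\<integral>\<^sup>+z. indicator {0..} (s - x) * indicator {0<..} (x + z - s) \<partial>jump_law) \<le> 1"
    using J.emeasure_space_1 by simp
  moreover have "ennreal (rate x) \<le> 1" using eta_bar_01 by simp
  ultimately have "jump_over x s \<le> 1 * 1" unfolding jump_over_def by (intro mult_mono) auto
  then show ?thesis by simp
qed

lemma jump_over_eq_0: "s < x \<Longrightarrow> jump_over x s = 0"
  unfolding jump_over_def by simp

lemma urge_op_eq:
  assumes [measurable]: "g \<in> borel_measurable borel"
  shows "urge_op g y = ennreal (rate y) * (\<integral>\<^sup>+z. g (min BR (y + z)) \<partial>jump_law)
    + ennreal (1 - rate y) * g y"
proof -
  let ?U = "uniform_measure lborel {0..1::real}" and ?e = "rate y"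
  interpret U: prob_space ?U by (rule prob_space_uniform_measure) auto
  interpret P: pair_prob_space ?U "jump_law" ..
  have "urge_op g y = (\<integral>\<^sup>+u. \<integral>\<^sup>+z. g (if u \<le> ?e then min BR (y + z) else y) \<partial>jump_law \<partial>?U)"
    unfolding urge_op_def mark_step_def by (subst J.nn_integral_fst[symmetric]) (simp_all cong: if_cong)
  also have "\<dots> = (\<integral>\<^sup>+u. (\<integral>\<^sup>+z. g (min BR (y + z)) \<partial>jump_law) * indicator {..?e} u + g y * indicator {?e<..} u \<partial>?U)"
    using J.emeasure_space_1 by (intro nn_integral_cong) (auto split: split_indicator)
  also have "\<dots> = (\<integral>\<^sup>+z. g (min BR (y + z)) \<partial>jump_law) * emeasure ?U {..?e} + g y * emeasure ?U {?e<..}"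
    by (subst nn_integral_add) (simp_all add: nn_integral_cmult)
  also have "emeasure ?U {..?e} = ennreal ?e"
  proof -
    have "{0..1} \<inter> {..?e} = {0..?e}" using eta_bar_01[of y] by auto
    then show ?thesis using eta_bar_01[of y] by (simp add: emeasure_uniform_measure divide_ennreal_def)
  qed
  also have "emeasure ?U {?e<..} = ennreal (1 - ?e)"
  proof -
    have "{0..1} \<inter> {?e<..} = {?e<..1}" using eta_bar_01[of y] by auto
    then show ?thesis using eta_bar_01[of y] by (simp add: emeasure_uniform_measure divide_ennreal_def)
  qed
  finally show ?thesis by (simp add: mult.commute)
qed

text \<open>The mass of the atom is left existential; it is determined by the total mass 1.\<close>

definition balanced :: "real measure \<Rightarrow> bool" where
  "balanced M \<longleftrightarrow> real_distribution M \<and>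
     (\<exists>a. M = boundary_mixture (- BL) BR a (\<lambda>s. ennreal (1 / w) * crossing_rate M s))"

lemma crossing_rate_measurable [measurable]:
  assumes "real_distribution M"
  shows "crossing_rate M \<in> borel_measurable borel"
proof -
  interpret M: real_distribution M by fact
  show ?thesis unfolding crossing_rate_def[abs_def] by measurable
qed

lemma balanced_supported:
  assumes "balanced M" shows "AE x in M. - BL \<le> x \<and> x \<le> BR"
proof -
  from assms obtain a where M: "real_distribution M"
    and M_eq: "M = boundary_mixture (- BL) BR a (\<lambda>s. ennreal (1 / w) * crossing_rate M s)"
    unfolding balanced_def by blast
  interpret M: real_distribution M by fact
  note [measurable] = crossing_rate_measurable[OF M]
  have "(\<integral>\<^sup>+x. indicator (- {- BL..BR}) x \<partial>M) = 0"
    using frame by (subst M_eq, subst nn_integral_boundary_mixture) (auto simp: nn_integral_0_iff_AE split: split_indicator)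
  then have "emeasure M (- {- BL..BR}) = 0" by simp
  then show ?thesis by (intro AE_I[where N="- {- BL..BR}"]) auto
qed

text \<open>With \<open>\<phi> x\<close> the probability that a particle started at \<open>x\<close> is above \<open>y\<close> at the next urge,
  and \<open>k\<close> the derivative of \<open>w \<phi>\<close>, the drift equation reads \<open>\<phi> + k = 1\<close> above \<open>y\<close>; the balance
  of \<open>M\<close> pairs \<open>k\<close> with the crossing rate.\<close>

lemma urge_invariant_of_balanced:
  assumes "balanced M" and [measurable]: "f \<in> borel_measurable borel"
  shows "(\<integral>\<^sup>+x. f x \<partial>M) =
      (\<integral>\<^sup>+x. \<integral>\<^sup>+m. \<integral>\<^sup>+s. f (flow s (step m x)) \<partial>waiting_law \<partial>mark_law J \<partial>M)"
proof -
  from assms(1) obtain a where M: "real_distribution M"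
    and M_eq: "M = boundary_mixture (- BL) BR a (\<lambda>s. ennreal (1 / w) * crossing_rate M s)"
    unfolding balanced_def by blast
  interpret M: real_distribution M by fact
  interpret E: prob_space waiting_law by (rule prob_space_waiting_law)
  interpret ME: pair_prob_space "mark_law J" waiting_law ..
  interpret MME: pair_prob_space M "mark_law J \<Otimes>\<^sub>M waiting_law" ..
  note [measurable] = crossing_rate_measurable[OF M]
  have int_M: "(\<integral>\<^sup>+x. g x \<partial>M) = a * g (- BL) + (\<integral>\<^sup>+s. g s * (ennreal (1 / w) * crossing_rate M s) * indicator {- BL..BR} s \<partial>lborel)"
    if [measurable]: "g \<in> borel_measurable borel" for g
    by (subst M_eq) (rule nn_integral_boundary_mixture; simp)
  note supp = balanced_supported[OF assms(1)]
  define N where "N = distr (M \<Otimes>\<^sub>M (mark_law J \<Otimes>\<^sub>M waiting_law)) borel (\<lambda>p. flow (snd (snd p)) (step (fst (snd p)) (fst p)))"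
  have N: "real_distribution N" unfolding N_def by (rule MME.real_distribution_distr) simp
  then interpret N: real_distribution N .
  have int_N: "(\<integral>\<^sup>+x. g x \<partial>N) = (\<integral>\<^sup>+x. \<integral>\<^sup>+m. \<integral>\<^sup>+s. g (flow s (step m x)) \<partial>waiting_law \<partial>mark_law J \<partial>M)"
    if [measurable]: "g \<in> borel_measurable borel" for g
    unfolding N_def by (simp add: nn_integral_distr E.nn_integral_fst[symmetric] ME.P.nn_integral_fst[symmetric])
  have tail: "emeasure N {y<..} = emeasure M {y<..}" for y
  proof (cases "y < - BL")
    case True
    have "AE x in M. x \<in> {y<..}" using supp by eventually_elim (use True in auto)
    then have "emeasure M {y<..} = 1" by (simp add: M.emeasure_eq_1_AE)
    moreover have "emeasure N {y<..} = (\<integral>\<^sup>+x. indicator {y<..} x \<partial>N)" by simp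
    moreover have "\<dots> = 1"
    proof -
      have "indicator {y<..} (flow s x) = (1::ennreal)" for s x
        using True by (auto simp: drift_def split: split_indicator)
      then show ?thesis
        by (subst int_N) (simp_all add: E.emeasure_space_1[simplified] mk.emeasure_space_1 M.emeasure_space_1[simplified])
    qed
    ultimately show ?thesis by simp
  next
    case False
    then have y: "- BL \<le> y" by simp
    define \<phi> where "\<phi> x = (\<integral>\<^sup>+s. indicator {y<..} (flow s x) \<partial>waiting_law)" for x
    define k where "k s = ennreal (exp (- (s - y) / w)) * indicator {y<..} s" for s
    have [measurable]: "\<phi> \<in> borel_measurable borel" unfolding \<phi>_def by measurable
    have [measurable]: "k \<in> borel_measurable borel" unfolding k_def by measurable
    have dr: "y < flow s x \<longleftrightarrow> s < (x - y) / w" for s x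
      using y w by (auto simp: drift_def max_def field_simps)
    \<comment> \<open>Writing \<open>\<phi>\<close> as the integral of its derivative turns its
      increment along a jump into an integral over the levels crossed, which is what
      \<open>jump_over\<close> measures.\<close>
    have \<phi>_int: "\<phi> x = (\<integral>\<^sup>+s. ennreal (1 / w) * k s * indicator {..<x} s \<partial>lborel)" for x
    proof -
      have "\<phi> x = (\<integral>\<^sup>+s. ennreal (exp (- s)) * indicator {y<..} (flow s x) * indicator {0<..} s \<partial>lborel)"
        unfolding \<phi>_def by (rule nn_integral_waiting_law) simp
      also have "\<dots> = (\<integral>\<^sup>+s. ennreal w * (ennreal (1 / w) * k (y + w * s) * indicator {..<x} (y + w * s)) \<partial>lborel)"
      proof (rule nn_integral_cong)
        fix s
        have "ennreal w * ennreal (1 / w) = 1" using w by (simp add: ennreal_mult'[symmetric])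
        then have "ennreal w * (ennreal (1 / w) * k (y + w * s) * indicator {..<x} (y + w * s)) = k (y + w * s) * indicator {..<x} (y + w * s)"
          by (simp add: mult.assoc[symmetric])
        also have "\<dots> = ennreal (exp (- s)) * indicator {y<..} (flow s x) * indicator {0<..} s"
          unfolding k_def using w dr[of s x] by (auto split: split_indicator simp: field_simps zero_less_mult_iff)
        finally show "ennreal (exp (- s)) * indicator {y<..} (flow s x) * indicator {0<..} s
           = ennreal w * (ennreal (1 / w) * k (y + w * s) * indicator {..<x} (y + w * s))" ..
      qed
      also have "\<dots> = (\<integral>\<^sup>+s. ennreal (1 / w) * k s * indicator {..<x} s \<partial>lborel)"
        using w by (subst nn_integral_real_affine[where c=w and t=y]) (simp_all add: nn_integral_cmult)
      finally show ?thesis .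
    qed
    have \<phi>_k: "\<phi> x + k x = indicator {y<..} x" for x
    proof (cases "y < x")
      case True
      then have t: "0 \<le> (x - y) / w" using w by simp
      have "\<phi> x + k x = (\<integral>\<^sup>+s. indicator {..<(x - y) / w} s \<partial>waiting_law) + (\<integral>\<^sup>+s. indicator {(x - y) / w<..} s \<partial>waiting_law)"
      proof (rule arg_cong2[where f="(+)"])
        show "\<phi> x = (\<integral>\<^sup>+s. indicator {..<(x - y) / w} s \<partial>waiting_law)"
          unfolding \<phi>_def by (intro nn_integral_cong) (auto split: split_indicator simp: dr)
        show "k x = (\<integral>\<^sup>+s. indicator {(x - y) / w<..} s \<partial>waiting_law)"
          using True emeasure_waiting_law_greaterThan[OF t] by (simp add: k_def minus_divide_left)
      qed
      also have "\<dots> = (\<integral>\<^sup>+s. indicator {..<(x - y) / w} s + indicator {(x - y) / w<..} s \<partial>waiting_law)"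
        by (rule nn_integral_add[symmetric]) simp_all
      also have "\<dots> = (\<integral>\<^sup>+s. 1 \<partial>waiting_law)"
      proof (rule nn_integral_cong_AE)
        have "AE s in waiting_law. s \<noteq> (x - y) / w"
          using AE_lborel_singleton[of "(x - y) / w"] by (subst AE_density) (auto elim: eventually_mono)
        then show "AE s in waiting_law. indicator {..<(x - y) / w} s + indicator {(x - y) / w<..} s = (1::ennreal)"
          by eventually_elim (auto split: split_indicator)
      qed
      also have "\<dots> = indicator {y<..} x" using E.emeasure_space_1 True by simp
      finally show ?thesis .
    next
      case False
      have "s < (x - y) / w \<longleftrightarrow> s < (x - y) / w \<and> s < 0" for s
        using False w by (meson divide_le_0_iff dual_order.strict_trans1 less_eq_real_def linorder_not_less diff_le_0_iff_le)
      then have "\<phi> x = 0"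
        unfolding \<phi>_int by (subst nn_integral_0_iff_AE) (use False in \<open>auto simp: k_def split: split_indicator\<close>)
      then show ?thesis using False by (simp add: k_def)
    qed
    let ?k = "\<lambda>s. ennreal (1 / w) * k s * indicator {- BL..BR} s"
    have step: "urge_op \<phi> x = \<phi> x + (\<integral>\<^sup>+s. ?k s * jump_over x s \<partial>lborel)"
      if x: "- BL \<le> x" "x \<le> BR" for x
    proof -
      let ?e = "ennreal (rate x)"
      let ?F = "\<lambda>z s. ?k s * (indicator {0..} (s - x) * indicator {0<..} (x + z - s)) :: ennreal"
      have "(\<integral>\<^sup>+z. \<phi> (min BR (x + z)) \<partial>jump_law)
         = (\<integral>\<^sup>+z. \<phi> x + (\<integral>\<^sup>+s. ?F z s \<partial>lborel) \<partial>jump_law)"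
      proof (rule nn_integral_cong_AE, use J_nonneg in eventually_elim)
        fix z :: real assume z: "0 \<le> z"
        have "\<phi> (min BR (x + z)) = (\<integral>\<^sup>+s. ennreal (1 / w) * k s * indicator {..<x} s + ?F z s \<partial>lborel)"
          unfolding \<phi>_int
          by (rule nn_integral_cong_AE, use AE_lborel_singleton[of BR] in eventually_elim)
             (use z x y in \<open>auto split: split_indicator simp: k_def\<close>)
        then show "\<phi> (min BR (x + z)) = \<phi> x + (\<integral>\<^sup>+s. ?F z s \<partial>lborel)"
          by (simp add: nn_integral_add \<phi>_int)
      qed
      also have "\<dots> = \<phi> x + (\<integral>\<^sup>+z. \<integral>\<^sup>+s. ?F z s \<partial>lborel \<partial>jump_law)"
        using J.emeasure_space_1 by (subst nn_integral_add) simp_all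
      also have "(\<integral>\<^sup>+z. \<integral>\<^sup>+s. ?F z s \<partial>lborel \<partial>jump_law) = (\<integral>\<^sup>+s. \<integral>\<^sup>+z. ?F z s \<partial>jump_law \<partial>lborel)"
      proof -
        interpret LJ: pair_sigma_finite lborel "jump_law" ..
        show ?thesis by (rule LJ.Fubini') simp
      qed
      finally have "urge_op \<phi> x = ?e * (\<phi> x + (\<integral>\<^sup>+s. \<integral>\<^sup>+z. ?F z s \<partial>jump_law \<partial>lborel)) + ennreal (1 - rate x) * \<phi> x"
        by (simp add: urge_op_eq)
      also have "\<dots> = (?e + ennreal (1 - rate x)) * \<phi> x + ?e * (\<integral>\<^sup>+s. \<integral>\<^sup>+z. ?F z s \<partial>jump_law \<partial>lborel)"
        by (simp add: distrib_left distrib_right add_ac)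
      also have "?e + ennreal (1 - rate x) = 1"
        using eta_bar_01[of x] by (simp add: ennreal_plus[symmetric] del: ennreal_plus)
      also have "?e * (\<integral>\<^sup>+s. \<integral>\<^sup>+z. ?F z s \<partial>jump_law \<partial>lborel)
         = (\<integral>\<^sup>+s. ?k s * jump_over x s \<partial>lborel)"
        unfolding jump_over_def
        by (subst nn_integral_cmult[symmetric], simp, rule nn_integral_cong)
           (simp add: nn_integral_cmult mult_ac)
      finally show ?thesis by simp
    qed
    have "emeasure N {y<..} = (\<integral>\<^sup>+x. indicator {y<..} x \<partial>N)" by simp
    also have "\<dots> = (\<integral>\<^sup>+x. urge_op \<phi> x \<partial>M)"
      by (subst int_N) (simp_all add: urge_op_def[abs_def] \<phi>_def[abs_def])
    also have "\<dots> = (\<integral>\<^sup>+x. \<phi> x + (\<integral>\<^sup>+s. ?k s * jump_over x s \<partial>lborel) \<partial>M)"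
      by (rule nn_integral_cong_AE) (use supp in \<open>eventually_elim, simp add: step\<close>)
    also have "\<dots> = (\<integral>\<^sup>+x. \<phi> x \<partial>M) + (\<integral>\<^sup>+x. \<integral>\<^sup>+s. ?k s * jump_over x s \<partial>lborel \<partial>M)"
      by (rule nn_integral_add) simp_all
    also have "(\<integral>\<^sup>+x. \<integral>\<^sup>+s. ?k s * jump_over x s \<partial>lborel \<partial>M)
        = (\<integral>\<^sup>+s. \<integral>\<^sup>+x. ?k s * jump_over x s \<partial>M \<partial>lborel)"
    proof -
      interpret LM: pair_sigma_finite lborel M ..
      show ?thesis by (rule LM.Fubini') simp
    qed
    also have "\<dots> = (\<integral>\<^sup>+s. ?k s * crossing_rate M s \<partial>lborel)"
      by (simp add: crossing_rate_def nn_integral_cmult)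
    \<comment> \<open>The atom contributes nothing, because \<open>\<phi>\<close> vanishes at
      \<open>- BL \<le> y\<close>.\<close>
    also have "(\<integral>\<^sup>+x. \<phi> x \<partial>M) = (\<integral>\<^sup>+s. \<phi> s * (ennreal (1 / w) * crossing_rate M s) * indicator {- BL..BR} s \<partial>lborel)"
      using \<phi>_k[of "- BL"] y by (subst int_M) simp_all
    also have "\<dots> + (\<integral>\<^sup>+s. ennreal (1 / w) * k s * indicator {- BL..BR} s * crossing_rate M s \<partial>lborel)
      = (\<integral>\<^sup>+s. (\<phi> s + k s) * (ennreal (1 / w) * crossing_rate M s) * indicator {- BL..BR} s \<partial>lborel)"
      by (subst nn_integral_add[symmetric]) (simp_all add: distrib_right distrib_left mult_ac)
    also have "\<dots> = (\<integral>\<^sup>+x. indicator {y<..} x \<partial>M)"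
      unfolding \<phi>_k using y by (subst int_M) simp_all
    finally show ?thesis by simp
  qed
  have "N = M"
  proof (rule cdf_unique[OF N M], rule ext)
    fix y
    have "measure N (UNIV - {y<..}) = measure M (UNIV - {y<..})"
      using tail[of y] N.prob_compl[of "{y<..}"] M.prob_compl[of "{y<..}"] by (simp add: measure_def)
    moreover have "UNIV - {y<..} = {..y}" by auto
    ultimately show "cdf N y = cdf M y" by (simp add: cdf_def)
  qed
  then show ?thesis using int_N[of f] by simp
qed

end

lemma distribution_function_cdf:
  assumes "real_distribution M"
  shows "distribution_function (cdf M)" and "interval_measure (cdf M) = M"
proof -
  interpret M: real_distribution M by fact
  show df: "distribution_function (cdf M)"
    unfolding distribution_function_def
    using M.cdf_nondecreasing M.cdf_is_right_cont M.cdf_lim_at_bot M.cdf_lim_at_top_prob by (auto simp: mono_def)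
  have "real_distribution (interval_measure (cdf M))" "cdf (interval_measure (cdf M)) = cdf M"
    using df by (auto simp: distribution_function_def mono_def intro!: real_distribution_interval_measure cdf_interval_measure)
  then show "interval_measure (cdf M) = M" using assms cdf_unique by blast
qed

lemma distribution_function_measure:
  assumes "distribution_function F"
  shows "real_distribution (interval_measure F)" and "cdf (interval_measure F) = F"
  using assms by (auto simp: distribution_function_def mono_def intro!: real_distribution_interval_measure cdf_interval_measure)

section \<open>Existence of balanced laws and the value of the frame operator\<close>

context frame_kernel begin

text \<open>Iterates for the crossing rate under an unnormalised law whose atom has mass 1. The
  equation is of Volterra type because \<open>jump_over x s\<close> vanishes for
  \<open>s < x\<close>.\<close>

primrec crossing_iter :: "nat \<Rightarrow> real \<Rightarrow> ennreal" where
  "crossing_iter 0 = (\<lambda>s. 0)"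
| "crossing_iter (Suc n) = (\<lambda>s. jump_over (- BL) s +
     (\<integral>\<^sup>+x. jump_over x s * (ennreal (1 / w) * crossing_iter n x) * indicator {- BL..BR} x \<partial>lborel))"

lemma crossing_iter_measurable [measurable]: "crossing_iter n \<in> borel_measurable borel"
  by (induction n) simp_all

lemma crossing_iter_mono: "crossing_iter n s \<le> crossing_iter (Suc n) s"
proof (induction n arbitrary: s)
  case (Suc n)
  show ?case
    unfolding crossing_iter.simps(2)[of "Suc n"] crossing_iter.simps(2)[of n]
    by (intro add_left_mono nn_integral_mono mult_right_mono mult_left_mono Suc[unfolded crossing_iter.simps]) auto
qed simp

text \<open>Gronwall: the exponential solves the same equation with \<open>jump_over\<close>
  replaced by its upper bound 1 on x \<le> s.\<close>

lemma crossing_iter_bound: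
  assumes "- BL \<le> s"
  shows "crossing_iter n s \<le> ennreal (exp ((s + BL) / w))"
  using assms
proof (induction n arbitrary: s)
  case (Suc n)
  have "crossing_iter (Suc n) s \<le> 1 + (\<integral>\<^sup>+x. ennreal (1 / w * exp ((x + BL) / w)) * indicator {- BL..s} x \<partial>lborel)"
    unfolding crossing_iter.simps
  proof (intro add_mono jump_over_le_1 nn_integral_mono)
    fix x
    show "jump_over x s * (ennreal (1 / w) * crossing_iter n x) * indicator {- BL..BR} x
       \<le> ennreal (1 / w * exp ((x + BL) / w)) * indicator {- BL..s} x"
    proof (cases "- BL \<le> x \<and> x \<le> s")
      case True
      have "jump_over x s * (ennreal (1 / w) * crossing_iter n x) * indicator {- BL..BR} x
         \<le> 1 * (ennreal (1 / w) * ennreal (exp ((x + BL) / w))) * 1"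
        using True by (intro mult_mono jump_over_le_1 Suc.IH) (auto split: split_indicator)
      then show ?thesis using True w by (simp add: ennreal_mult'[symmetric])
    qed (auto simp: jump_over_eq_0)
  qed
  also have "(\<integral>\<^sup>+x. ennreal (1 / w * exp ((x + BL) / w)) * indicator {- BL..s} x \<partial>lborel)
     = ennreal (exp ((s + BL) / w) - exp ((- BL + BL) / w))"
    by (rule nn_integral_FTC_Icc) (use w Suc.prems in \<open>auto intro!: derivative_eq_intros simp: field_simps\<close>)
  also have "1 + \<dots> = ennreal (exp ((s + BL) / w))"
    using w Suc.prems by (subst ennreal_1[symmetric], subst ennreal_plus[symmetric]) auto
  finally show ?case .
qed simp

text \<open>The increasing limit of the iterates solves the linear equation. Its total mass
  \<open>m\<close> is finite by the Gronwall bound and at least 1 because of the atom, so dividing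
  by \<open>m\<close> gives a probability law with the same balance.\<close>

lemma ex_balanced: "\<exists>M. balanced M"
proof -
  define \<phi> where "\<phi> s = (SUP n. crossing_iter n s)" for s
  have [measurable]: "\<phi> \<in> borel_measurable borel" unfolding \<phi>_def by measurable
  have inc: "incseq (\<lambda>n. crossing_iter n s)" for s
    by (intro incseq_SucI crossing_iter_mono)
  let ?I = "\<lambda>g s. (\<integral>\<^sup>+x. jump_over x s * (ennreal (1 / w) * g x) * indicator {- BL..BR} x \<partial>lborel)"
  have \<phi>_eq: "\<phi> s = jump_over (- BL) s + ?I \<phi> s" for s
  proof -
    have incI: "incseq (\<lambda>n x. jump_over x s * (ennreal (1 / w) * crossing_iter n x) * indicator {- BL..BR} x)"
      by (intro incseq_SucI le_funI mult_right_mono mult_left_mono crossing_iter_mono) auto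
    have "?I \<phi> s = (\<integral>\<^sup>+x. (SUP n. jump_over x s * (ennreal (1 / w) * crossing_iter n x) * indicator {- BL..BR} x) \<partial>lborel)"
      unfolding \<phi>_def by (simp add: SUP_mult_left_ennreal SUP_mult_right_ennreal)
    also have "\<dots> = (SUP n. ?I (crossing_iter n) s)"
      using incI by (rule nn_integral_monotone_convergence_SUP) simp
    finally have I: "?I \<phi> s = (SUP n. ?I (crossing_iter n) s)" .
    have "\<phi> s = (SUP n. crossing_iter (Suc n) s)"
      unfolding \<phi>_def
    proof (rule antisym)
      show "(SUP n. crossing_iter n s) \<le> (SUP n. crossing_iter (Suc n) s)"
        by (rule SUP_mono, rule bexI, rule crossing_iter_mono) simp
      show "(SUP n. crossing_iter (Suc n) s) \<le> (SUP n. crossing_iter n s)"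
        by (rule SUP_least, rule SUP_upper) simp
    qed
    also have "\<dots> = (SUP n. jump_over (- BL) s + ?I (crossing_iter n) s)"
      by simp
    also have "\<dots> = jump_over (- BL) s + (SUP n. ?I (crossing_iter n) s)"
      by (rule ennreal_SUP_add_right[symmetric]) simp
    finally show ?thesis unfolding I .
  qed
  have bound: "\<phi> s \<le> ennreal (exp ((BR + BL) / w))" if "s \<in> {- BL..BR}" for s
    unfolding \<phi>_def
  proof (rule SUP_least)
    fix n
    have "crossing_iter n s \<le> ennreal (exp ((s + BL) / w))" using that by (intro crossing_iter_bound) simp
    also have "\<dots> \<le> ennreal (exp ((BR + BL) / w))" using that w by (intro ennreal_leI) (simp add: divide_right_mono)
    finally show "crossing_iter n s \<le> ennreal (exp ((BR + BL) / w))" .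
  qed
  define m where "m = 1 + (\<integral>\<^sup>+s. ennreal (1 / w) * \<phi> s * indicator {- BL..BR} s \<partial>lborel)"
  have "(\<integral>\<^sup>+s. ennreal (1 / w) * \<phi> s * indicator {- BL..BR} s \<partial>lborel)
     \<le> (\<integral>\<^sup>+s. ennreal (1 / w) * ennreal (exp ((BR + BL) / w)) * indicator {- BL..BR} s \<partial>lborel)"
    using bound by (intro nn_integral_mono) (auto intro!: mult_left_mono split: split_indicator)
  also have "\<dots> < \<infinity>" using frame by (simp add: nn_integral_cmult ennreal_mult_less_top)
  finally have m: "m \<noteq> 0" "m \<noteq> \<top>" unfolding m_def by auto
  define c where "c = inverse m"
  have cm: "c * m = 1" unfolding c_def using m by (simp add: divide_ennreal_def[symmetric] mult.commute ennreal_divide_self less_top[symmetric])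
  define M where "M = boundary_mixture (- BL) BR c (\<lambda>s. ennreal (1 / w) * (c * \<phi> s))"
  have [measurable_cong]: "sets M = sets borel" by (simp add: M_def)
  have int_M: "(\<integral>\<^sup>+x. g x \<partial>M) = c * (g (- BL) + (\<integral>\<^sup>+s. g s * (ennreal (1 / w) * \<phi> s) * indicator {- BL..BR} s \<partial>lborel))"
    if [measurable]: "g \<in> borel_measurable borel" for g
    unfolding M_def
    by (subst nn_integral_boundary_mixture, simp, simp, subst distrib_left, subst nn_integral_cmult[symmetric], simp)
       (simp add: mult_ac)
  have "emeasure M (space M) = (\<integral>\<^sup>+x. 1 \<partial>M)" by simp
  also have "\<dots> = c * m" by (subst int_M) (simp_all add: m_def)
  finally have M: "real_distribution M"
    by (intro real_distribution.intro prob_spaceI real_distribution_axioms.intro) (simp_all add: cm M_def)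
  have cr: "crossing_rate M s = c * \<phi> s" for s
    unfolding crossing_rate_def by (subst int_M, simp) (subst \<phi>_eq, simp)
  have "balanced M" unfolding balanced_def
    by (intro conjI M exI[of _ c], unfold cr, fact M_def)
  then show ?thesis ..
qed

text \<open>Resolves the \<open>THE\<close>: invariance before urges supplies a stationary law, and
  \<open>stationary_unique\<close> excludes any other.\<close>

lemma frame_operator_eq_cdf:
  assumes b: "balanced M"
  shows "frame_operator \<eta> J w BL BR \<gamma> = cdf M"
  unfolding frame_operator_def
proof (rule the_equality)
  have M: "real_distribution M" using b by (simp add: balanced_def)
  then interpret M: real_distribution M .
  note sM = balanced_supported[OF b]
  have st: "law_at M t = M" if "0 \<le> t" for t
    using stationary_of_urge_invariant[OF M urge_invariant_of_balanced[OF b] that] .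
  have "measure M {- BL..BR} = 1" using sM by (subst M.prob_eq_1) auto
  then show "stationary_distribution \<eta> J \<gamma> w BL BR (cdf M)"
    unfolding stationary_distribution_def concentrated_on_def
    using distribution_function_cdf[OF M] st by simp
  fix \<pi> assume \<pi>: "stationary_distribution \<eta> J \<gamma> w BL BR \<pi>"
  then have "distribution_function \<pi>" unfolding stationary_distribution_def by (rule conjunct1)
  then have \<pi>': "real_distribution (interval_measure \<pi>)" "cdf (interval_measure \<pi>) = \<pi>"
    by (rule distribution_function_measure)+
  interpret P: real_distribution "interval_measure \<pi>" by (rule \<pi>'(1))
  have "AE x in interval_measure \<pi>. x \<in> {- BL..BR}"
  proof (subst P.prob_eq_1[symmetric])
    show "P.prob {- BL..BR} = 1"
      using \<pi> unfolding stationary_distribution_def concentrated_on_def by blast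
  qed simp
  then have "AE x in interval_measure \<pi>. x \<le> BR" by eventually_elim simp
  then have "stationary_law (interval_measure \<pi>)"
    using \<pi> \<pi>'(1) unfolding stationary_law_def stationary_distribution_def by blast
  moreover have "AE x in M. x \<le> BR" using sM by eventually_elim simp
  then have "stationary_law M" using M st unfolding stationary_law_def by blast
  ultimately have "interval_measure \<pi> = M" by (rule stationary_unique)
  then show "\<pi> = cdf M" using \<pi>' by simp
qed

text \<open>The forward direction rests on \<open>ex_balanced\<close>: since some balanced law
  exists, the \<open>THE\<close> is specified, and the fixed point has to be that law.\<close>

lemma fixed_point_iff_balanced:
  assumes "distribution_function \<gamma>"
  shows "\<gamma> = frame_operator \<eta> J w BL BR \<gamma> \<longleftrightarrow> balanced (interval_measure \<gamma>)"
proof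
  assume \<gamma>: "\<gamma> = frame_operator \<eta> J w BL BR \<gamma>"
  obtain M where b: "balanced M" using ex_balanced by blast
  have "cdf M = \<gamma>" using \<gamma> frame_operator_eq_cdf[OF b] by simp
  moreover have "interval_measure (cdf M) = M" using b distribution_function_cdf by (simp add: balanced_def)
  ultimately show "balanced (interval_measure \<gamma>)" using b by simp
next
  assume "balanced (interval_measure \<gamma>)"
  then show "\<gamma> = frame_operator \<eta> J w BL BR \<gamma>"
    using frame_operator_eq_cdf distribution_function_measure(2)[OF assms] by simp
qed

end

section \<open>The delay equation\<close>

text \<open>Bridge between two integrals: the calculus below uses the gauge integral, while Fubini
  and translations are done with the Lebesgue integral.\<close>

lemma bounded_integrable_on:
  fixes g :: "real \<Rightarrow> real"
  assumes [measurable]: "g \<in> borel_measurable borel" and B: "\<And>x. \<bar>g x\<bar> \<le> B"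
  shows "g integrable_on {a..b}" and "integral {a..b} g = (LINT x|lborel. indicator {a..b} x * g x)"
proof -
  have "set_integrable lborel {a..b} g"
    unfolding set_integrable_def
    by (rule integrableI_bounded_set[where A="{a..b}" and B=B])
       (use B in \<open>auto simp: emeasure_lborel_Icc_eq ennreal_less_top split: split_indicator\<close>)
  from set_borel_integral_eq_integral[OF this]
  show "g integrable_on {a..b}" "integral {a..b} g = (LINT x|lborel. indicator {a..b} x * g x)"
    by (simp_all add: set_lebesgue_integral_def)
qed

text \<open>The set where \<open>W t + \<epsilon> * (t - a)\<close> is at least \<open>W a\<close>
  is compact, and its maximum cannot lie below \<open>b\<close>. This stands in for a sign condition
  on a derivative, which the later \<open>W\<close>, containing a positive part, may lack.\<close>

lemma nondecreasing_from_right_local: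
  fixes W :: "real \<Rightarrow> real"
  assumes ab: "a \<le> b" and cont: "continuous_on {a..b} W"
    and local: "\<And>t \<epsilon>. a \<le> t \<Longrightarrow> t < b \<Longrightarrow> 0 < \<epsilon> \<Longrightarrow> \<exists>t'>t. t' \<le> b \<and> W t - \<epsilon> * (t' - t) \<le> W t'"
  shows "W a \<le> W b"
proof (rule field_le_epsilon)
  fix e :: real assume e: "0 < e"
  \<comment> \<open>The \<open>+ 1\<close> covers \<open>a = b\<close> and still gives
    \<open>\<epsilon> * (b - a) \<le> e\<close>.\<close>
  define \<epsilon> where "\<epsilon> = e / (b - a + 1)"
  have \<epsilon>: "0 < \<epsilon>" using e ab by (simp add: \<epsilon>_def)
  define S where "S = {a..b} \<inter> (\<lambda>t. W t + \<epsilon> * (t - a)) -` {W a..}"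
  have "closed S" unfolding S_def
    by (intro continuous_closed_preimage continuous_intros cont)
  moreover have "bounded S" unfolding S_def by (meson bounded_Int bounded_closed_interval)
  ultimately have "compact S" by (simp add: compact_eq_bounded_closed)
  moreover have "a \<in> S" using ab by (simp add: S_def)
  ultimately obtain c where c: "c \<in> S" "\<And>s. s \<in> S \<Longrightarrow> s \<le> c"
    using compact_attains_sup[of S] by blast
  have "c = b"
  proof (rule ccontr)
    assume "c \<noteq> b"
    then have "a \<le> c" "c < b" using c by (auto simp: S_def)
    from local[OF this \<epsilon>] obtain t' where t': "t' > c" "t' \<le> b" "W c - \<epsilon> * (t' - c) \<le> W t'" by blast
    then have "t' \<in> S" using c(1) by (auto simp: S_def algebra_simps)
    then show False using c(2) t'(1) by fastforce
  qed
  then have "W a \<le> W b + \<epsilon> * (b - a)" using c(1) by (simp add: S_def)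
  also have "\<epsilon> * (b - a) \<le> e"
    using e ab by (simp add: \<epsilon>_def field_simps)
  finally show "W a \<le> W b + e" by simp
qed

lemma increment_of_integral_equation:
  fixes f q :: "real \<Rightarrow> real"
  assumes eq: "\<And>y. b \<le> y \<Longrightarrow> y \<le> R \<Longrightarrow> w * (f y - f b) = integral {b..y} q"
    and q: "\<And>x y. q integrable_on {x..y}" and st: "b \<le> s" "s \<le> t" "t \<le> R"
  shows "w * (f t - f s) = integral {s..t} q"
  using eq[of s] eq[of t] st q
    Henstock_Kurzweil_Integration.integral_combine[where a=b and c=s and b=t and f=q]
  by (simp add: algebra_simps)

lemma lipschitz_of_integral_equation:
  fixes f q :: "real \<Rightarrow> real"
  assumes w: "0 < w" and eq: "\<And>y. b \<le> y \<Longrightarrow> y \<le> R \<Longrightarrow> w * (f y - f b) = integral {b..y} q"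
    and q: "\<And>x y. q integrable_on {x..y}" and q01: "\<And>x. 0 \<le> q x" "\<And>x. q x \<le> 1"
  shows "(1 / w)-lipschitz_on {b..R} f"
proof (rule lipschitz_onI)
  have *: "\<bar>f t - f s\<bar> \<le> 1 / w * \<bar>t - s\<bar>" if st: "b \<le> s" "s \<le> t" "t \<le> R" for s t
  proof -
    have e: "w * (f t - f s) = integral {s..t} q"
      by (rule increment_of_integral_equation[OF eq q st])
    have "0 \<le> integral {s..t} q" by (rule integral_nonneg) (use q q01 in auto)
    moreover have "integral {s..t} q \<le> integral {s..t} (\<lambda>_. 1)" by (rule integral_le) (use q q01 in auto)
    ultimately have "0 \<le> w * (f t - f s)" "w * (f t - f s) \<le> t - s" using st e by simp_all
    then show ?thesis using w st by (simp add: field_simps zero_le_mult_iff)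
  qed
  fix s t assume "s \<in> {b..R}" "t \<in> {b..R}"
  then show "dist (f s) (f t) \<le> 1 / w * dist s t"
    using *[of s t] *[of t s] by (cases "s \<le> t") (auto simp: dist_real_def abs_minus_commute)
qed (use w in simp)

section \<open>Consequences of the standing assumptions; the primitive of the jump
  probability\<close>

locale wave_model =
  fixes \<eta> J :: "real \<Rightarrow> real"
  assumes \<eta>: "jump_prob \<eta>" and J: "jump_size_cdf J"
begin

sublocale J: real_distribution "interval_measure J"
  using J by (auto simp: jump_size_cdf_def distribution_function_def mono_def intro!: real_distribution_interval_measure)

abbreviation "jumps \<equiv> interval_measure J"

lemma J_nonneg: "AE z in jumps. 0 \<le> z"
proof -
  have "J.prob {0..} = 1" using J by (simp add: jump_size_cdf_def concentrated_on_def)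
  then have "AE z in jumps. z \<in> {0..}" by (subst (asm) J.prob_eq_1) auto
  then show ?thesis by simp
qed

text \<open>Otherwise jumps would vanish almost surely, against the mean 1. The length \<delta>
  obtained here is the step width of the comparison argument.\<close>

lemma ex_long_jump: "\<exists>\<delta>>0. 0 < measure jumps {\<delta>..}"
proof (rule ccontr)
  assume "\<not> ?thesis"
  then have *: "measure jumps {\<delta>..} = 0" if "0 < \<delta>" for \<delta>
    using that by (metis less_eq_real_def measure_nonneg)
  have "AE z in jumps. \<forall>n::nat. z < 1 / real (Suc n)"
  proof (subst AE_all_countable, rule allI)
    fix n :: nat
    have "{1 / real (Suc n)..} \<in> null_sets jumps"
      using *[of "1 / real (Suc n)"] by (auto simp: null_sets_def J.emeasure_eq_measure)
    then show "AE z in jumps. z < 1 / real (Suc n)"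
      by (rule AE_I') (auto simp: not_less)
  qed
  then have "AE z in jumps. z = 0"
    using J_nonneg
  proof eventually_elim
    case (elim z)
    show ?case
    proof (rule ccontr)
      assume "z \<noteq> 0"
      then obtain n where "inverse (real (Suc n)) < z" using elim reals_Archimedean[of z] by auto
      then show False using elim(1)[rule_format, of n] by (simp add: inverse_eq_divide)
    qed
  qed
  then have "(LINT z|jumps. z) = (LINT z|jumps. 0)"
    by (intro integral_cong_AE) auto
  then show False using J by (simp add: jump_size_cdf_def)
qed

lemma \<eta>_cont: "continuous_on {0..1} \<eta>" and \<eta>_0: "\<eta> 0 = 1" and \<eta>_1: "\<eta> 1 = 0"
  using \<eta> by (auto simp: jump_prob_def)

lemma \<eta>_less: "0 \<le> x \<Longrightarrow> x < y \<Longrightarrow> y \<le> 1 \<Longrightarrow> \<eta> y < \<eta> x"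
  using \<eta> by (auto simp: jump_prob_def monotone_on_def)

lemma \<eta>_le: "0 \<le> x \<Longrightarrow> x \<le> y \<Longrightarrow> y \<le> 1 \<Longrightarrow> \<eta> y \<le> \<eta> x"
  using \<eta>_less[of x y] by (cases "x = y") auto

lemma \<eta>_01: "0 \<le> x \<Longrightarrow> x \<le> 1 \<Longrightarrow> 0 \<le> \<eta> x \<and> \<eta> x \<le> 1"
  using \<eta>_le[of 0 x] \<eta>_le[of x 1] by (auto simp: \<eta>_0 \<eta>_1)

text \<open>The cap at 1 and the empty range for \<nu> < 0 extend \<open>H\<close> by constants to
  the whole line: the shooting solutions may exceed 1, and the flux estimates are applied to them
  too.\<close>

definition H :: "real \<Rightarrow> real" where
  "H \<nu> = integral {0..min 1 \<nu>} \<eta>"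

lemma \<eta>_integrable: fixes x y :: real shows "0 \<le> x \<Longrightarrow> y \<le> 1 \<Longrightarrow> \<eta> integrable_on {x..y}"
  by (intro integrable_continuous_interval continuous_on_subset[OF \<eta>_cont]) auto

lemma H_diff:
  assumes "0 \<le> x" "x \<le> y" "y \<le> 1"
  shows "H y - H x = integral {x..y} \<eta>"
proof -
  have "min 1 x = x" "min 1 y = y" using assms by auto
  then show ?thesis
    unfolding H_def using assms \<eta>_integrable
      Henstock_Kurzweil_Integration.integral_combine[where a=0 and c=x and b=y and f=\<eta>] by simp
qed

lemma H_nonpos [simp]: "\<nu> \<le> 0 \<Longrightarrow> H \<nu> = 0"
  unfolding H_def by (cases "\<nu> = 0") auto

lemma H_ge_1: "1 \<le> \<nu> \<Longrightarrow> H \<nu> = H 1"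
  unfolding H_def by simp

lemma H_clamp: "H \<nu> = H (max 0 (min 1 \<nu>))"
  using H_ge_1[of \<nu>] H_nonpos[of \<nu>] by (cases "\<nu> \<le> 0"; cases "1 \<le> \<nu>") (simp_all add: max_def min_def)

lemma H_diff_bounds:
  assumes "0 \<le> x" "x \<le> y" "y \<le> 1"
  shows "\<eta> y * (y - x) \<le> H y - H x" "H y - H x \<le> \<eta> x * (y - x)"
proof -
  have "integral {x..y} (\<lambda>_. \<eta> y) \<le> integral {x..y} \<eta>"
    using assms by (intro integral_le \<eta>_integrable) (auto intro: \<eta>_le)
  then show "\<eta> y * (y - x) \<le> H y - H x" using assms by (simp add: H_diff mult.commute)
  have "integral {x..y} \<eta> \<le> integral {x..y} (\<lambda>_. \<eta> x)"
    using assms by (intro integral_le \<eta>_integrable) (auto intro: \<eta>_le)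
  then show "H y - H x \<le> \<eta> x * (y - x)" using assms by (simp add: H_diff mult.commute)
qed

lemma H_mono: "x \<le> y \<Longrightarrow> H x \<le> H y"
proof -
  have *: "H x \<le> H y" if "0 \<le> x" "x \<le> y" "y \<le> 1" for x y
    using H_diff_bounds(1)[OF that] \<eta>_01[of y] that mult_nonneg_nonneg[of "\<eta> y" "y - x"] by linarith
  assume "x \<le> y"
  then show ?thesis
    by (subst (1 2) H_clamp) (intro *, auto simp: max_def min_def)
qed

lemma H_diff_le: "x \<le> y \<Longrightarrow> H y - H x \<le> y - x"
proof -
  have *: "H y - H x \<le> y - x" if "0 \<le> x" "x \<le> y" "y \<le> 1" for x y
    using H_diff_bounds(2)[OF that] \<eta>_01[of x] that mult_right_mono[of "\<eta> x" 1 "y - x"] by simp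
  assume "x \<le> y"
  then have "H y - H x \<le> max 0 (min 1 y) - max 0 (min 1 x)"
    by (subst (1 2) H_clamp) (intro *, auto simp: max_def min_def)
  also have "\<dots> \<le> y - x" using \<open>x \<le> y\<close> by (auto simp: max_def min_def)
  finally show ?thesis .
qed

lemma H_lipschitz: "\<bar>H x - H y\<bar> \<le> \<bar>x - y\<bar>"
  using H_mono[of x y] H_mono[of y x] H_diff_le[of x y] H_diff_le[of y x] by linarith

lemma H_01: "0 \<le> H \<nu>" "H \<nu> \<le> 1"
proof -
  show "0 \<le> H \<nu>" using H_mono[of "min \<nu> 0" \<nu>] by simp
  have "H \<nu> = H (min 1 \<nu>)" by (simp add: H_def)
  also have "\<dots> \<le> H 1" by (intro H_mono) simp
  also have "\<dots> \<le> 1" using H_diff_le[of 0 1] by simp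
  finally show "H \<nu> \<le> 1" .
qed

lemma H_strict:
  assumes "0 \<le> x" "x < y" "y \<le> 1" shows "H x < H y"
proof -
  \<comment> \<open>The midpoint is used because \<eta> vanishes at \<open>y\<close> itself when
    \<open>y = 1\<close>.\<close>
  let ?m = "(x + y) / 2"
  have "0 < \<eta> ?m * (?m - x)" using assms \<eta>_less[of ?m 1] \<eta>_1 by simp
  also have "\<dots> \<le> H ?m - H x" using assms by (intro H_diff_bounds) auto
  also have "\<dots> \<le> H y - H x" using assms H_mono[of ?m y] by simp
  finally show ?thesis by simp
qed

lemma H_cont: "continuous_on S H"
  by (rule lipschitz_on_continuous_on[of 1], rule lipschitz_onI) (auto simp: dist_real_def H_lipschitz)

section \<open>Averaging over a jump, and the flux\<close>

definition conv :: "(real \<Rightarrow> real) \<Rightarrow> real \<Rightarrow> real" where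
  "conv g s = (LINT z|jumps. g (s - z))"

text \<open>The mean of H(f s) - H(f(s - Z)). For a distribution function that is zero left of the
  frame and Lipschitz on it, this is the rate of jumps across \<open>s\<close>; see
  \<open>crossing_rate_eq\<close>.\<close>

definition K :: "(real \<Rightarrow> real) \<Rightarrow> real \<Rightarrow> real" where
  "K f s = H (f s) - conv (\<lambda>x. H (f x)) s"

lemma conv_measurable:
  assumes [measurable]: "g \<in> borel_measurable borel"
  shows "conv g \<in> borel_measurable borel"
  unfolding conv_def[abs_def] by measurable

lemma integrable_conv:
  fixes B :: real
  assumes [measurable]: "g \<in> borel_measurable borel" and "\<And>x. \<bar>g x\<bar> \<le> B"
  shows "integrable jumps (\<lambda>z. g (s - z))"
  by (rule J.integrable_const_bound[where B=B]) (use assms(2) in auto)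

text \<open>Two bounds for two roles: \<open>B\<close> gives integrability, and \<open>C\<close> is
  asked for only on \<open>x \<le> s\<close>, where \<open>s - z\<close> lies for almost every jump
  size \<open>z\<close>.\<close>

lemma abs_conv_le:
  assumes [measurable]: "g \<in> borel_measurable borel" and B: "\<And>x. \<bar>g x\<bar> \<le> B"
    and C: "\<And>x. x \<le> s \<Longrightarrow> \<bar>g x\<bar> \<le> C"
  shows "\<bar>conv g s\<bar> \<le> C"
proof -
  note i = integrable_conv[OF assms(1) B, of s]
  have "\<bar>conv g s\<bar> \<le> (LINT z|jumps. \<bar>g (s - z)\<bar>)"
    unfolding conv_def using integral_norm_bound[of jumps "\<lambda>z. g (s - z)"] by simp
  also have "\<dots> \<le> (LINT z|jumps. C)"
    by (intro integral_mono_AE) (use i J_nonneg in \<open>auto intro: C elim!: eventually_mono\<close>)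
  also have "\<dots> = C" using J.prob_space by simp
  finally show ?thesis .
qed

lemma conv_mono:
  assumes [measurable]: "g \<in> borel_measurable borel" "h \<in> borel_measurable borel"
    and g: "\<And>x. \<bar>g x\<bar> \<le> B" and h: "\<And>x. \<bar>h x\<bar> \<le> B'" and le: "\<And>x. x \<le> s \<Longrightarrow> g x \<le> h x"
  shows "conv g s \<le> conv h s"
  unfolding conv_def
proof (rule integral_mono_AE)
  show "integrable jumps (\<lambda>z. g (s - z))" by (rule integrable_conv[OF assms(1) g])
  show "integrable jumps (\<lambda>z. h (s - z))" by (rule integrable_conv[OF assms(2) h])
  show "AE z in jumps. g (s - z) \<le> h (s - z)"
    using J_nonneg by eventually_elim (simp add: le)
qed

lemma conv_diff:
  assumes [measurable]: "g \<in> borel_measurable borel" "h \<in> borel_measurable borel"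
    and g: "\<And>x. \<bar>g x\<bar> \<le> B" and h: "\<And>x. \<bar>h x\<bar> \<le> B'"
  shows "conv (\<lambda>x. g x - h x) s = conv g s - conv h s"
  unfolding conv_def
  by (rule Bochner_Integration.integral_diff[OF integrable_conv[OF assms(1) g] integrable_conv[OF assms(2) h]])

lemma H_measurable [measurable]: "H \<in> borel_measurable borel"
  by (rule borel_measurable_continuous_onI) (rule H_cont)

lemma mono_measurable: "mono f \<Longrightarrow> (f :: real \<Rightarrow> real) \<in> borel_measurable borel"
  by (rule borel_measurable_mono)

lemma abs_H_le: "\<bar>H x\<bar> \<le> 1"
  using H_01[of x] by simp

lemma K_measurable:
  assumes [measurable]: "f \<in> borel_measurable borel"
  shows "K f \<in> borel_measurable borel"
  unfolding K_def[abs_def] by (intro borel_measurable_diff conv_measurable) measurable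

lemma K_01:
  assumes f: "mono f"
  shows "0 \<le> K f s" "K f s \<le> 1"
proof -
  have [measurable]: "f \<in> borel_measurable borel" using f by (rule mono_measurable)
  have "\<bar>conv (\<lambda>x. H (f x)) s\<bar> \<le> H (f s)"
    by (rule abs_conv_le[where B=1]) (simp_all add: abs_H_le H_01 H_mono monoD[OF f])
  then show "0 \<le> K f s" unfolding K_def by linarith
  have "0 \<le> conv (\<lambda>x. H (f x)) s" unfolding conv_def by (intro integral_nonneg_AE) (simp add: H_01)
  then show "K f s \<le> 1" using H_01[of "f s"] unfolding K_def by linarith
qed

lemma abs_K_le: "mono f \<Longrightarrow> \<bar>K f s\<bar> \<le> 1"
  using K_01[of f s] by simp

lemma K_integrable_on: "mono f \<Longrightarrow> K f integrable_on {a..b}"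
  by (rule bounded_integrable_on(1)[where B=1]) (auto simp: abs_K_le mono_measurable K_measurable)

text \<open>Fubini and a translation by each jump size; since \<phi> vanishes left of
  \<open>b\<close>, shifting the window loses mass only at its right end.\<close>

lemma integral_conv:
  assumes [measurable]: "\<phi> \<in> borel_measurable borel" and B: "\<And>x. \<bar>\<phi> x\<bar> \<le> B"
    and 0: "\<And>x. x < b \<Longrightarrow> \<phi> x = 0"
  shows "integral {b..t} (conv \<phi>) = (LINT z|jumps. integral {b..t - z} \<phi>)"
proof -
  interpret P: pair_sigma_finite lborel jumps ..
  have int: "integrable (lborel \<Otimes>\<^sub>M jumps) (\<lambda>(s, z). indicator {b..t} s * \<phi> (s - z))"
  proof (rule integrableI_bounded_set[where A="{b..t} \<times> UNIV" and B=B])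
    show "emeasure (lborel \<Otimes>\<^sub>M jumps) ({b..t} \<times> UNIV) < \<infinity>"
      using J.emeasure_space_1
      by (subst J.emeasure_pair_measure_Times) (auto simp: emeasure_lborel_Icc_eq ennreal_mult_less_top)
    show "AE p in lborel \<Otimes>\<^sub>M jumps. p \<notin> {b..t} \<times> UNIV \<longrightarrow> (case p of (s, z) \<Rightarrow> indicator {b..t} s * \<phi> (s - z)) = 0"
      by (intro AE_I2) (auto simp: indicator_def)
  qed (use B in \<open>auto split: split_indicator intro: order_trans[OF abs_ge_zero B]\<close>)
  have "integral {b..t} (conv \<phi>) = (LINT s|lborel. indicator {b..t} s * conv \<phi> s)"
    by (rule bounded_integrable_on(2)[where B=B]) (auto intro: abs_conv_le B conv_measurable)
  also have "\<dots> = (LINT s|lborel. LINT z|jumps. indicator {b..t} s * \<phi> (s - z))"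
    by (simp add: conv_def)
  also have "\<dots> = (LINT z|jumps. LINT s|lborel. indicator {b..t} s * \<phi> (s - z))"
    by (rule P.Fubini_integral[symmetric]) (rule int)
  also have "\<dots> = (LINT z|jumps. integral {b..t - z} \<phi>)"
  proof (rule integral_cong_AE)
    show "AE z in jumps. (LINT s|lborel. indicator {b..t} s * \<phi> (s - z)) = integral {b..t - z} \<phi>"
      using J_nonneg
    proof eventually_elim
      fix z :: real assume z: "0 \<le> z"
      have "(LINT s|lborel. indicator {b..t} s * \<phi> (s - z)) = (LINT u|lborel. indicator {b..t} (z + u) * \<phi> u)"
        using lborel_integral_real_affine[of 1 "\<lambda>s. indicator {b..t} s * \<phi> (s - z)" z] by simp
      also have "\<dots> = (LINT u|lborel. indicator {b..t - z} u * \<phi> u)"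
        by (intro Bochner_Integration.integral_cong) (use z 0 in \<open>auto split: split_indicator\<close>)
      also have "\<dots> = integral {b..t - z} \<phi>"
        by (rule bounded_integrable_on(2)[symmetric, OF assms(1) B])
      finally show "(LINT s|lborel. indicator {b..t} s * \<phi> (s - z)) = integral {b..t - z} \<phi>" .
    qed
    have "(\<lambda>z. LINT u|lborel. indicator {b..} u * indicator {..t} (z + u) * \<phi> u) \<in> borel_measurable jumps"
      by measurable
    moreover have "integral {b..t - z} \<phi> = (LINT u|lborel. indicator {b..} u * indicator {..t} (z + u) * \<phi> u)" for z
      unfolding bounded_integrable_on(2)[OF assms(1) B]
      by (intro Bochner_Integration.integral_cong) (auto split: split_indicator)
    ultimately show "(\<lambda>z. integral {b..t - z} \<phi>) \<in> borel_measurable jumps" by simp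
  qed measurable
  finally show ?thesis .
qed

abbreviation "long_jump \<delta> \<equiv> measure jumps {\<delta>..}"

text \<open>Jumps of size at least \<open>\<delta>\<close> carry the mass of \<open>\<phi>\<close> on \<open>[t - \<delta>, t]\<close> out of
  \<open>[b, t]\<close>.\<close>

lemma conv_deficit:
  assumes [measurable]: "\<phi> \<in> borel_measurable borel" and B: "\<And>x. \<bar>\<phi> x\<bar> \<le> B"
    and 0: "\<And>x. x < b \<Longrightarrow> \<phi> x = 0" and nn: "\<And>x. 0 \<le> \<phi> x" and \<delta>: "0 \<le> \<delta>" and t: "b \<le> t"
  shows "long_jump \<delta> * integral {t - \<delta>..t} \<phi> \<le> integral {b..t} (\<lambda>s. \<phi> s - conv \<phi> s)"
proof -
  define A where "A x = integral {b..x} \<phi>" for x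
  note i = bounded_integrable_on(1)[OF assms(1) B]
  have A_mono: "A x \<le> A y" if "x \<le> y" for x y
    unfolding A_def by (rule integral_subset_le) (use that i nn in auto)
  have A_nn: "0 \<le> A x" for x unfolding A_def by (rule integral_nonneg) (use i nn in auto)
  have A_le: "A x \<le> A t" if "x \<le> t" for x using A_mono[OF that] .
  have A_meas: "A \<in> borel_measurable borel" by (rule mono_measurable) (simp add: mono_def A_mono)
  note [measurable] = A_meas
  have i_conv: "conv \<phi> integrable_on {b..t}"
    by (rule bounded_integrable_on(1)[where B=B]) (auto intro: abs_conv_le B conv_measurable)
  have iA: "integrable jumps (\<lambda>z. A (t - z))"
    by (rule J.integrable_const_bound[where B="A t"])
       (use J_nonneg in \<open>auto simp: A_nn intro: A_le elim!: eventually_mono\<close>)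
  have eq: "integral {t - \<delta>..t} \<phi> = A t - A (t - \<delta>)"
  proof (cases "b \<le> t - \<delta>")
    case True
    then show ?thesis unfolding A_def using Henstock_Kurzweil_Integration.integral_combine[where a=b and c="t - \<delta>" and b=t and f=\<phi>] i \<delta> by simp
  next
    case False
    \<comment> \<open>\<phi> is known to vanish only strictly left of \<open>b\<close>, so the point
      \<open>b\<close> is discarded as a null set.\<close>
    have z: "integral {t - \<delta>..b} \<phi> = 0"
    proof -
      have "integral {t - \<delta>..b} \<phi> = integral {t - \<delta>..b} (\<lambda>_. 0)"
        by (rule integral_spike[of "{b}"]) (auto simp: 0)
      then show ?thesis by simp
    qed
    then show ?thesis unfolding A_def
      using Henstock_Kurzweil_Integration.integral_combine[where a="t - \<delta>" and c=b and b=t and f=\<phi>] i t False by simp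
  qed
  have "long_jump \<delta> * integral {t - \<delta>..t} \<phi> = (LINT z|jumps. indicator {\<delta>..} z * (A t - A (t - \<delta>)))"
    by (simp add: eq)
  also have "\<dots> \<le> (LINT z|jumps. A t - A (t - z))"
  proof (rule integral_mono_AE)
    show "integrable jumps (\<lambda>z. indicator {\<delta>..} z * (A t - A (t - \<delta>)))"
      by (intro integrable_mult_left integrable_real_indicator) (auto simp: J.emeasure_eq_measure)
    show "integrable jumps (\<lambda>z. A t - A (t - z))" using iA by simp
    show "AE z in jumps. indicator {\<delta>..} z * (A t - A (t - \<delta>)) \<le> A t - A (t - z)"
      using J_nonneg by eventually_elim (auto split: split_indicator intro: A_mono A_le)
  qed
  also have "\<dots> = A t - (LINT z|jumps. A (t - z))"
    using iA J.prob_space by simp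
  also have "\<dots> = integral {b..t} \<phi> - integral {b..t} (conv \<phi>)"
    unfolding A_def by (subst integral_conv[OF assms(1) B 0]) simp_all
  also have "\<dots> = integral {b..t} (\<lambda>s. \<phi> s - conv \<phi> s)"
    by (rule Henstock_Kurzweil_Integration.integral_diff[symmetric]) (use i i_conv in auto)
  finally show ?thesis .
qed

section \<open>Comparison of super- and subsolutions\<close>

context
  fixes f g :: "real \<Rightarrow> real" and b R w :: real
  assumes f: "mono f" and g: "mono g" and f0: "\<And>t. t < b \<Longrightarrow> f t = 0" and g0: "\<And>t. 0 \<le> g t"
    and cf: "continuous_on {b..R} f" and cg: "continuous_on {b..R} g" and w: "0 < w"
    and sup: "\<And>s t. b \<le> s \<Longrightarrow> s \<le> t \<Longrightarrow> t \<le> R \<Longrightarrow> integral {s..t} (K f) \<le> w * (f t - f s)"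
    and sub: "\<And>s t. b \<le> s \<Longrightarrow> s \<le> t \<Longrightarrow> t \<le> R \<Longrightarrow> w * (g t - g s) \<le> integral {s..t} (K g)"
begin

abbreviation "excess s \<equiv> max 0 (H (f s) - H (g s))"

lemma excess_measurable: "excess \<in> borel_measurable borel"
proof -
  note [measurable] = mono_measurable[OF f] mono_measurable[OF g]
  show ?thesis by measurable
qed

lemma excess_bounds: "\<bar>excess x\<bar> \<le> 1" "0 \<le> excess x"
  using H_01[of "f x"] H_01[of "g x"] by (auto simp: max_def)

text \<open>\<open>W\<close> is nondecreasing: where \<open>f > g\<close> by the two differential inequalities, and elsewhere because
  the integrand \<open>r\<close> is at most \<open>(f - g)\<^sup>+\<close>, which vanishes there.\<close>

lemma comparison_aux:
  assumes t: "b \<le> t" "t \<le> R" and \<delta>: "0 \<le> \<delta>"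
  shows "w * max 0 (f b - g b) + long_jump \<delta> * integral {t - \<delta>..t} excess \<le> w * max 0 (f t - g t)"
proof -
  define D where "D s = f s - g s" for s
  define r where "r s = excess s - conv excess s" for s
  define W where "W u = w * max 0 (D u) - integral {b..u} r" for u
  have [measurable]: "f \<in> borel_measurable borel" "g \<in> borel_measurable borel"
    using f g by (auto intro: mono_measurable)
  note \<phi>m [measurable] = excess_measurable and \<phi>B = excess_bounds(1) and \<phi>nn = excess_bounds(2)
  have \<phi>0: "excess x = 0" if "x < b" for x using that f0 H_01(1)[of "g x"] by simp
  have conv_nn: "0 \<le> conv excess x" for x unfolding conv_def by (intro integral_nonneg_AE) (simp add: \<phi>nn)
  have conv_1: "\<bar>conv excess x\<bar> \<le> 1" for x by (rule abs_conv_le[OF \<phi>m \<phi>B \<phi>B])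
  have rm [measurable]: "r \<in> borel_measurable borel" unfolding r_def by (intro borel_measurable_diff \<phi>m conv_measurable)
  have rB: "\<bar>r x\<bar> \<le> 2" for x using \<phi>B[of x] conv_1[of x] unfolding r_def by linarith
  have ir: "r integrable_on {u..v}" for u v by (rule bounded_integrable_on(1)[OF rm rB])
  have W_diff: "W v - W u = w * (max 0 (D v) - max 0 (D u)) - integral {u..v} r" if "b \<le> u" "u \<le> v" for u v
    using that Henstock_Kurzweil_Integration.integral_combine[where a=b and c=u and b=v and f=r] ir
    unfolding W_def by (simp add: algebra_simps)
  have cD: "continuous_on {b..R} D" unfolding D_def by (intro continuous_intros cf cg)
  have cW: "continuous_on {b..R} W" unfolding W_def
    by (intro continuous_intros cD indefinite_integral_continuous_1 ir)
  have r_le: "r s \<le> max 0 (D s)" for s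
    using conv_nn[of s] H_diff_le[of "g s" "f s"] H_mono[of "f s" "g s"] unfolding r_def D_def by linarith
  \<comment> \<open>Where f \<ge> g, the first term of \<open>r\<close> is exactly
    \<open>H (f s) - H (g s)\<close>; taking positive parts can only enlarge the averaged term,
    which is subtracted.\<close>
  have r_le_K: "r s \<le> K f s - K g s" if "0 \<le> D s" for s
  proof -
    have "conv (\<lambda>x. H (f x)) s - conv (\<lambda>x. H (g x)) s = conv (\<lambda>x. H (f x) - H (g x)) s"
      by (rule conv_diff[symmetric, where B=1 and B'=1]) (simp_all add: abs_H_le)
    also have "\<dots> \<le> conv excess s"
    proof (rule conv_mono)
      show "\<bar>H (f x) - H (g x)\<bar> \<le> 2" for x using abs_H_le[of "f x"] abs_H_le[of "g x"] by linarith
      show "\<bar>excess x\<bar> \<le> 1" for x by (rule \<phi>B)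
      show "H (f x) - H (g x) \<le> excess x" for x by simp
    qed simp_all
    finally have "conv (\<lambda>x. H (f x)) s - conv (\<lambda>x. H (g x)) s \<le> conv excess s" .
    moreover have "excess s = H (f s) - H (g s)" using H_mono[of "g s" "f s"] that by (simp add: D_def)
    ultimately show ?thesis unfolding r_def K_def by linarith
  qed
  have "W b \<le> W t"
  proof (rule nondecreasing_from_right_local[where W=W])
    show "continuous_on {b..t} W" using cW by (rule continuous_on_subset) (use t in auto)
    fix u \<epsilon> :: real assume u: "b \<le> u" "u < t" and \<epsilon>: "0 < \<epsilon>"
    have cont: "(D \<longlongrightarrow> D u) (at u within {b..R})" using cD u t by (auto simp: continuous_on_def)
    show "\<exists>t'>u. t' \<le> t \<and> W u - \<epsilon> * (t' - u) \<le> W t'"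
    proof (cases "0 < D u")
      case True
      from order_tendstoD(1)[OF cont True]
      obtain d where d: "0 < d" "\<And>s. s \<in> {b..R} \<Longrightarrow> s \<noteq> u \<Longrightarrow> dist s u < d \<Longrightarrow> 0 < D s"
        unfolding eventually_at by blast
      define v where "v = min t (u + d / 2)"
      have v: "u < v" "v \<le> t" using u d by (auto simp: v_def)
      have pos: "0 \<le> D s" if "s \<in> {u..v}" for s
      proof (cases "s = u")
        case False
        then have "0 < D s" using that d u t by (intro d(2)) (auto simp: v_def dist_real_def)
        then show ?thesis by simp
      qed (use True in simp)
      have "integral {u..v} r \<le> integral {u..v} (\<lambda>s. K f s - K g s)"
        by (intro integral_le ir Henstock_Kurzweil_Integration.integrable_diff K_integrable_on f g r_le_K pos)
      also have "\<dots> = integral {u..v} (K f) - integral {u..v} (K g)"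
        by (intro Henstock_Kurzweil_Integration.integral_diff K_integrable_on f g)
      also have "\<dots> \<le> w * (f v - f u) - w * (g v - g u)"
        using sup[of u v] sub[of u v] u v t by simp
      also have "\<dots> = w * (max 0 (D v) - max 0 (D u))"
        using pos[of u] pos[of v] v by (simp add: D_def algebra_simps)
      finally have "0 \<le> W v - W u" using W_diff[of u v] u v by simp
      moreover have "0 \<le> \<epsilon> * (v - u)" using \<epsilon> v by simp
      ultimately show ?thesis using v by (intro exI[of _ v]) linarith
    next
      case False
      \<comment> \<open>Right of \<open>u\<close> the difference may become positive, but by
        continuity it stays below \<epsilon> for a while, and
        \<open>nondecreasing_from_right_local\<close> tolerates a loss of that slope.\<close>
      then have "D u < \<epsilon>" using \<epsilon> by simp
      from order_tendstoD(2)[OF cont this]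
      obtain d where d: "0 < d" "\<And>s. s \<in> {b..R} \<Longrightarrow> s \<noteq> u \<Longrightarrow> dist s u < d \<Longrightarrow> D s < \<epsilon>"
        unfolding eventually_at by blast
      define v where "v = min t (u + d / 2)"
      have v: "u < v" "v \<le> t" using u d by (auto simp: v_def)
      have "integral {u..v} r \<le> integral {u..v} (\<lambda>_. \<epsilon>)"
      proof (intro integral_le ir)
        fix s assume s: "s \<in> {u..v}"
        have "D s \<le> \<epsilon>"
        proof (cases "s = u")
          case False
          then have "D s < \<epsilon>" using s d u t by (intro d(2)) (auto simp: v_def dist_real_def)
          then show ?thesis by simp
        qed (use \<open>D u < \<epsilon>\<close> in simp)
        then show "r s \<le> \<epsilon>" using r_le[of s] \<epsilon> by linarith
      qed auto
      also have "\<dots> = \<epsilon> * (v - u)" using v by (simp add: mult.commute)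
      finally have "integral {u..v} r \<le> \<epsilon> * (v - u)" .
      moreover have "0 \<le> w * (max 0 (D v) - max 0 (D u))" using w False by simp
      ultimately have "- (\<epsilon> * (v - u)) \<le> W v - W u" using W_diff[of u v] u v by simp
      then show ?thesis using v by (intro exI[of _ v]) linarith
    qed
  qed (use t in simp)
  moreover have "long_jump \<delta> * integral {t - \<delta>..t} excess \<le> integral {b..t} r"
    unfolding r_def by (rule conv_deficit[OF \<phi>m \<phi>B \<phi>0 \<phi>nn \<delta> t(1)])
  ultimately show ?thesis unfolding W_def D_def by simp
qed

text \<open>Moves from \<open>R\<close> to the left in steps of length \<delta>: if f \<le> g at
  \<sigma>, the right side of \<open>comparison_aux\<close> is 0 there, so the continuous
  nonnegative excess vanishes between \<sigma> - \<delta> and \<sigma>. Strict monotonicity of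
  \<open>H\<close> on [0,1] then gives f \<le> g on that stretch.\<close>

theorem comparison:
  assumes f1: "\<And>t. t \<le> R \<Longrightarrow> f t \<le> 1" and R: "f R \<le> g R" and t: "t \<le> R"
  shows "f t \<le> g t"
proof (cases "t < b")
  case True
  then show ?thesis using f0 g0 by simp
next
  case False
  obtain \<delta> where \<delta>: "0 < \<delta>" and p: "0 < long_jump \<delta>"
    using ex_long_jump by blast
  note \<phi>m = excess_measurable and \<phi>B = excess_bounds(1) and \<phi>nn = excess_bounds(2)
  have c\<phi>: "continuous_on {b..R} excess"
    by (intro continuous_intros continuous_on_compose2[OF H_cont[of UNIV]] cf cg) auto
  have step_back: "f s \<le> g s" if \<sigma>: "b \<le> \<sigma>" "\<sigma> \<le> R" "f \<sigma> \<le> g \<sigma>" and s: "\<sigma> - \<delta> \<le> s" "b \<le> s" "s \<le> \<sigma>" for \<sigma> s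
  proof (rule ccontr)
    assume "\<not> f s \<le> g s"
    then have lt: "g s < f s" by simp
    then have "s < \<sigma>" using s \<sigma> by (cases "s = \<sigma>") auto
    have "long_jump \<delta> * integral {\<sigma> - \<delta>..\<sigma>} excess \<le> 0"
    proof -
      have "0 \<le> w * max 0 (f b - g b)" using w by simp
      moreover have "w * max 0 (f \<sigma> - g \<sigma>) = 0" using \<sigma>(3) by simp
      ultimately show ?thesis
        using comparison_aux[OF \<sigma>(1,2), of \<delta>] \<delta> by linarith
    qed
    then have "integral {\<sigma> - \<delta>..\<sigma>} excess \<le> 0" using p by (simp add: mult_le_0_iff)
    moreover have "integral {s..\<sigma>} excess \<le> integral {\<sigma> - \<delta>..\<sigma>} excess"
      by (rule integral_subset_le) (use s \<phi>nn bounded_integrable_on(1)[OF \<phi>m \<phi>B] in auto)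
    moreover have "0 \<le> integral {s..\<sigma>} excess"
      by (rule integral_nonneg) (use \<phi>nn bounded_integrable_on(1)[OF \<phi>m \<phi>B] in auto)
    ultimately have "integral {s..\<sigma>} excess = 0" by simp
    then have "excess s = 0"
      using integral_eq_0_iff[of s \<sigma> excess] \<open>s < \<sigma>\<close> \<phi>nn continuous_on_subset[OF c\<phi>, of "{s..\<sigma>}"] s \<sigma> by auto
    moreover have "H (g s) < H (f s)" using lt g0 f1 s \<sigma> by (intro H_strict) auto
    ultimately show False by simp
  qed
  have steps: "f s \<le> g s" if "R - real n * \<delta> \<le> s" "b \<le> s" "s \<le> R" for n s
    using that
  proof (induction n arbitrary: s)
    case 0
    then show ?case using R by simp
  next
    case (Suc n)
    show ?case
    proof (cases "R - real n * \<delta> \<le> s")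
      case True
      then show ?thesis using Suc by simp
    next
      case False
      define \<sigma> where "\<sigma> = R - real n * \<delta>"
      have "f \<sigma> \<le> g \<sigma>" unfolding \<sigma>_def using False Suc.prems \<delta> by (intro Suc.IH) auto
      moreover have "b \<le> \<sigma>" "\<sigma> \<le> R" "\<sigma> - \<delta> \<le> s" "s \<le> \<sigma>"
        using False Suc.prems \<delta> by (auto simp: \<sigma>_def algebra_simps)
      ultimately show ?thesis using step_back Suc.prems(2) by blast
    qed
  qed
  obtain n where "R - t < real n * \<delta>" using \<delta> reals_Archimedean3[of \<delta>] by blast
  then show ?thesis using False t by (intro steps[of n]) auto
qed


end
end

text \<open>A pointwise contraction principle; \<open>c\<close> will be the weight
  \<open>exp (4 * t / w)\<close> at the point considered.\<close>

lemma geometric_increments_convergent: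
  fixes x :: "nat \<Rightarrow> real"
  assumes "\<And>n. \<bar>x (Suc n) - x n\<bar> \<le> (1/2)^n * c"
  shows "x \<longlonglongrightarrow> lim x" and "\<bar>lim x - x n\<bar> \<le> 2 * (1/2)^n * c"
proof -
  have c: "0 \<le> c" using assms[of 0] by simp
  have step: "\<bar>x (n + k) - x n\<bar> \<le> 2 * (1/2)^n * c * (1 - (1/2)^k)" for n k
  proof (induction k)
    case (Suc k)
    have "\<bar>x (n + Suc k) - x n\<bar> \<le> \<bar>x (Suc (n + k)) - x (n + k)\<bar> + \<bar>x (n + k) - x n\<bar>" by simp
    also have "\<dots> \<le> (1/2)^(n + k) * c + 2 * (1/2)^n * c * (1 - (1/2)^k)" using assms[of "n + k"] Suc by linarith
    also have "\<dots> = 2 * (1/2)^n * c * (1 - (1/2)^Suc k)" by (simp add: power_add algebra_simps)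
    finally show ?case .
  qed simp
  have bound: "\<bar>x m - x n\<bar> \<le> 2 * (1/2)^n * c" if "n \<le> m" for m n
  proof -
    have "2 * (1/2)^n * c * (1 - (1/2)^(m - n)) \<le> 2 * (1/2)^n * c * 1"
      using c by (intro mult_left_mono) auto
    also have "\<dots> = 2 * (1/2)^n * c" by simp
    finally have le: "2 * (1/2)^n * c * (1 - (1/2)^(m - n)) \<le> 2 * (1/2)^n * c" .
    have "n + (m - n) = m" using that by simp
    then show ?thesis using order_trans[OF step[of n "m - n"] le] by simp
  qed
  have lim0: "(\<lambda>n. 2 * (1/2)^n * c) \<longlonglongrightarrow> 0"
    by (auto intro!: tendsto_eq_intros LIMSEQ_power_zero)
  have "Cauchy x"
  proof (rule metric_CauchyI)
    fix e :: real assume "0 < e"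
    then have "eventually (\<lambda>n. 2 * (1/2)^n * c < e) sequentially" using lim0 by (intro order_tendstoD(2))
    then obtain N where N: "\<And>n. n \<ge> N \<Longrightarrow> 2 * (1/2)^n * c < e" by (auto simp: eventually_sequentially)
    have close: "dist (x m) (x n) < e" if "N \<le> n" "n \<le> m" for m n
      using bound[of n m] N[of n] that by (simp add: dist_real_def)
    have "dist (x m) (x n) < e" if "N \<le> m" "N \<le> n" for m n
      using close[of m n] close[of n m] that by (cases "n \<le> m") (simp_all add: dist_commute)
    then show "\<exists>M. \<forall>m\<ge>M. \<forall>n\<ge>M. dist (x m) (x n) < e" by blast
  qed
  then show lim: "x \<longlonglongrightarrow> lim x" by (simp add: Cauchy_convergent_iff convergent_LIMSEQ_iff)
  show "\<bar>lim x - x n\<bar> \<le> 2 * (1/2)^n * c"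
  proof (rule LIMSEQ_le_const2)
    show "(\<lambda>m. \<bar>x m - x n\<bar>) \<longlonglongrightarrow> \<bar>lim x - x n\<bar>" by (intro tendsto_intros lim)
  qed (use bound in blast)
qed

section \<open>Shooting: solutions of the delay equation with a prescribed atom\<close>

context wave_model begin

text \<open>The frame starts at 0 and has no right end here; the condition at the right end is met
  later by choosing \<open>a\<close>.\<close>

definition picard_op :: "real \<Rightarrow> real \<Rightarrow> (real \<Rightarrow> real) \<Rightarrow> real \<Rightarrow> real" where
  "picard_op w a f t = (if t < 0 then 0 else a + integral {0..t} (K f) / w)"

primrec picard :: "real \<Rightarrow> real \<Rightarrow> nat \<Rightarrow> real \<Rightarrow> real" where
  "picard w a 0 = (\<lambda>t. if t < 0 then 0 else a)"
| "picard w a (Suc n) = picard_op w a (picard w a n)"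

definition profile :: "real \<Rightarrow> real \<Rightarrow> real \<Rightarrow> real" where
  "profile w a t = lim (\<lambda>n. picard w a n t)"

lemma integral_K_mono:
  assumes "mono f" "s \<le> t" shows "integral {0..s} (K f) \<le> integral {0..t} (K f)"
  by (rule integral_subset_le) (use assms K_integrable_on K_01 in auto)

lemma integral_K_nonneg: "mono f \<Longrightarrow> 0 \<le> integral {s..t} (K f)"
  by (rule integral_nonneg) (use K_integrable_on K_01 in auto)

lemma integral_K_le: "mono f \<Longrightarrow> s \<le> t \<Longrightarrow> integral {s..t} (K f) \<le> t - s"
  using integral_le[of "K f" "{s..t}" "\<lambda>_. 1"] K_integrable_on K_01 by auto

lemma picard_op_mono:
  assumes "mono f" "0 < w" "0 \<le> a" shows "mono (picard_op w a f)"
proof (rule monoI)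
  fix s t :: real assume "s \<le> t"
  then show "picard_op w a f s \<le> picard_op w a f t"
    using assms integral_K_mono[of f s t] integral_K_nonneg[of f 0 t]
    by (auto simp: picard_op_def intro: divide_right_mono)
qed

lemma picard_mono: "0 < w \<Longrightarrow> 0 \<le> a \<Longrightarrow> mono (picard w a n)"
proof (induction n)
  case 0
  then show ?case by (auto simp: mono_def)
qed (simp add: picard_op_mono)

lemma picard_neg [simp]: "t < 0 \<Longrightarrow> picard w a n t = 0"
  by (cases n) (simp_all add: picard_op_def)

text \<open>In the norm weighted by \<open>exp (4 t / w)\<close> the Picard operator is a contraction with factor
  \<open>1/2\<close>.\<close>

lemma K_contraction:
  assumes f: "mono f" and g: "mono g" and w: "0 < w" and M: "0 \<le> M" and t: "0 \<le> t" "t \<le> T"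
    and f0: "\<And>s. s < 0 \<Longrightarrow> f s = 0" and g0: "\<And>s. s < 0 \<Longrightarrow> g s = 0"
    and close: "\<And>s. 0 \<le> s \<Longrightarrow> s \<le> T \<Longrightarrow> \<bar>f s - g s\<bar> \<le> M * exp (4 * s / w)"
  shows "\<bar>integral {0..t} (K f) / w - integral {0..t} (K g) / w\<bar> \<le> M / 2 * exp (4 * t / w)"
proof -
  have [measurable]: "f \<in> borel_measurable borel" "g \<in> borel_measurable borel"
    using f g by (auto intro: mono_measurable)
  have K_close: "\<bar>K f s - K g s\<bar> \<le> 2 * M * exp (4 * s / w)" if s: "0 \<le> s" "s \<le> t" for s
  proof -
    have H_close: "\<bar>H (f x) - H (g x)\<bar> \<le> M * exp (4 * s / w)" if x: "x \<le> s" for x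
    proof (cases "x < 0")
      case True
      then show ?thesis using f0 g0 M by simp
    next
      case False
      have "\<bar>H (f x) - H (g x)\<bar> \<le> \<bar>f x - g x\<bar>" by (rule H_lipschitz)
      also have "\<dots> \<le> M * exp (4 * x / w)" using False x s t by (intro close) auto
      also have "\<dots> \<le> M * exp (4 * s / w)" using M x w by (intro mult_left_mono) (auto simp: divide_right_mono)
      finally show ?thesis .
    qed
    have "\<bar>conv (\<lambda>x. H (f x) - H (g x)) s\<bar> \<le> M * exp (4 * s / w)"
    proof (rule abs_conv_le)
      show "\<bar>H (f x) - H (g x)\<bar> \<le> 2" for x using abs_H_le[of "f x"] abs_H_le[of "g x"] by linarith
    qed (simp_all add: H_close)
    moreover have "conv (\<lambda>x. H (f x) - H (g x)) s = conv (\<lambda>x. H (f x)) s - conv (\<lambda>x. H (g x)) s"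
      by (rule conv_diff[where B=1 and B'=1]) (simp_all add: abs_H_le)
    ultimately show ?thesis using H_close[of s] unfolding K_def by simp
  qed
  \<comment> \<open>The two terms of \<open>K\<close> cause the constant 2, and integrating the
    weight contributes \<open>w / 4\<close>; after division by \<open>w\<close> the factor 1/2
    remains.\<close>
  have int: "((\<lambda>s. 2 * M * exp (4 * s / w)) has_integral (M * w / 2 * exp (4 * t / w) - M * w / 2 * exp (4 * 0 / w))) {0..t}"
    by (rule fundamental_theorem_of_calculus)
       (use t w in \<open>auto intro!: derivative_eq_intros simp: has_real_derivative_iff_has_vector_derivative[symmetric]\<close>)
  have "\<bar>integral {0..t} (K f) - integral {0..t} (K g)\<bar> = \<bar>integral {0..t} (\<lambda>s. K f s - K g s)\<bar>"
    by (subst Henstock_Kurzweil_Integration.integral_diff) (auto intro: K_integrable_on f g)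
  also have "\<dots> \<le> integral {0..t} (\<lambda>s. 2 * M * exp (4 * s / w))"
    unfolding real_norm_def[symmetric]
    by (rule integral_norm_bound_integral)
       (use int K_close in \<open>auto intro!: Henstock_Kurzweil_Integration.integrable_diff K_integrable_on f g\<close>)
  also have "\<dots> = M * w / 2 * exp (4 * t / w) - M * w / 2"
    using integral_unique[OF int] by simp
  also have "\<dots> \<le> M * w / 2 * exp (4 * t / w)" using M w by simp
  finally show ?thesis using w by (simp add: diff_divide_distrib[symmetric] field_simps)
qed

lemma picard_increment:
  assumes w: "0 < w" and a: "0 \<le> a" and t: "0 \<le> t"
  shows "\<bar>picard w a (Suc n) t - picard w a n t\<bar> \<le> (1/2)^n * exp (4 * t / w)"
  using t
proof (induction n arbitrary: t)
  case 0
  have "\<bar>picard w a (Suc 0) t - picard w a 0 t\<bar> = integral {0..t} (K (picard w a 0)) / w"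
    using 0 w integral_K_nonneg[OF picard_mono[OF w a], of 0 t 0] by (simp add: picard_op_def)
  also have "\<dots> \<le> t / w"
    using 0 w integral_K_le[OF picard_mono[OF w a], of 0 t 0] by (simp add: divide_right_mono)
  also have "\<dots> \<le> 1 + 4 * t / w" using 0 w by (simp add: field_simps)
  also have "\<dots> \<le> exp (4 * t / w)" by (rule exp_ge_add_one_self)
  finally show ?case by simp
next
  case (Suc n)
  have "\<bar>picard w a (Suc (Suc n)) t - picard w a (Suc n) t\<bar>
     = \<bar>integral {0..t} (K (picard w a (Suc n))) / w - integral {0..t} (K (picard w a n)) / w\<bar>"
    using Suc.prems by (simp add: picard_op_def[of w a "picard w a n"] picard_op_def[of w a "picard_op w a (picard w a n)"])
  also have "\<dots> \<le> (1/2)^n / 2 * exp (4 * t / w)"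
    by (rule K_contraction[OF picard_mono[OF w a] picard_mono[OF w a] w _ Suc.prems order_refl _ _ Suc.IH])
      (simp_all add: picard_op_def)
  finally show ?case by simp
qed

context
  fixes w a :: real
  assumes w: "0 < w" and a: "0 \<le> a"
begin

lemma picard_LIMSEQ: "(\<lambda>n. picard w a n t) \<longlonglongrightarrow> profile w a t"
proof (cases "t < 0")
  case True
  then show ?thesis by (simp add: profile_def lim_const)
next
  case False
  then show ?thesis unfolding profile_def
    by (intro geometric_increments_convergent(1)[where c="exp (4 * t / w)"] picard_increment w a) simp
qed

lemma profile_picard: "0 \<le> t \<Longrightarrow> \<bar>profile w a t - picard w a n t\<bar> \<le> 2 * (1/2)^n * exp (4 * t / w)"
  unfolding profile_def by (intro geometric_increments_convergent(2) picard_increment w a)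

lemma profile_neg [simp]: "t < 0 \<Longrightarrow> profile w a t = 0"
  by (simp add: profile_def lim_const)

lemma profile_mono: "mono (profile w a)"
proof (rule monoI)
  fix s t :: real assume "s \<le> t"
  then show "profile w a s \<le> profile w a t"
    by (intro LIMSEQ_le[OF picard_LIMSEQ picard_LIMSEQ]) (auto intro: monoD[OF picard_mono[OF w a]])
qed

lemma profile_eq:
  assumes t: "0 \<le> t"
  shows "profile w a t = a + integral {0..t} (K (profile w a)) / w"
proof -
  let ?I = "a + integral {0..t} (K (profile w a)) / w"
  have "\<bar>profile w a t - ?I\<bar> \<le> 2 * (1/2)^n * exp (4 * t / w)" for n
  proof -
    have "\<bar>integral {0..t} (K (picard w a n)) / w - integral {0..t} (K (profile w a)) / w\<bar>
       \<le> (2 * (1/2)^n) / 2 * exp (4 * t / w)"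
      by (rule K_contraction[OF picard_mono[OF w a] profile_mono w _ t order_refl])
        (use profile_picard in \<open>auto simp: abs_minus_commute\<close>)
    moreover have "\<bar>profile w a t - picard w a (Suc n) t\<bar> \<le> 2 * (1/2)^Suc n * exp (4 * t / w)"
      by (rule profile_picard[OF t])
    moreover have "picard w a (Suc n) t = a + integral {0..t} (K (picard w a n)) / w"
      using t by (simp add: picard_op_def)
    ultimately show ?thesis by simp
  qed
  moreover have "(\<lambda>n. 2 * (1/2)^n * exp (4 * t / w)) \<longlonglongrightarrow> 0"
    by (auto intro!: tendsto_eq_intros LIMSEQ_power_zero)
  ultimately have "\<bar>profile w a t - ?I\<bar> \<le> 0" by (intro LIMSEQ_le_const[where X="\<lambda>n. 2 * (1/2)^n * exp (4 * t / w)"]) blast+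
  then show ?thesis by simp
qed

lemma profile_0 [simp]: "profile w a 0 = a"
  using profile_eq[of 0] by simp

lemma profile_diff:
  assumes "0 \<le> s" "s \<le> t"
  shows "w * (profile w a t - profile w a s) = integral {s..t} (K (profile w a))"
  by (rule increment_of_integral_equation[OF _ K_integrable_on[OF profile_mono] assms order_refl])
     (use w profile_eq profile_0 in simp)

lemma profile_lipschitz_on: "(1 / w)-lipschitz_on {0..T} (profile w a)"
  by (rule lipschitz_of_integral_equation[OF w _ K_integrable_on[OF profile_mono] K_01[OF profile_mono]])
     (use w profile_eq profile_0 in simp)

lemma profile_lipschitz:
  assumes "0 \<le> s" "0 \<le> t"
  shows "\<bar>profile w a t - profile w a s\<bar> \<le> \<bar>t - s\<bar> / w"
  using lipschitz_onD[OF profile_lipschitz_on[of "max s t"], of t s] assms by (simp add: dist_real_def)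

lemma profile_cont: "continuous_on {0..} (profile w a)"
  by (rule lipschitz_on_continuous_on[of "1 / w"], rule lipschitz_onI)
     (use w in \<open>auto simp: dist_real_def intro: profile_lipschitz[simplified]\<close>)

end

text \<open>Let C be the change of the data. If two iterates differ by at most 2C times the weight,
  the next ones differ by at most C plus C times the weight, so the bound 2C reproduces itself and
  passes to the limit.\<close>

lemma profile_dependence:
  assumes w: "0 < w" and a: "0 \<le> a" and w': "0 < w'" and a': "0 \<le> a'" and t: "0 \<le> t" "t \<le> T"
  shows "\<bar>profile w a t - profile w' a' t\<bar> \<le> 2 * (\<bar>a - a'\<bar> + \<bar>1 / w - 1 / w'\<bar> * T) * exp (4 * t / w)"
proof -
  let ?C = "\<bar>a - a'\<bar> + \<bar>1 / w - 1 / w'\<bar> * T"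
  have C: "\<bar>a - a'\<bar> \<le> ?C" "0 \<le> ?C" using t by auto
  have e: "1 \<le> exp (4 * t / w)" if "0 \<le> t" for t :: real using w that by simp
  have "\<bar>picard w a n t - picard w' a' n t\<bar> \<le> 2 * ?C * exp (4 * t / w)" for n
    using t
  proof (induction n arbitrary: t)
    case 0
    have "\<bar>a - a'\<bar> * 1 \<le> 2 * ?C * exp (4 * t / w)" using C e[of t] 0 by (intro mult_mono) auto
    then show ?case using 0 by simp
  next
    case (Suc n)
    let ?f = "picard w a n" and ?g = "picard w' a' n"
    have 1: "\<bar>integral {0..t} (K ?f) / w - integral {0..t} (K ?g) / w\<bar> \<le> (2 * ?C) / 2 * exp (4 * t / w)"
      by (rule K_contraction[OF picard_mono[OF w a] picard_mono[OF w' a'] w _ Suc.prems _ _ Suc.IH]) (use C in auto)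
    have "\<bar>integral {0..t} (K ?g) / w - integral {0..t} (K ?g) / w'\<bar> = \<bar>1 / w - 1 / w'\<bar> * integral {0..t} (K ?g)"
    proof -
      have "integral {0..t} (K ?g) / w - integral {0..t} (K ?g) / w' = (1 / w - 1 / w') * integral {0..t} (K ?g)"
        by (simp add: algebra_simps)
      then show ?thesis using integral_K_nonneg[OF picard_mono[OF w' a'], of 0 t n] by (simp add: abs_mult)
    qed
    also have "\<dots> \<le> \<bar>1 / w - 1 / w'\<bar> * T"
      using integral_K_le[OF picard_mono[OF w' a'], of 0 t n] Suc.prems by (intro mult_left_mono) auto
    finally have 2: "\<bar>integral {0..t} (K ?g) / w - integral {0..t} (K ?g) / w'\<bar> \<le> \<bar>1 / w - 1 / w'\<bar> * T" .
    have 3: "?C * 1 \<le> ?C * exp (4 * t / w)" using C e[of t] Suc.prems by (intro mult_left_mono) auto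
    have "\<bar>picard w a (Suc n) t - picard w' a' (Suc n) t\<bar>
      = \<bar>(a - a') + (integral {0..t} (K ?f) / w - integral {0..t} (K ?g) / w) + (integral {0..t} (K ?g) / w - integral {0..t} (K ?g) / w')\<bar>"
      using Suc.prems by (simp add: picard_op_def)
    also have "\<dots> \<le> \<bar>a - a'\<bar> + \<bar>integral {0..t} (K ?f) / w - integral {0..t} (K ?g) / w\<bar>
      + \<bar>integral {0..t} (K ?g) / w - integral {0..t} (K ?g) / w'\<bar>" by linarith
    also have "\<dots> \<le> \<bar>a - a'\<bar> + (2 * ?C) / 2 * exp (4 * t / w) + \<bar>1 / w - 1 / w'\<bar> * T"
      by (intro add_mono order_refl 1 2)
    also have "\<dots> = ?C * 1 + ?C * exp (4 * t / w)" by simp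
    also have "\<dots> \<le> ?C * exp (4 * t / w) + ?C * exp (4 * t / w)" by (intro add_right_mono 3)
    also have "\<dots> = 2 * ?C * exp (4 * t / w)" by simp
    finally show ?case .
  qed
  then show ?thesis
    by (intro LIMSEQ_le_const2[OF tendsto_rabs[OF tendsto_diff[OF picard_LIMSEQ[OF w a] picard_LIMSEQ[OF w' a']]]]) auto
qed

lemma profile_zero: "0 < w \<Longrightarrow> profile w 0 t = 0"
proof -
  have "K (\<lambda>_. 0) = (\<lambda>_. 0)" by (rule ext) (simp add: K_def conv_def)
  then have "picard w 0 n = (\<lambda>_. 0)" for n
    by (induction n) (simp_all add: picard_op_def[abs_def] if_distrib cong: if_cong)
  then show ?thesis by (simp add: profile_def lim_const)
qed

text \<open>\<open>comparison_aux\<close> with \<delta> = 0, where the flux integral over a point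
  drops out: the positive part of the difference never falls below its initial value. This inverse
  bound controls the start by the value at the right end.\<close>

lemma profile_expansion:
  assumes w: "0 < w" and a: "0 \<le> a" and a': "0 \<le> a'" and t: "0 \<le> t"
  shows "\<bar>a - a'\<bar> \<le> \<bar>profile w a t - profile w a' t\<bar>"
proof -
  have *: "a - a' \<le> max 0 (profile w a t - profile w a' t)" if a: "0 \<le> a" and a': "0 \<le> a'" for a a'
  proof -
    note cont = continuous_on_subset[OF profile_cont[OF w], of _ "{0..t}"]
    have nn: "0 \<le> profile w a' s" for s
      using monoD[OF profile_mono[OF w a'], of "min s (- 1)" s] profile_neg[OF w a', of "min s (- 1)"] by simp
    have "w * max 0 (profile w a 0 - profile w a' 0) + long_jump 0 *
         integral {t - 0..t} (\<lambda>s. max 0 (H (profile w a s) - H (profile w a' s))) \<le> w * max 0 (profile w a t - profile w a' t)"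
      by (rule comparison_aux[where R=t])
        (use w a a' t nn in \<open>auto simp: profile_mono profile_diff intro!: cont\<close>)
    then have "w * max 0 (a - a') \<le> w * max 0 (profile w a t - profile w a' t)"
      using w a a' by simp
    then have "max 0 (a - a') \<le> max 0 (profile w a t - profile w a' t)" using w by simp
    then show ?thesis by simp
  qed
  show ?thesis using *[OF a a'] *[OF a' a] by (auto simp: max_def split: if_splits)
qed

text \<open>Jumps go to the right, so the flux at \<open>s\<close> sees only values on
  \<open>{..s}\<close>. This permits capping a profile at 1 once it has reached 1.\<close>

lemma K_cong:
  assumes f: "mono f" and g: "mono g" and eq: "\<And>x. x \<le> s \<Longrightarrow> f x = g x"
  shows "K f s = K g s"
proof -
  have [measurable]: "f \<in> borel_measurable borel" "g \<in> borel_measurable borel"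
    using f g by (auto intro: mono_measurable)
  have "conv (\<lambda>x. H (f x)) s = conv (\<lambda>x. H (g x)) s"
    unfolding conv_def
  proof (rule integral_cong_AE)
    show "AE z in jumps. H (f (s - z)) = H (g (s - z))"
      using J_nonneg by eventually_elim (simp add: eq)
  qed measurable
  then show ?thesis by (simp add: K_def eq)
qed

lemma K_translate: "K (\<lambda>x. f (x - c)) s = K f (s - c)"
  by (simp add: K_def conv_def algebra_simps)

lemma integral_K_translate:
  assumes f: "mono f"
  shows "integral {a + c..b + c} (K (\<lambda>x. f (x - c))) = integral {a..b} (K f)"
proof -
  have f': "mono (\<lambda>x. f (x - c))" using f by (simp add: mono_def)
  have "integral {a + c..b + c} (K (\<lambda>x. f (x - c))) = (LINT s|lborel. indicator {a + c..b + c} s * K f (s - c))"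
    unfolding K_translate[symmetric]
    by (rule bounded_integrable_on(2)[OF K_measurable[OF mono_measurable[OF f']] abs_K_le[OF f']])
  also have "\<dots> = (LINT s|lborel. indicator {a..b} s * K f s)"
    using lborel_integral_real_affine[of 1 "\<lambda>s. indicator {a + c..b + c} s * K f (s - c)" c]
    by (simp add: indicator_def if_distrib add.commute cong: if_cong)
  also have "\<dots> = integral {a..b} (K f)"
    by (rule bounded_integrable_on(2)[OF K_measurable[OF mono_measurable[OF f]] abs_K_le[OF f], symmetric])
  finally show ?thesis .
qed

section \<open>Waves in a finite frame\<close>

text \<open>The integrated equation is imposed on \<open>{b..R}\<close> only: right of
  \<open>R\<close> the flux need not vanish although \<gamma> is constant.\<close>

definition is_wave :: "real \<Rightarrow> real \<Rightarrow> real \<Rightarrow> (real \<Rightarrow> real) \<Rightarrow> bool" where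
  "is_wave w b R \<gamma> \<longleftrightarrow> distribution_function \<gamma> \<and> (\<forall>t<b. \<gamma> t = 0) \<and> (\<forall>t\<ge>R. \<gamma> t = 1) \<and>
     (\<forall>t\<in>{b..R}. w * (\<gamma> t - \<gamma> b) = integral {b..t} (K \<gamma>))"

lemma wave_mono: "is_wave w b R \<gamma> \<Longrightarrow> mono \<gamma>"
  by (simp add: is_wave_def distribution_function_def)

lemma wave_01:
  assumes "is_wave w b R \<gamma>" shows "0 \<le> \<gamma> t" "\<gamma> t \<le> 1"
  using monoD[OF wave_mono[OF assms], of "min t (b - 1)" t] monoD[OF wave_mono[OF assms], of t "max t R"] assms
  by (auto simp: is_wave_def)

lemma wave_diff:
  assumes \<gamma>: "is_wave w b R \<gamma>" and st: "b \<le> s" "s \<le> t" "t \<le> R"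
  shows "w * (\<gamma> t - \<gamma> s) = integral {s..t} (K \<gamma>)"
  by (rule increment_of_integral_equation[OF _ K_integrable_on[OF wave_mono[OF \<gamma>]] st])
     (use \<gamma> in \<open>simp add: is_wave_def\<close>)

lemma wave_lipschitz:
  assumes \<gamma>: "is_wave w b R \<gamma>" and w: "0 < w"
  shows "(1 / w)-lipschitz_on {b..R} \<gamma>"
  by (rule lipschitz_of_integral_equation[OF w _ K_integrable_on K_01]; (rule wave_mono[OF \<gamma>])?)
     (use \<gamma> in \<open>simp add: is_wave_def\<close>)

lemma wave_cont: "is_wave w b R \<gamma> \<Longrightarrow> 0 < w \<Longrightarrow> continuous_on {b..R} \<gamma>"
  by (rule lipschitz_on_continuous_on[OF wave_lipschitz])

text \<open>All three monotonicities, and uniqueness, from \<open>comparison\<close> on the common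
  frame \<open>{b..R'}\<close>: \<open>f\<close> is a supersolution for the larger speed
  \<open>w'\<close> because it is nondecreasing, and at \<open>R'\<close> the function
  \<open>g\<close> already has the value 1.\<close>

lemma wave_comparison:
  assumes f: "is_wave w b R f" and g: "is_wave w' b' R' g"
    and w: "0 < w" "w \<le> w'" and b: "b' \<le> b" and R: "R' \<le> R" and bR: "b \<le> R'"
  shows "f t \<le> g t"
proof (cases "t \<le> R'")
  case True
  show ?thesis
  proof (rule comparison[where f=f and g=g and t=t and w=w' and b=b and R=R'])
    show "continuous_on {b..R'} f" using wave_cont[OF f w(1)] by (rule continuous_on_subset) (use R in auto)
    show "continuous_on {b..R'} g" using wave_cont[OF g] by (rule continuous_on_subset) (use b w in auto)
    show "integral {s..t} (K f) \<le> w' * (f t - f s)" if "b \<le> s" "s \<le> t" "t \<le> R'" for s t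
    proof -
      have "w * (f t - f s) \<le> w' * (f t - f s)"
        using monoD[OF wave_mono[OF f] that(2)] w by (intro mult_right_mono) auto
      then show ?thesis using wave_diff[OF f that(1,2)] that R by simp
    qed
    show "w' * (g t - g s) \<le> integral {s..t} (K g)" if "b \<le> s" "s \<le> t" "t \<le> R'" for s t
      using wave_diff[OF g _ that(2,3)] that b by simp
    show "f R' \<le> g R'" using wave_01(2)[OF f, of R'] g by (simp add: is_wave_def)
    show "f t = 0" if "t < b" for t using f that by (simp add: is_wave_def)
  qed (use True w wave_01[OF f] wave_01[OF g] wave_mono[OF f] wave_mono[OF g] in auto)
next
  case False
  then show ?thesis using wave_01(2)[OF f, of t] g by (simp add: is_wave_def)
qed

lemma wave_unique:
  assumes "is_wave w b R f" "is_wave w b R g" "0 < w" "b \<le> R" shows "f = g"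
  using wave_comparison[OF assms(1,2)] wave_comparison[OF assms(2,1)] assms(3,4)
  by (intro ext antisym) auto

text \<open>The cap leaves the equation on the frame intact: the profile is at most 1 up to
  \<open>l\<close>, and by \<open>K_cong\<close> nothing further right matters.\<close>

lemma profile_wave:
  assumes w: "0 < w" and a: "0 \<le> a" and l: "0 < l" and hit: "profile w a l = 1"
  shows "is_wave w b (b + l) (\<lambda>t. min 1 (profile w a (t - b)))" (is "is_wave _ _ _ ?\<gamma>")
proof -
  note pm = profile_mono[OF w a] and pn = profile_neg[OF w a] and pc = profile_cont[OF w a]
  have m: "mono ?\<gamma>" using pm by (auto simp: mono_def min_def intro: order_trans)
  have le1: "profile w a s \<le> 1" if "s \<le> l" for s using monoD[OF pm that] hit by simp
  have ge1: "1 \<le> profile w a s" if "l \<le> s" for s using monoD[OF pm that] hit by simp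
  have neg: "?\<gamma> t = 0" if "t < b" for t using pn[of "t - b"] that by simp
  have one: "?\<gamma> t = 1" if "b + l \<le> t" for t using ge1[of "t - b"] that by simp
  have rc: "continuous (at_right t) ?\<gamma>" for t
  proof (cases "t < b")
    case True
    have "\<forall>\<^sub>F s in at_right t. ?\<gamma> s = 0"
      using eventually_at_right_less eventually_at_right_real[OF True]
      by eventually_elim (use neg in auto)
    then show ?thesis using neg[OF True] unfolding continuous_within by (simp add: tendsto_eventually)
  next
    case False
    have "continuous_on {b..} ?\<gamma>"
      by (intro continuous_intros continuous_on_compose2[OF pc]) auto
    then have "continuous (at t within {b..}) ?\<gamma>" using False by (simp add: continuous_on_eq_continuous_within)
    then show ?thesis by (rule continuous_within_subset) (use False in auto)
  qed
  have "distribution_function ?\<gamma>"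
    unfolding distribution_function_def
  proof (intro conjI m allI rc)
    show "(?\<gamma> \<longlongrightarrow> 0) at_bot"
      by (rule tendsto_eventually, rule eventually_mono[OF eventually_gt_at_bot[of b]]) (use neg in auto)
    show "(?\<gamma> \<longlongrightarrow> 1) at_top"
      by (rule tendsto_eventually, rule eventually_mono[OF eventually_ge_at_top[of "b + l"]]) (use one in auto)
  qed
  moreover have "w * (?\<gamma> t - ?\<gamma> b) = integral {b..t} (K ?\<gamma>)" if t: "t \<in> {b..b + l}" for t
  proof -
    have pm': "mono (\<lambda>s. profile w a (s - b))" using pm by (simp add: mono_def)
    have "integral {b..t} (K ?\<gamma>) = integral {b..t} (K (\<lambda>s. profile w a (s - b)))"
      by (intro integral_cong K_cong m pm') (use le1 t in auto)
    also have "\<dots> = integral {0..t - b} (K (profile w a))"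
      using integral_K_translate[OF pm, of 0 b "t - b"] by simp
    also have "\<dots> = w * (profile w a (t - b) - profile w a 0)"
      using t by (intro profile_diff[symmetric] w a) auto
    also have "\<dots> = w * (?\<gamma> t - ?\<gamma> b)" using t le1[of "t - b"] le1[of 0] l by simp
    finally show ?thesis ..
  qed
  ultimately show ?thesis unfolding is_wave_def using neg one by auto
qed

text \<open>Intermediate value theorem in the atom: start 0 gives the zero profile, and start 1
  gives a value of at least 1 at \<open>l\<close>.\<close>

lemma ex_hitting_start:
  assumes w: "0 < w" and l: "0 < l"
  shows "\<exists>a. 0 \<le> a \<and> a \<le> 1 \<and> profile w a l = 1"
proof -
  have "continuous_on {0..1} (\<lambda>a. profile w a l)"
  proof (rule lipschitz_on_continuous_on[of "2 * exp (4 * l / w)"], rule lipschitz_onI)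
    fix a a' :: real assume "a \<in> {0..1}" "a' \<in> {0..1}"
    then show "dist (profile w a l) (profile w a' l) \<le> 2 * exp (4 * l / w) * dist a a'"
      using profile_dependence[OF w _ w, of a a' l l] l by (simp add: dist_real_def mult_ac)
  qed simp
  moreover have "profile w 0 l \<le> 1" using profile_zero[OF w] by simp
  moreover have "1 \<le> profile w 1 l"
    using monoD[OF profile_mono[OF w], of 1 0 l] profile_0[OF w, of 1] l by simp
  ultimately show ?thesis using IVT'[of "\<lambda>a. profile w a l" 0 1 1] by auto
qed

text \<open>The choice is harmless: by \<open>profile_expansion\<close> at most one start reaches
  the value 1 at \<open>l\<close>.\<close>

definition wave_start :: "real \<Rightarrow> real \<Rightarrow> real" where
  "wave_start w l = (SOME a. 0 \<le> a \<and> a \<le> 1 \<and> profile w a l = 1)"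

lemma wave_start:
  assumes "0 < w" "0 < l"
  shows "0 \<le> wave_start w l" "wave_start w l \<le> 1" "profile w (wave_start w l) l = 1"
  using someI_ex[OF ex_hitting_start[OF assms]] unfolding wave_start_def by auto

definition wave :: "real \<Rightarrow> real \<Rightarrow> real \<Rightarrow> real \<Rightarrow> real" where
  "wave w b R t = min 1 (profile w (wave_start w (R - b)) (t - b))"

lemma is_wave_wave: "0 < w \<Longrightarrow> b < R \<Longrightarrow> is_wave w b R (wave w b R)"
  using profile_wave[OF _ wave_start(1) _ wave_start(3), of w "R - b" b] unfolding wave_def by simp

lemma wave_translate: "wave w (b + c) (R + c) t = wave w b R (t - c)"
  by (simp add: wave_def algebra_simps)

text \<open>\<open>profile_expansion\<close> passes from starts to values at \<open>l\<close>. Both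
  starts reach 1 at their own lengths, so what remains is one start compared at two speeds and at
  two lengths.\<close>

lemma wave_start_close:
  assumes w: "0 < w" and l: "0 < l" and w': "0 < w'" and l': "0 < l'"
  shows "\<bar>wave_start w l - wave_start w' l'\<bar> \<le> 2 * \<bar>1 / w - 1 / w'\<bar> * l * exp (4 * l / w) + \<bar>l - l'\<bar> / w'"
proof -
  let ?a = "wave_start w l" and ?a' = "wave_start w' l'"
  note a = wave_start[OF w l] and a' = wave_start[OF w' l']
  have "\<bar>?a - ?a'\<bar> \<le> \<bar>profile w ?a l - profile w ?a' l\<bar>"
    using l by (intro profile_expansion w a a') simp
  also have "\<dots> = \<bar>profile w ?a' l - profile w' ?a' l'\<bar>" by (simp add: a a' abs_minus_commute)
  also have "\<dots> \<le> \<bar>profile w ?a' l - profile w' ?a' l\<bar> + \<bar>profile w' ?a' l - profile w' ?a' l'\<bar>" by linarith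
  also have "\<bar>profile w ?a' l - profile w' ?a' l\<bar> \<le> 2 * (\<bar>?a' - ?a'\<bar> + \<bar>1 / w - 1 / w'\<bar> * l) * exp (4 * l / w)"
    using l by (intro profile_dependence w w' a') auto
  also have "\<bar>profile w' ?a' l - profile w' ?a' l'\<bar> \<le> \<bar>l - l'\<bar> / w'"
    using l l' by (intro profile_lipschitz w' a') auto
  finally show ?thesis by simp
qed

text \<open>Combines the continuity of the start, of the profile in its parameters and of the
  profile in its argument; \<open>b0 < t\<close> keeps \<open>t - b k\<close> eventually positive,
  where profiles are Lipschitz.\<close>

lemma wave_continuous:
  assumes w: "\<And>k. 0 < w k" "0 < w0" and bR: "\<And>k. b k < R k" "b0 < R0"
    and lim: "w \<longlonglongrightarrow> w0" "b \<longlonglongrightarrow> b0" "R \<longlonglongrightarrow> R0" and t: "b0 < t"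
  shows "(\<lambda>k. wave (w k) (b k) (R k) t) \<longlonglongrightarrow> wave w0 b0 R0 t"
proof -
  define l where "l k = R k - b k" for k
  define l0 where "l0 = R0 - b0"
  define a where "a k = wave_start (w k) (l k)" for k
  define a0 where "a0 = wave_start w0 l0"
  have l: "0 < l k" "0 < l0" "l \<longlonglongrightarrow> l0" for k
    using bR lim by (auto simp: l_def[abs_def] l0_def intro!: tendsto_intros)
  have a: "0 \<le> a k" "0 \<le> a0" for k unfolding a_def a0_def using w l by (auto intro: wave_start)
  have inv: "(\<lambda>k. 1 / w0 - 1 / w k) \<longlonglongrightarrow> 0" using lim w by (auto intro!: tendsto_eq_intros)
  have a_lim: "(\<lambda>k. a0 - a k) \<longlonglongrightarrow> 0"
  proof (rule Lim_null_comparison)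
    show "\<forall>\<^sub>F k in sequentially. norm (a0 - a k) \<le> 2 * \<bar>1 / w0 - 1 / w k\<bar> * l0 * exp (4 * l0 / w0) + \<bar>l0 - l k\<bar> / w k"
      unfolding a_def a0_def using wave_start_close w l by (intro always_eventually) auto
    show "(\<lambda>k. 2 * \<bar>1 / w0 - 1 / w k\<bar> * l0 * exp (4 * l0 / w0) + \<bar>l0 - l k\<bar> / w k) \<longlonglongrightarrow> 0"
      using inv l lim w by (auto intro!: tendsto_eq_intros)
  qed
  have a_lim': "a \<longlonglongrightarrow> a0" using tendsto_diff[OF tendsto_const[of a0] a_lim] by simp
  have "(\<lambda>k. profile w0 a0 (t - b0) - profile (w k) (a k) (t - b k)) \<longlonglongrightarrow> 0"
  proof (rule Lim_null_comparison)
    let ?T = "t - b0"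
    show "\<forall>\<^sub>F k in sequentially. norm (profile w0 a0 ?T - profile (w k) (a k) (t - b k))
      \<le> 2 * (\<bar>a0 - a k\<bar> + \<bar>1 / w0 - 1 / w k\<bar> * ?T) * exp (4 * ?T / w0) + \<bar>b k - b0\<bar> / w k"
      using order_tendstoD(2)[OF lim(2) t]
    proof eventually_elim
      case (elim k)
      have "\<bar>profile w0 a0 ?T - profile (w k) (a k) ?T\<bar> \<le> 2 * (\<bar>a0 - a k\<bar> + \<bar>1 / w0 - 1 / w k\<bar> * ?T) * exp (4 * ?T / w0)"
        using t by (intro profile_dependence w a) auto
      moreover have "\<bar>profile (w k) (a k) ?T - profile (w k) (a k) (t - b k)\<bar> \<le> \<bar>?T - (t - b k)\<bar> / w k"
        using t elim by (intro profile_lipschitz w a) auto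
      ultimately show ?case by simp
    qed
    show "(\<lambda>k. 2 * (\<bar>a0 - a k\<bar> + \<bar>1 / w0 - 1 / w k\<bar> * ?T) * exp (4 * ?T / w0) + \<bar>b k - b0\<bar> / w k) \<longlonglongrightarrow> 0"
      using inv a_lim' lim w by (auto intro!: tendsto_eq_intros)
  qed
  then have "(\<lambda>k. profile (w k) (a k) (t - b k)) \<longlonglongrightarrow> profile w0 a0 (t - b0)"
    using tendsto_diff[OF tendsto_const[of "profile w0 a0 (t - b0)"]] by fastforce
  then show ?thesis
    unfolding wave_def a_def a0_def l_def l0_def by (intro tendsto_intros)
qed

section \<open>Strict monotonicity, and the limits of large and small speed\<close>

lemma K_lower_bound:
  assumes f: "mono f"
  shows "long_jump \<delta> * (H (f s) - H (f (s - \<delta>))) \<le> K f s"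
proof -
  have [measurable]: "f \<in> borel_measurable borel" using f by (rule mono_measurable)
  have i: "integrable jumps (\<lambda>z. H (f (s - z)))"
    by (rule integrable_conv[of "\<lambda>x. H (f x)" 1]) (auto simp: abs_H_le)
  have "long_jump \<delta> * (H (f s) - H (f (s - \<delta>)))
      = (LINT z|jumps. indicator {\<delta>..} z * (H (f s) - H (f (s - \<delta>))))" by simp
  also have "\<dots> \<le> (LINT z|jumps. H (f s) - H (f (s - z)))"
  proof (rule integral_mono_AE)
    show "integrable jumps (\<lambda>z. indicator {\<delta>..} z * (H (f s) - H (f (s - \<delta>))))"
      by (intro integrable_mult_left integrable_real_indicator) (auto simp: J.emeasure_eq_measure)
    show "AE z in jumps. indicator {\<delta>..} z * (H (f s) - H (f (s - \<delta>))) \<le> H (f s) - H (f (s - z))"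
      using J_nonneg
    proof eventually_elim
      case (elim z)
      then show ?case using H_mono[OF monoD[OF f, of "s - z" s]] H_mono[OF monoD[OF f, of "s - z" "s - \<delta>"]]
        by (auto split: split_indicator)
    qed
  qed (use i in simp)
  also have "\<dots> = K f s" using i J.prob_space by (simp add: K_def conv_def)
  finally show ?thesis .
qed

text \<open>Without an atom the profile would be identically 0 and could not reach 1.\<close>

lemma wave_pos:
  assumes w: "0 < w" and bR: "b < R" and t: "b \<le> t"
  shows "0 < wave w b R t"
proof -
  have l: "0 < R - b" using bR by simp
  have "wave_start w (R - b) \<noteq> 0"
    using wave_start(3)[OF w l] profile_zero[OF w, of "R - b"] by auto
  then have "0 < wave w b R b"
    using wave_start(1)[OF w l] profile_0[OF w wave_start(1)[OF w l]] by (simp add: wave_def)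
  also have "\<dots> \<le> wave w b R t" using wave_mono[OF is_wave_wave[OF w bR]] t by (rule monoD)
  finally show ?thesis .
qed

text \<open>Suppose there is a flat stretch at height c, and let \<sigma> be the first point where c
  is reached. Jumps of length at least \<delta> from below \<sigma> cross the levels just right of
  \<sigma>, so the flux there is bounded below and the wave has to rise.\<close>

lemma wave_strict:
  assumes w: "0 < w" and bR: "b < R" and st: "b \<le> s" "s < t" "t \<le> R"
  shows "wave w b R s < wave w b R t"
proof (rule ccontr)
  let ?\<gamma> = "wave w b R"
  note W = is_wave_wave[OF w bR]
  note m = wave_mono[OF W]
  assume "\<not> ?\<gamma> s < ?\<gamma> t"
  then have eq: "?\<gamma> s = ?\<gamma> t" using monoD[OF m, of s t] st by simp
  define c where "c = ?\<gamma> t"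
  have c: "0 < c" "c \<le> 1" using wave_pos[OF w bR, of t] wave_01(2)[OF W] st by (auto simp: c_def)
  define S where "S = {b..s} \<inter> ?\<gamma> -` {c..}"
  have "closed S" unfolding S_def
    by (intro continuous_closed_preimage continuous_on_subset[OF wave_cont[OF W w]]) (use st in auto)
  then have "compact S" unfolding compact_eq_bounded_closed
    by (auto simp: S_def intro: bounded_subset[of "{b..s}"])
  moreover have "s \<in> S" using st eq by (simp add: S_def c_def)
  ultimately obtain \<sigma> where \<sigma>: "\<sigma> \<in> S" "\<And>u. u \<in> S \<Longrightarrow> \<sigma> \<le> u" using compact_attains_inf[of S] by blast
  have \<sigma>b: "b \<le> \<sigma>" "\<sigma> \<le> s" "c \<le> ?\<gamma> \<sigma>" using \<sigma>(1) by (auto simp: S_def)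
  have below: "?\<gamma> u < c" if "u < \<sigma>" for u
  proof (cases "u < b")
    case True
    then show ?thesis using W c by (simp add: is_wave_def)
  next
    case False
    then show ?thesis using \<sigma>(2)[of u] that \<sigma>b by (auto simp: S_def not_le[symmetric])
  qed
  obtain \<delta> where \<delta>: "0 < \<delta>" and p: "0 < long_jump \<delta>"
    using ex_long_jump by blast
  \<comment> \<open>For \<open>u\<close> up to \<sigma> + \<delta>/2 the point
    \<open>u - \<delta>\<close> lies left of \<sigma> - \<delta>/2, where the wave is at most
    \<open>c' < c\<close>.\<close>
  define v where "v = min t (\<sigma> + \<delta> / 2)"
  have v: "\<sigma> < v" "v \<le> t" using \<sigma>b st \<delta> by (auto simp: v_def)
  define c' where "c' = ?\<gamma> (\<sigma> - \<delta> / 2)"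
  have c': "0 \<le> c'" "c' < c" using wave_01(1)[OF W] below[of "\<sigma> - \<delta> / 2"] \<delta> by (auto simp: c'_def)
  define \<kappa> where "\<kappa> = long_jump \<delta> * (H c - H c')"
  have \<kappa>: "0 < \<kappa>" using p H_strict[OF c' c(2)] by (simp add: \<kappa>_def)
  have const: "?\<gamma> u = c" if "\<sigma> \<le> u" "u \<le> t" for u
    using monoD[OF m that(1)] monoD[OF m that(2)] \<sigma>b(3) by (simp add: c_def)
  have "\<kappa> \<le> K ?\<gamma> u" if u: "u \<in> {\<sigma>..v}" for u
  proof -
    have "?\<gamma> (u - \<delta>) \<le> c'" unfolding c'_def using u v by (intro monoD[OF m]) (auto simp: v_def)
    then have "\<kappa> \<le> long_jump \<delta> * (H c - H (?\<gamma> (u - \<delta>)))"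
      unfolding \<kappa>_def by (intro mult_left_mono diff_left_mono H_mono) auto
    also have "\<dots> = long_jump \<delta> * (H (?\<gamma> u) - H (?\<gamma> (u - \<delta>)))"
      using const[of u] u v by simp
    also have "\<dots> \<le> K ?\<gamma> u" by (rule K_lower_bound[OF m])
    finally show ?thesis .
  qed
  then have "integral {\<sigma>..v} (\<lambda>_. \<kappa>) \<le> integral {\<sigma>..v} (K ?\<gamma>)"
    by (intro integral_le K_integrable_on m) auto
  also have "\<dots> = w * (?\<gamma> v - ?\<gamma> \<sigma>)" using \<sigma>b v st by (intro wave_diff[OF W, symmetric]) auto
  also have "\<dots> = 0" using const[of v] const[of \<sigma>] v by simp
  finally have "\<kappa> * (v - \<sigma>) \<le> 0" using v by (simp add: mult.commute)
  then show False using \<kappa> v by (simp add: mult_le_0_iff)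
qed

text \<open>The flux is at most 1, so the wave gains at most \<open>(R - b) / w\<close> over the
  frame; all the rest is the atom at \<open>b\<close>.\<close>

lemma wave_large_w:
  assumes w: "0 < w" and bR: "b < R" and t: "b \<le> t"
  shows "1 - (R - b) / w \<le> wave w b R t"
proof -
  note W = is_wave_wave[OF w bR]
  have "w * (wave w b R R - wave w b R b) \<le> R - b"
    using wave_diff[OF W, of b R] integral_K_le[OF wave_mono[OF W], of b R] bR by simp
  moreover have "wave w b R R = 1" using W by (simp add: is_wave_def)
  ultimately have "1 - (R - b) / w \<le> wave w b R b" using w by (simp add: field_simps)
  also have "\<dots> \<le> wave w b R t" using wave_mono[OF W] t by (rule monoD)
  finally show ?thesis .
qed

text \<open>By \<open>conv_deficit\<close> on the whole frame, jumps of length at least \<delta>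
  carry a fixed fraction of the integral of \<open>H\<close> along the wave near \<open>R\<close>
  out of the frame, while the equation limits this loss to \<open>w\<close>. Monotonicity transfers
  the bound from near \<open>R\<close> to \<open>t\<close>; the constant depends on \<open>t\<close>
  but not on \<open>w\<close>.\<close>

lemma wave_small_w:
  assumes bR: "b < R" and t: "t < R"
  shows "\<exists>C. \<forall>w>0. H (wave w b R t) \<le> C * w"
proof -
  obtain \<delta> where \<delta>: "0 < \<delta>" and p: "0 < long_jump \<delta>"
    using ex_long_jump by blast
  let ?p = "long_jump \<delta>"
  define u where "u = max t (R - \<delta>)"
  have u: "u < R" "t \<le> u" "R - \<delta> \<le> u" using t \<delta> by (auto simp: u_def)
  have "H (wave w b R t) \<le> 1 / (?p * (R - u)) * w" if w: "0 < w" for w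
  proof -
    let ?\<gamma> = "wave w b R"
    note W = is_wave_wave[OF w bR]
    note m = wave_mono[OF W]
    have [measurable]: "?\<gamma> \<in> borel_measurable borel" using m by (rule mono_measurable)
    have i: "(\<lambda>s. H (?\<gamma> s)) integrable_on {x..y}" for x y
      by (rule bounded_integrable_on(1)[where B=1]) (simp_all add: abs_H_le)
    have "(R - u) * H (?\<gamma> t) = integral {u..R} (\<lambda>_. H (?\<gamma> t))" using u by simp
    also have "\<dots> \<le> integral {u..R} (\<lambda>s. H (?\<gamma> s))"
      by (intro integral_le i) (use u in \<open>auto intro!: H_mono monoD[OF m]\<close>)
    also have "\<dots> \<le> integral {R - \<delta>..R} (\<lambda>s. H (?\<gamma> s))"
      by (rule integral_subset_le) (use u i H_01 in auto)
    finally have "?p * ((R - u) * H (?\<gamma> t)) \<le> ?p * integral {R - \<delta>..R} (\<lambda>s. H (?\<gamma> s))"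
      using p by (intro mult_left_mono) auto
    also have "\<dots> \<le> integral {b..R} (\<lambda>s. H (?\<gamma> s) - conv (\<lambda>x. H (?\<gamma> x)) s)"
      by (rule conv_deficit[where B=1]) (use W bR \<delta> in \<open>auto simp: abs_H_le H_01 is_wave_def\<close>)
    also have "\<dots> = w * (?\<gamma> R - ?\<gamma> b)"
      using wave_diff[OF W, of b R] bR by (simp add: K_def[abs_def])
    also have "\<dots> \<le> w * 1"
      using wave_01[OF W, of R] wave_01[OF W, of b] w by (intro mult_left_mono) auto
    finally show ?thesis using p u by (simp add: field_simps)
  qed
  then show ?thesis by blast
qed

lemma wave_tendsto_1:
  assumes w: "\<And>k. 0 < w k" "filterlim w at_top sequentially" and bR: "b < R" and t: "b \<le> t"
  shows "(\<lambda>k. wave (w k) b R t) \<longlonglongrightarrow> 1"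
proof (rule tendsto_sandwich)
  show "\<forall>\<^sub>F k in sequentially. 1 - (R - b) / w k \<le> wave (w k) b R t"
    using wave_large_w w bR t by (intro always_eventually) auto
  show "\<forall>\<^sub>F k in sequentially. wave (w k) b R t \<le> 1"
    using wave_01(2)[OF is_wave_wave] w bR by (intro always_eventually) auto
  have "(\<lambda>k. 1 - (R - b) / w k) \<longlonglongrightarrow> 1 - 0"
    by (intro tendsto_intros tendsto_divide_0[OF tendsto_const] filterlim_at_top_imp_at_infinity w)
  then show "(\<lambda>k. 1 - (R - b) / w k) \<longlonglongrightarrow> 1" by simp
qed simp

lemma wave_tendsto_0:
  assumes w: "\<And>k. 0 < w k" "w \<longlonglongrightarrow> 0" and bR: "b < R" and t: "t < R"
  shows "(\<lambda>k. wave (w k) b R t) \<longlonglongrightarrow> 0"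
proof (rule order_tendstoI)
  fix y :: real assume "y < 0"
  then show "\<forall>\<^sub>F k in sequentially. y < wave (w k) b R t"
    using wave_01(1)[OF is_wave_wave[OF w(1) bR]] by (intro always_eventually allI) (rule less_le_trans)
next
  fix y :: real assume y: "0 < y"
  \<comment> \<open>\<open>H\<close> is constant beyond 1, so the threshold is lowered to at most 1
    before \<open>H_strict\<close> is applied.\<close>
  define e where "e = min y 1"
  have e: "0 < e" "e \<le> 1" "e \<le> y" using y by (auto simp: e_def)
  obtain C where C: "\<And>w. 0 < w \<Longrightarrow> H (wave w b R t) \<le> C * w" using wave_small_w[OF bR t] by blast
  have "(\<lambda>k. C * w k) \<longlonglongrightarrow> 0" using w(2) by (auto intro!: tendsto_eq_intros)
  moreover have "0 < H e" using H_strict[of 0 e] e by simp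
  ultimately have "\<forall>\<^sub>F k in sequentially. C * w k < H e" by (rule order_tendstoD(2))
  then show "\<forall>\<^sub>F k in sequentially. wave (w k) b R t < y"
  proof eventually_elim
    case (elim k)
    then have "H (wave (w k) b R t) < H e" using C[OF w(1)[of k]] by simp
    then have "wave (w k) b R t < e" using H_mono[of e "wave (w k) b R t"] by (meson not_less)
    then show ?case using e by simp
  qed
qed

text \<open>Continuity in \<open>w\<close> and the two limits give a speed at which the wave has the
  value \<nu> at \<open>y\<close>. By \<open>wave_strict\<close> it is smaller than \<nu> to the
  left of \<open>y\<close>, so \<open>y\<close> is exactly the quantile.\<close>

lemma ex_wave_quantile:
  assumes y: "b < y" "y < R" and \<nu>: "0 < \<nu>" "\<nu> < 1"
  shows "\<exists>w>0. quantile (wave w b R) \<nu> = y"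
proof -
  have bR: "b < R" using y by simp
  have "(\<lambda>k. wave (real (Suc k)) b R y) \<longlonglongrightarrow> 1"
  proof (rule wave_tendsto_1[OF _ _ bR])
    show "filterlim (\<lambda>k. real (Suc k)) at_top sequentially"
      using filterlim_compose[OF filterlim_real_sequentially filterlim_Suc] .
  qed (use y in auto)
  then have "\<forall>\<^sub>F k in sequentially. \<nu> < wave (real (Suc k)) b R y" using \<nu> by (intro order_tendstoD(1))
  then obtain k where k: "\<nu> < wave (real (Suc k)) b R y" by (auto simp: eventually_sequentially)
  have "(\<lambda>k. wave (inverse (real (Suc k))) b R y) \<longlonglongrightarrow> 0"
    by (rule wave_tendsto_0[OF _ LIMSEQ_inverse_real_of_nat bR y(2)]) simp
  then have "\<forall>\<^sub>F k in sequentially. wave (inverse (real (Suc k))) b R y < \<nu>" using \<nu> by (intro order_tendstoD(2))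
  then obtain j where j: "wave (inverse (real (Suc j))) b R y < \<nu>" by (auto simp: eventually_sequentially)
  let ?u = "inverse (real (Suc j))" and ?v = "real (Suc k)"
  have u: "0 < ?u" "?u \<le> 1" "1 \<le> ?v" by (auto simp: field_simps)
  have "continuous_on {?u..?v} (\<lambda>w. wave w b R y)"
    unfolding continuous_on_sequentially
  proof (intro allI ballI impI, elim conjE)
    fix x a assume x: "\<forall>n. x n \<in> {?u..?v}" "a \<in> {?u..?v}" "x \<longlonglongrightarrow> a"
    have "(\<lambda>n. wave (x n) b R y) \<longlonglongrightarrow> wave a b R y"
    proof (rule wave_continuous)
      show "0 < x n" for n using x(1) u(1) by (meson atLeastAtMost_iff less_le_trans)
      show "0 < a" using x(2) u(1) by (meson atLeastAtMost_iff less_le_trans)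
    qed (use x bR y in auto)
    then show "((\<lambda>w. wave w b R y) \<circ> x) \<longlonglongrightarrow> wave a b R y" by (simp add: comp_def)
  qed
  then obtain w where w: "?u \<le> w" "w \<le> ?v" "wave w b R y = \<nu>"
    using IVT'[of "\<lambda>w. wave w b R y" ?u \<nu> ?v] j k u by auto
  have w0: "0 < w" using u(1) w(1) by (rule less_le_trans)
  note W = is_wave_wave[OF w0 bR]
  have "{z. wave w b R z \<ge> \<nu>} = {y..}"
  proof (intro set_eqI iffI)
    fix z assume "z \<in> {z. wave w b R z \<ge> \<nu>}"
    then have z: "\<nu> \<le> wave w b R z" by simp
    show "z \<in> {y..}"
    proof (rule ccontr)
      assume "z \<notin> {y..}"
      then have "z < y" by simp
      then have "wave w b R z < \<nu>"
        using wave_strict[OF w0 bR, of z y] W w(3) \<nu> y by (cases "z < b") (auto simp: is_wave_def)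
      then show False using z by simp
    qed
  qed (use monoD[OF wave_mono[OF W], of y] w(3) in auto)
  then have "quantile (wave w b R) \<nu> = y" unfolding quantile_def by simp
  then show ?thesis using w0 by blast
qed

end

section \<open>Traveling waves as solutions of the delay equation\<close>

context wave_model begin

lemma set_lebesgue_integral_\<eta>:
  assumes "0 \<le> x" "x \<le> y" "y \<le> 1"
  shows "(LBINT \<nu>:{x..y}. \<eta> \<nu>) = H y - H x"
proof -
  have "set_integrable lborel {x..y} \<eta>"
    by (rule borel_integrable_atLeastAtMost') (rule continuous_on_subset[OF \<eta>_cont], use assms in auto)
  from set_borel_integral_eq_integral(2)[OF this] show ?thesis using assms by (simp add: H_diff)
qed

context
  fixes \<gamma> :: "real \<Rightarrow> real"
  assumes \<gamma>: "distribution_function \<gamma>"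
begin

abbreviation "\<mu> \<equiv> interval_measure \<gamma>"

interpretation M: real_distribution \<mu>
  by (rule distribution_function_measure(1)[OF \<gamma>])

lemma cdf_interval [simp]: "measure \<mu> {..y} = \<gamma> y"
  using fun_cong[OF distribution_function_measure(2)[OF \<gamma>], of y] by (simp add: cdf_def)

lemma df_01: "0 \<le> \<gamma> y" "\<gamma> y \<le> 1"
  using M.prob_le_1[of "{..y}"] measure_nonneg[of \<mu> "{..y}"] unfolding cdf_interval by simp_all

lemma df_mono: "mono \<gamma>"
  using \<gamma> by (simp add: distribution_function_def)

abbreviation "left_limit y \<equiv> measure \<mu> {..<y}"

lemma df_left:
  "0 \<le> left_limit y" "left_limit y \<le> \<gamma> y"
  "x < y \<Longrightarrow> \<gamma> x \<le> left_limit y"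
proof -
  have "left_limit y \<le> measure \<mu> {..y}"
    by (rule M.finite_measure_mono) auto
  then show "left_limit y \<le> \<gamma> y" by (simp only: cdf_interval)
  assume "x < y"
  then have "measure \<mu> {..x} \<le> left_limit y"
    by (intro M.finite_measure_mono) auto
  then show "\<gamma> x \<le> left_limit y" by (simp only: cdf_interval)
qed (rule measure_nonneg)

lemma df_atom: "measure \<mu> {y} = \<gamma> y - left_limit y"
proof -
  have "measure \<mu> ({..<y} \<union> {y}) = left_limit y + measure \<mu> {y}"
    by (rule M.finite_measure_Union) auto
  moreover have "{..<y} \<union> {y} = {..y}" by auto
  ultimately have "\<gamma> y = left_limit y + measure \<mu> {y}"
    by (simp only: cdf_interval)
  then show ?thesis by simp
qed

text \<open>At an atom \<open>eta_bar\<close> is the slope of the chord of \<open>H\<close> across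
  the jump of \<gamma>, hence it lies between the values of \<eta> at both ends; without an atom the
  last identity reads 0 = 0.\<close>

lemma eta_bar_props:
  "\<eta> (\<gamma> y) \<le> eta_bar \<eta> y \<gamma>" "eta_bar \<eta> y \<gamma> \<le> \<eta> (left_limit y)"
  "measure \<mu> {y} * eta_bar \<eta> y \<gamma> = H (\<gamma> y) - H (left_limit y)"
proof -
  let ?l = "left_limit y"
  have cont: "isCont \<gamma> y \<longleftrightarrow> measure \<mu> {y} = 0"
    using M.isCont_cdf[of y] distribution_function_measure(2)[OF \<gamma>] by simp
  have "Lim (at_left y) \<gamma> = ?l"
    using M.cdf_at_left[of y] distribution_function_measure(2)[OF \<gamma>] by (intro tendsto_Lim) simp_all
  then have e: "eta_bar \<eta> y \<gamma> = (if measure \<mu> {y} = 0 then \<eta> (\<gamma> y) else (H (\<gamma> y) - H ?l) / (\<gamma> y - ?l))"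
    using set_lebesgue_integral_\<eta>[of ?l "\<gamma> y"] df_left[of y] df_01[of y] unfolding eta_bar_def cont by (simp add: Let_def)
  have b: "\<eta> (\<gamma> y) * (\<gamma> y - ?l) \<le> H (\<gamma> y) - H ?l" "H (\<gamma> y) - H ?l \<le> \<eta> ?l * (\<gamma> y - ?l)"
    by (intro H_diff_bounds df_left df_01)+
  show "\<eta> (\<gamma> y) \<le> eta_bar \<eta> y \<gamma>" "eta_bar \<eta> y \<gamma> \<le> \<eta> ?l"
    "measure \<mu> {y} * eta_bar \<eta> y \<gamma> = H (\<gamma> y) - H ?l"
  proof -
    show "measure \<mu> {y} * eta_bar \<eta> y \<gamma> = H (\<gamma> y) - H ?l"
      using e df_atom[of y] by auto
    show "\<eta> (\<gamma> y) \<le> eta_bar \<eta> y \<gamma>" "eta_bar \<eta> y \<gamma> \<le> \<eta> ?l"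
      using e b df_atom[of y] df_left(2)[of y] by (auto simp: le_divide_eq divide_le_eq)
  qed
qed

lemma eta_bar_bounds: "0 \<le> eta_bar \<eta> y \<gamma>" "eta_bar \<eta> y \<gamma> \<le> 1"
proof -
  show "0 \<le> eta_bar \<eta> y \<gamma>"
    using eta_bar_props(1)[of y] \<eta>_01[OF df_01(1)[of y] df_01(2)[of y]] by linarith
  show "eta_bar \<eta> y \<gamma> \<le> 1"
    using eta_bar_props(2)[of y] \<eta>_01[OF df_left(1)[of y] order_trans[OF df_left(2)[of y] df_01(2)[of y]]] by linarith
qed

lemma eta_bar_le: "x < u \<Longrightarrow> eta_bar \<eta> u \<gamma> \<le> \<eta> (\<gamma> x)"
  by (rule order_trans[OF eta_bar_props(2) \<eta>_le[OF df_01(1) df_left(3) order_trans[OF df_left(2) df_01(2)]]])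

lemma eta_bar_antimono: "antimono (\<lambda>y. eta_bar \<eta> y \<gamma>)"
proof (rule antimonoI)
  fix x y :: real assume "x \<le> y"
  then show "eta_bar \<eta> y \<gamma> \<le> eta_bar \<eta> x \<gamma>"
    using order_trans[OF eta_bar_le eta_bar_props(1), of x y] by (cases "x = y") auto
qed

lemma eta_bar_borel_measurable: "(\<lambda>y. eta_bar \<eta> y \<gamma>) \<in> borel_measurable borel"
proof -
  have "mono (\<lambda>y. - eta_bar \<eta> y \<gamma>)" using eta_bar_antimono by (auto simp: mono_def antimono_def)
  then have "(\<lambda>y. - (- eta_bar \<eta> y \<gamma>)) \<in> borel_measurable borel"
    by (intro borel_measurable_uminus mono_measurable)
  then show ?thesis by simp
qed

text \<open>The averaging in \<open>eta_bar\<close> is made for the chain rule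
  \<open>eta_bar d\<gamma> = d(H \<circ> \<gamma>)\<close>. Both sides have increments over \<open>(x, y]\<close> between
  \<open>\<eta> (\<gamma> y) (\<gamma> y - \<gamma> x)\<close> and \<open>\<eta> (\<gamma> x) (\<gamma> y - \<gamma> x)\<close>, so for Lipschitz \<open>\<gamma>\<close> their difference has
  derivative zero.\<close>

lemma eta_bar_chain_rule:
  assumes below: "\<And>t. t < b \<Longrightarrow> \<gamma> t = 0" and lip: "C-lipschitz_on {b..R} \<gamma>" and y: "y \<le> R"
  shows "(LINT x|\<mu>. indicator {..y} x * eta_bar \<eta> x \<gamma>) = H (\<gamma> y)"
proof -
  note [measurable] = eta_bar_borel_measurable
  define N where "N y = (LINT x|\<mu>. indicator {..y} x * eta_bar \<eta> x \<gamma>)" for y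
  have i: "integrable \<mu> (\<lambda>x. indicator A x * eta_bar \<eta> x \<gamma>)" if [measurable]: "A \<in> sets borel" for A
    by (rule M.integrable_const_bound[where B=1]) (use eta_bar_bounds in \<open>auto split: split_indicator\<close>)
  have left_b: "measure \<mu> {..<b} = 0"
  proof -
    have lim: "((\<lambda>_. 0) \<longlongrightarrow> measure \<mu> {..<b}) (at_left b)"
      using M.cdf_at_left[of b] below distribution_function_measure(2)[OF \<gamma>]
      by (rule_tac Lim_transform_eventually[where f=\<gamma>]) (auto simp: eventually_at_filter)
    show ?thesis using tendsto_unique[OF _ lim tendsto_const] by simp
  qed
  \<comment> \<open>Base point of the integration: with no mass left of \<open>b\<close>, the claim
    at \<open>b\<close> is the atom identity of \<open>eta_bar_props\<close>.\<close>
  have N_b: "N b = H (\<gamma> b)"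
  proof -
    have "AE x in \<mu>. x \<notin> {..<b}"
      using left_b by (intro AE_not_in) (auto simp: null_sets_def M.emeasure_eq_measure)
    then have "N b = (LINT x|\<mu>. indicator {b} x * eta_bar \<eta> b \<gamma>)"
      unfolding N_def by (intro integral_cong_AE) (auto split: split_indicator elim!: eventually_mono)
    also have "\<dots> = measure \<mu> {b} * eta_bar \<eta> b \<gamma>" by simp
    finally show ?thesis using eta_bar_props(3)[of b] left_b by simp
  qed
  show ?thesis
  proof (cases "y < b")
    case True
    have "measure \<mu> {..y} = 0" using below[OF True] by simp
    then have "AE x in \<mu>. x \<notin> {..y}"
      by (intro AE_not_in) (auto simp: null_sets_def M.emeasure_eq_measure)
    then have "N y = (LINT x|\<mu>. 0)"
      unfolding N_def by (intro integral_cong_AE) (auto split: split_indicator elim!: eventually_mono)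
    then show ?thesis using below[OF True] by (simp add: N_def)
  next
    case False
    define E where "E u = N u - H (\<gamma> u)" for u
    have C: "0 \<le> C" using lip by (rule lipschitz_on_nonneg)
    have incr: "\<bar>E v - E u\<bar> \<le> C * \<bar>\<eta> (\<gamma> v) - \<eta> (\<gamma> u)\<bar> * \<bar>v - u\<bar>" if uv: "b \<le> u" "u \<le> v" "v \<le> R" for u v
    proof -
      have d: "0 \<le> \<gamma> v - \<gamma> u" using monoD[OF df_mono uv(2)] by simp
      have "N v - N u = (LINT x|\<mu>. indicator {..v} x * eta_bar \<eta> x \<gamma> - indicator {..u} x * eta_bar \<eta> x \<gamma>)"
        unfolding N_def by (intro Bochner_Integration.integral_diff[symmetric] i) auto
      also have "\<dots> = (LINT x|\<mu>. indicator {u<..v} x * eta_bar \<eta> x \<gamma>)"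
        using uv by (intro Bochner_Integration.integral_cong) (auto split: split_indicator)
      finally have N_diff: "N v - N u = (LINT x|\<mu>. indicator {u<..v} x * eta_bar \<eta> x \<gamma>)" .
      have meas: "(LINT x|\<mu>. indicator {u<..v} x * c) = c * (\<gamma> v - \<gamma> u)" for c
      proof -
        have "measure \<mu> {u<..v} = \<gamma> v - \<gamma> u"
          using \<gamma> uv by (intro measure_interval_measure_Ioc) (auto simp: distribution_function_def mono_def)
        then show ?thesis by simp
      qed
      have const_int: "integrable \<mu> (\<lambda>x. indicator {u<..v} x * c)" for c :: real
        by (intro integrable_mult_left integrable_real_indicator) (auto simp: M.emeasure_eq_measure)
      have lo: "\<eta> (\<gamma> v) * (\<gamma> v - \<gamma> u) \<le> N v - N u"
        unfolding N_diff meas[symmetric]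
      proof (rule integral_mono[OF const_int i])
        fix x
        show "indicator {u<..v} x * \<eta> (\<gamma> v) \<le> indicator {u<..v} x * eta_bar \<eta> x \<gamma>"
          using eta_bar_props(1)[of x] \<eta>_le[of "\<gamma> x" "\<gamma> v"] df_01[of x] df_01[of v] monoD[OF df_mono, of x v]
          by (auto split: split_indicator)
      qed simp
      have hi: "N v - N u \<le> \<eta> (\<gamma> u) * (\<gamma> v - \<gamma> u)"
        unfolding N_diff meas[symmetric]
        by (rule integral_mono[OF i const_int]) (auto split: split_indicator intro: eta_bar_le)
      note Hb = H_diff_bounds[OF df_01(1)[of u] monoD[OF df_mono uv(2)] df_01(2)[of v]]
      have "\<bar>E v - E u\<bar> \<le> (\<eta> (\<gamma> u) - \<eta> (\<gamma> v)) * (\<gamma> v - \<gamma> u)"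
        using lo hi Hb unfolding E_def by (simp add: algebra_simps)
      also have "\<dots> \<le> \<bar>\<eta> (\<gamma> v) - \<eta> (\<gamma> u)\<bar> * (C * \<bar>v - u\<bar>)"
        using lipschitz_onD[OF lip, of u v] uv d by (intro mult_mono) (auto simp: dist_real_def abs_minus_commute)
      finally show ?thesis by (simp add: mult_ac)
    qed
    have incr': "\<bar>E v - E u\<bar> \<le> C * \<bar>\<eta> (\<gamma> v) - \<eta> (\<gamma> u)\<bar> * \<bar>v - u\<bar>" if "u \<in> {b..R}" "v \<in> {b..R}" for u v
      using incr[of u v] incr[of v u] that by (cases "u \<le> v") (auto simp: abs_minus_commute)
    have cont: "continuous_on {b..R} (\<lambda>u. \<eta> (\<gamma> u))"
      by (rule continuous_on_compose2[OF \<eta>_cont lipschitz_on_continuous_on[OF lip]]) (use df_01 in auto)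
    have "(E has_field_derivative 0) (at u within {b..R})" if u: "u \<in> {b..R}" for u
      unfolding has_field_derivative_iff
    proof (rule Lim_null_comparison)
      show "\<forall>\<^sub>F v in at u within {b..R}. norm ((E v - E u) / (v - u)) \<le> C * \<bar>\<eta> (\<gamma> v) - \<eta> (\<gamma> u)\<bar>"
        unfolding eventually_at_filter
      proof (intro always_eventually allI impI)
        fix v assume "v \<noteq> u" "v \<in> {b..R}"
        then show "norm ((E v - E u) / (v - u)) \<le> C * \<bar>\<eta> (\<gamma> v) - \<eta> (\<gamma> u)\<bar>"
          using incr'[OF u, of v] by (simp add: divide_le_eq)
      qed
      have "((\<lambda>v. \<eta> (\<gamma> v)) \<longlongrightarrow> \<eta> (\<gamma> u)) (at u within {b..R})"
        using cont u by (auto simp: continuous_on_def)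
      then show "((\<lambda>v. C * \<bar>\<eta> (\<gamma> v) - \<eta> (\<gamma> u)\<bar>) \<longlongrightarrow> 0) (at u within {b..R})"
        by (auto intro!: tendsto_eq_intros)
    qed
    then obtain c where c: "\<And>u. u \<in> {b..R} \<Longrightarrow> E u = c"
      using has_field_derivative_zero_constant[of "{b..R}" E] by auto
    have "E y = E b" using c[of y] c[of b] False y by simp
    then show ?thesis using N_b by (simp add: E_def N_def)
  qed
qed

section \<open>Balanced laws and the delay equation\<close>

context
  fixes w BL BR :: real
  assumes w: "0 < w" and frame: "- BL < BR"
begin

interpretation frame_kernel \<eta> J \<gamma> w BL BR
  by unfold_locales
     (use eta_bar_borel_measurable eta_bar_bounds w frame J_nonneg J.prob_space_axioms in \<open>auto simp: prob_space_def\<close>)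

text \<open>After exchanging the integrals, the starting points from which a jump of size z crosses
  s form the interval (s - z, s], and \<open>eta_bar_chain_rule\<close> evaluates the rate on
  it.\<close>

lemma crossing_rate_eq:
  assumes below: "\<And>t. t < - BL \<Longrightarrow> \<gamma> t = 0" and lip: "C-lipschitz_on {- BL..BR} \<gamma>" and s: "s \<le> BR"
  shows "crossing_rate \<mu> s = ennreal (K \<gamma> s)"
proof -
  interpret MJ: pair_prob_space jumps \<mu> ..
  note [measurable] = eta_bar_borel_measurable mono_measurable[OF df_mono]
  let ?e = "\<lambda>x. eta_bar \<eta> x \<gamma>"
  have i: "integrable \<mu> (\<lambda>x. indicator A x * ?e x)" if [measurable]: "A \<in> sets borel" for A
    by (rule M.integrable_const_bound[where B=1]) (use eta_bar_bounds in \<open>auto split: split_indicator\<close>)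
  have int_J: "integrable jumps (\<lambda>z. H (\<gamma> (s - z)))"
    by (rule integrable_conv[of "\<lambda>x. H (\<gamma> x)" 1]) (auto simp: abs_H_le)
  have "crossing_rate \<mu> s = (\<integral>\<^sup>+x. \<integral>\<^sup>+z. ennreal (?e x) * (indicator {0..} (s - x) * indicator {0<..} (x + z - s)) \<partial>jumps \<partial>\<mu>)"
    unfolding crossing_rate_def jump_over_def by (simp add: nn_integral_cmult)
  also have "\<dots> = (\<integral>\<^sup>+z. \<integral>\<^sup>+x. ennreal (?e x) * (indicator {0..} (s - x) * indicator {0<..} (x + z - s)) \<partial>\<mu> \<partial>jumps)"
    by (rule MJ.Fubini') measurable
  also have "\<dots> = (\<integral>\<^sup>+z. ennreal (H (\<gamma> s) - H (\<gamma> (s - z))) \<partial>jumps)"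
  proof (rule nn_integral_cong_AE, use J_nonneg in eventually_elim)
    fix z :: real assume z: "0 \<le> z"
    have "(\<integral>\<^sup>+x. ennreal (?e x) * (indicator {0..} (s - x) * indicator {0<..} (x + z - s)) \<partial>\<mu>)
       = (\<integral>\<^sup>+x. ennreal (indicator {s - z<..s} x * ?e x) \<partial>\<mu>)"
      by (intro nn_integral_cong) (auto split: split_indicator)
    also have "\<dots> = ennreal (LINT x|\<mu>. indicator {s - z<..s} x * ?e x)"
      by (intro nn_integral_eq_integral i) (use eta_bar_bounds in auto)
    also have "(LINT x|\<mu>. indicator {s - z<..s} x * ?e x)
      = (LINT x|\<mu>. indicator {..s} x * ?e x - indicator {..s - z} x * ?e x)"
      using z by (intro Bochner_Integration.integral_cong) (auto split: split_indicator)
    also have "\<dots> = H (\<gamma> s) - H (\<gamma> (s - z))"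
      using z s eta_bar_chain_rule[OF below lip, of s] eta_bar_chain_rule[OF below lip, of "s - z"]
      by (subst Bochner_Integration.integral_diff[OF i i]) auto
    finally show "(\<integral>\<^sup>+x. ennreal (?e x) * (indicator {0..} (s - x) * indicator {0<..} (x + z - s)) \<partial>\<mu>)
       = ennreal (H (\<gamma> s) - H (\<gamma> (s - z)))" .
  qed
  also have "\<dots> = ennreal (LINT z|jumps. H (\<gamma> s) - H (\<gamma> (s - z)))"
  proof (rule nn_integral_eq_integral)
    show "integrable jumps (\<lambda>z. H (\<gamma> s) - H (\<gamma> (s - z)))" using int_J by simp
    show "AE z in jumps. 0 \<le> H (\<gamma> s) - H (\<gamma> (s - z))"
      using J_nonneg by eventually_elim (auto intro!: H_mono monoD[OF df_mono])
  qed
  also have "(LINT z|jumps. H (\<gamma> s) - H (\<gamma> (s - z))) = K \<gamma> s"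
    using int_J J.prob_space by (simp add: K_def conv_def)
  finally show ?thesis .
qed

lemma emeasure_mixture_atMost:
  assumes [measurable]: "q \<in> borel_measurable borel" "\<phi> \<in> borel_measurable borel"
    and q: "\<And>s. 0 \<le> q s" "\<And>s. q s \<le> 1" and \<phi>: "\<And>s. - BL \<le> s \<Longrightarrow> s \<le> BR \<Longrightarrow> \<phi> s = ennreal (q s)"
    and y: "- BL \<le> y"
  shows "emeasure (boundary_mixture (- BL) BR a (\<lambda>s. ennreal (1 / w) * \<phi> s)) {..y}
    = a + ennreal (integral {- BL..min y BR} q / w)"
proof -
  have "emeasure (boundary_mixture (- BL) BR a (\<lambda>s. ennreal (1 / w) * \<phi> s)) {..y}
    = (\<integral>\<^sup>+x. indicator {..y} x \<partial>boundary_mixture (- BL) BR a (\<lambda>s. ennreal (1 / w) * \<phi> s))" by simp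
  also have "\<dots> = a + (\<integral>\<^sup>+s. indicator {..y} s * (ennreal (1 / w) * \<phi> s) * indicator {- BL..BR} s \<partial>lborel)"
    using y by (subst nn_integral_boundary_mixture) auto
  also have "(\<integral>\<^sup>+s. indicator {..y} s * (ennreal (1 / w) * \<phi> s) * indicator {- BL..BR} s \<partial>lborel)
    = (\<integral>\<^sup>+s. ennreal (1 / w) * ennreal (indicator {- BL..min y BR} s * q s) \<partial>lborel)"
    by (intro nn_integral_cong) (auto split: split_indicator simp: \<phi>)
  also have "\<dots> = ennreal (1 / w) * (\<integral>\<^sup>+s. ennreal (indicator {- BL..min y BR} s * q s) \<partial>lborel)"
    by (rule nn_integral_cmult) simp
  also have "(\<integral>\<^sup>+s. ennreal (indicator {- BL..min y BR} s * q s) \<partial>lborel) = ennreal (LINT s|lborel. indicator {- BL..min y BR} s * q s)"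
  proof (rule nn_integral_eq_integral)
    show "integrable lborel (\<lambda>s. indicator {- BL..min y BR} s * q s)"
      by (rule integrableI_bounded_set[where A="{- BL..min y BR}" and B=1])
         (use q in \<open>auto simp: emeasure_lborel_Icc_eq split: split_indicator\<close>)
  qed (use q in auto)
  also have "(LINT s|lborel. indicator {- BL..min y BR} s * q s) = integral {- BL..min y BR} q"
    using q by (subst bounded_integrable_on(2)[where B=1]) auto
  finally show ?thesis using w
    by (simp add: ennreal_mult'[symmetric] integral_nonneg divide_inverse mult.commute)
qed

lemma balanced_of_wave:
  assumes W: "is_wave w (- BL) BR \<gamma>"
  shows "balanced \<mu>"
proof -
  let ?M = \<mu> and ?b = "- BL"
  let ?B = "boundary_mixture (- BL) BR (ennreal (\<gamma> ?b)) (\<lambda>s. ennreal (1 / w) * crossing_rate ?M s)"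
  have rd: "real_distribution ?M" by (rule M.real_distribution_axioms)
  note [measurable] = crossing_rate_measurable[OF rd]
  note m = wave_mono[OF W]
  have cr: "crossing_rate ?M s = ennreal (K \<gamma> s)" if "s \<le> BR" for s
    by (rule crossing_rate_eq[OF _ wave_lipschitz[OF W w] that]) (use W in \<open>auto simp: is_wave_def\<close>)
  have B: "emeasure ?B {..y} = ennreal (\<gamma> y)" for y
  proof (cases "y < ?b")
    case True
    have "emeasure ?B {..y} = (\<integral>\<^sup>+x. indicator {..y} x \<partial>?B)" by simp
    also have "\<dots> = 0"
      using True by (subst nn_integral_boundary_mixture) (auto simp: nn_integral_0_iff_AE split: split_indicator)
    finally show ?thesis using W True by (simp add: is_wave_def)
  next
    case False
    have "emeasure ?B {..y} = ennreal (\<gamma> ?b) + ennreal (integral {?b..min y BR} (K \<gamma>) / w)"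
      by (rule emeasure_mixture_atMost)
         (use False cr K_01[OF m] in \<open>auto intro: K_measurable mono_measurable m\<close>)
    also have "integral {?b..min y BR} (K \<gamma>) = w * (\<gamma> (min y BR) - \<gamma> ?b)"
      using False frame by (intro wave_diff[OF W, symmetric]) auto
    also have "ennreal (\<gamma> ?b) + ennreal (w * (\<gamma> (min y BR) - \<gamma> ?b) / w) = ennreal (\<gamma> (min y BR))"
      using w monoD[OF m, of ?b "min y BR"] False frame wave_01(1)[OF W]
      by (subst ennreal_plus[symmetric]) auto
    also have "\<gamma> (min y BR) = \<gamma> y" using W by (simp add: is_wave_def min_def)
    finally show ?thesis .
  qed
  have "?M = ?B"
  proof (rule cdf_unique')
    \<comment> \<open>\<open>cdf_unique'\<close> asks for a finite measure; for the mixture this is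
      read off from its values on half-lines.\<close>
    have "emeasure ?B UNIV = (SUP n::nat. emeasure ?B {..real n})"
    proof -
      have "(\<Union>n::nat. {..real n}) = UNIV" by (auto intro: real_arch_simple)
      then show ?thesis by (subst SUP_emeasure_incseq) (auto simp: incseq_def)
    qed
    also have "\<dots> \<le> 1" by (rule SUP_least) (simp add: B df_01)
    finally have "emeasure ?B (space ?B) \<noteq> \<infinity>" by (auto simp: boundary_mixture_def top_unique)
    then show "finite_borel_measure ?B"
      by (intro finite_borel_measure.intro finite_measureI finite_borel_measure_axioms.intro) simp_all
    show "cdf ?M = cdf ?B"
      by (rule ext) (simp add: cdf_def measure_def[of ?B] B df_01)
  qed (rule M.finite_borel_measure_M)
  then show ?thesis unfolding balanced_def using rd by blast
qed

text \<open>A bootstrap: balance alone gives a density bounded by \<open>1 / w\<close>, hence a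
  Lipschitz \<gamma>. Only then does the chain rule apply and identify the crossing rate with
  \<open>K \<gamma>\<close>.\<close>

lemma wave_of_balanced:
  assumes bal: "balanced \<mu>"
  shows "is_wave w (- BL) BR \<gamma>"
proof -
  let ?M = \<mu> and ?b = "- BL"
  from bal obtain a where M_eq: "?M = boundary_mixture ?b BR a (\<lambda>s. ennreal (1 / w) * crossing_rate ?M s)"
    unfolding balanced_def by blast
  have rd: "real_distribution ?M" by (rule M.real_distribution_axioms)
  note [measurable] = crossing_rate_measurable[OF rd]
  have cr1: "crossing_rate ?M s \<le> 1" for s
  proof -
    have "crossing_rate ?M s \<le> (\<integral>\<^sup>+x. 1 \<partial>?M)" unfolding crossing_rate_def by (intro nn_integral_mono jump_over_le_1)
    also have "\<dots> = 1" using M.emeasure_space_1 by simp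
    finally show ?thesis .
  qed
  define q where "q s = enn2real (crossing_rate ?M s)" for s
  have q: "0 \<le> q s" "q s \<le> 1" "crossing_rate ?M s = ennreal (q s)" for s
  proof -
    have "crossing_rate ?M s < \<top>" using cr1[of s] by (rule le_less_trans) simp
    then show e: "crossing_rate ?M s = ennreal (q s)" by (simp add: q_def)
    show "0 \<le> q s" by (simp add: q_def)
    show "q s \<le> 1" using cr1[of s] unfolding e by simp
  qed
  have [measurable]: "q \<in> borel_measurable borel" unfolding q_def by measurable
  have iq: "q integrable_on {x..y}" for x y by (rule bounded_integrable_on(1)[where B=1]) (use q in auto)
  have cdf_eq: "ennreal (\<gamma> y) = a + ennreal (integral {?b..y} q / w)" if "?b \<le> y" "y \<le> BR" for y
  proof -
    have "ennreal (\<gamma> y) = emeasure ?M {..y}" by (simp add: M.emeasure_eq_measure)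
    also have "\<dots> = a + ennreal (integral {?b..min y BR} q / w)"
      by (subst M_eq) (rule emeasure_mixture_atMost, use q that in auto)
    finally show ?thesis using that by (simp add: min_def)
  qed
  have a: "a = ennreal (\<gamma> ?b)" using cdf_eq[of ?b] frame by simp
  have eq: "w * (\<gamma> y - \<gamma> ?b) = integral {?b..y} q" if "?b \<le> y" "y \<le> BR" for y
  proof -
    have nn: "0 \<le> integral {?b..y} q" by (rule integral_nonneg) (use iq q in auto)
    have "ennreal (\<gamma> y) = ennreal (\<gamma> ?b + integral {?b..y} q / w)"
      using cdf_eq[OF that] nn w df_01 by (simp add: a ennreal_plus)
    then have "\<gamma> y = \<gamma> ?b + integral {?b..y} q / w"
      using nn w df_01 by (subst (asm) ennreal_inj) auto
    then show ?thesis using w by simp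
  qed
  have lip: "(1 / w)-lipschitz_on {?b..BR} \<gamma>"
    by (rule lipschitz_of_integral_equation[OF w eq iq q(1,2)])
  have supp: "AE x in ?M. ?b \<le> x \<and> x \<le> BR" by (rule balanced_supported[OF bal])
  have below: "\<gamma> t = 0" if "t < ?b" for t
  proof -
    have "AE x in ?M. x \<notin> {..t}" using supp by eventually_elim (use that in auto)
    then have "measure ?M {..t} = 0" by (subst (asm) AE_iff_null_sets[symmetric]) (auto simp: null_sets_def measure_def)
    then show ?thesis by simp
  qed
  have above: "\<gamma> t = 1" if "BR \<le> t" for t
  proof -
    have "AE x in ?M. x \<in> {..t}" using supp by eventually_elim (use that in auto)
    then have "measure ?M {..t} = 1" by (subst M.prob_eq_1) auto
    then show ?thesis by simp
  qed
  have "w * (\<gamma> y - \<gamma> ?b) = integral {?b..y} (K \<gamma>)" if y: "y \<in> {?b..BR}" for y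
  proof -
    have "q s = K \<gamma> s" if "s \<in> {?b..y}" for s
    proof -
      have "ennreal (q s) = ennreal (K \<gamma> s)"
        unfolding q(3)[symmetric] using that y by (intro crossing_rate_eq[OF below lip]) auto
      then show ?thesis using q(1)[of s] K_01(1)[OF df_mono, of s] by simp
    qed
    then have "integral {?b..y} q = integral {?b..y} (K \<gamma>)" by (rule integral_cong)
    then show ?thesis using eq[of y] y by simp
  qed
  then show ?thesis unfolding is_wave_def using \<gamma> below above by blast
qed

lemma fixed_point_iff_wave: "\<gamma> = frame_operator \<eta> J w BL BR \<gamma> \<longleftrightarrow> is_wave w (- BL) BR \<gamma>"
  using fixed_point_iff_balanced[OF \<gamma>] balanced_of_wave wave_of_balanced by blast

lemma wave_concentrated:
  assumes "is_wave w (- BL) BR \<gamma>" shows "concentrated_on \<gamma> {- BL..BR}"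
proof -
  have "measure \<mu> {- BL..BR} = 1"
    using balanced_supported[OF balanced_of_wave[OF assms]] by (subst M.prob_eq_1) auto
  then show ?thesis by (simp add: concentrated_on_def)
qed

end

end

theorem traveling_wave_eq:
  assumes w: "0 < w" and frame: "- BL < BR"
  shows "traveling_wave \<eta> J w BL BR = wave w (- BL) BR"
  unfolding traveling_wave_def
proof (rule the_equality)
  note W = is_wave_wave[OF w frame]
  have df: "distribution_function (wave w (- BL) BR)" using W by (simp add: is_wave_def)
  show "distribution_function (wave w (- BL) BR) \<and> concentrated_on (wave w (- BL) BR) {- BL..BR} \<and>
    wave w (- BL) BR = frame_operator \<eta> J w BL BR (wave w (- BL) BR)"
    using df W fixed_point_iff_wave[OF df w frame] wave_concentrated[OF df w frame] by blast
  fix \<gamma> assume "distribution_function \<gamma> \<and> concentrated_on \<gamma> {- BL..BR} \<and> \<gamma> = frame_operator \<eta> J w BL BR \<gamma>"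
  then have "is_wave w (- BL) BR \<gamma>" using fixed_point_iff_wave[OF _ w frame] by blast
  then show "\<gamma> = wave w (- BL) BR" using W w frame by (intro wave_unique) auto
qed

end

section \<open>Transfer of the properties of \<open>wave\<close> to
  \<open>traveling_wave\<close>\<close>

theorem lemma5p4:
  fixes \<eta> J :: "real \<Rightarrow> real"
  assumes "jump_prob \<eta>" and "jump_size_cdf J"
  shows
    "(\<forall>(p :: nat \<Rightarrow> real \<times> real \<times> real) p0.
        (\<forall>k. p k \<in> {0<..} \<times> {0<..} \<times> {0<..}) \<and> p0 \<in> {0<..} \<times> {0<..} \<times> {0<..} \<and> p \<longlonglongrightarrow> p0 \<longrightarrow>
        Gamma_converges (\<lambda>k. framed_wave \<eta> J (p k)) (framed_wave \<eta> J p0))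
     \<and>
     ((\<forall>w w' BL BR. 0 < w \<and> w \<le> w' \<and> 0 < BL \<and> 0 < BR \<longrightarrow>
         traveling_wave \<eta> J w' BL BR \<preceq> traveling_wave \<eta> J w BL BR) \<and>
      (\<forall>w BL BL' BR. 0 < w \<and> 0 < BL \<and> BL \<le> BL' \<and> 0 < BR \<longrightarrow>
         traveling_wave \<eta> J w BL' BR \<preceq> traveling_wave \<eta> J w BL BR) \<and>
      (\<forall>w BL BR BR'. 0 < w \<and> 0 < BL \<and> 0 < BR \<and> BR \<le> BR' \<longrightarrow>
         traveling_wave \<eta> J w BL BR \<preceq> traveling_wave \<eta> J w BL BR'))
     \<and>
     (\<forall>BL BR. 0 < BL \<and> 0 < BR \<longrightarrow>
        (\<forall>w :: nat \<Rightarrow> real. (\<forall>k. 0 < w k) \<and> filterlim w at_top sequentially \<longrightarrow>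
           weak_conv_m (\<lambda>k. interval_measure (traveling_wave \<eta> J (w k) BL BR))
             (return borel (- BL))) \<and>
        (\<forall>w :: nat \<Rightarrow> real. (\<forall>k. 0 < w k) \<and> w \<longlonglongrightarrow> 0 \<longrightarrow>
           weak_conv_m (\<lambda>k. interval_measure (traveling_wave \<eta> J (w k) BL BR))
             (return borel BR)) \<and>
        (\<forall>y\<in>{- BL<..<BR}. \<forall>\<nu>\<in>{0<..<1}. \<exists>w>0. quantile (traveling_wave \<eta> J w BL BR) \<nu> = y))
     \<and>
     (\<forall>w BL BR c. 0 < w \<and> - BL < BR \<longrightarrow>
        (\<forall>\<gamma>. \<gamma> = traveling_wave \<eta> J w BL BR \<longrightarrow>
           translate c \<gamma> = traveling_wave \<eta> J w (BL - c) (BR + c)))"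
proof -
  interpret wave_model \<eta> J by unfold_locales (fact assms)+
  have tw: "traveling_wave \<eta> J w BL BR = wave w (- BL) BR" if "0 < w" "0 < BL" "0 < BR" for w BL BR
    using that by (intro traveling_wave_eq) auto
  have is_wave: "is_wave w (- BL) BR (wave w (- BL) BR)" if "0 < w" "0 < BL" "0 < BR" for w BL BR
    using that by (intro is_wave_wave) auto
  have in_Gamma: "framed_wave \<eta> J p \<in> Gamma_space" if "p \<in> {0<..} \<times> {0<..} \<times> {0<..}" for p
  proof -
    obtain w BL BR where p: "p = (w, BL, BR)" by (cases p)
    have pos: "0 < w" "0 < BL" "0 < BR" using that by (auto simp: p)
    note W = is_wave[OF pos]
    have "- BL < BR" using pos by simp
    then show ?thesis
      using pos W wave_concentrated[OF _ pos(1) _ W] wave_lipschitz[OF W pos(1)]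
      by (simp add: p framed_wave_def Gamma_space_def Gamma_frame_def tw is_wave_def)
  qed
  have continuity: "Gamma_converges (\<lambda>k. framed_wave \<eta> J (p k)) (framed_wave \<eta> J p0)"
    if p: "\<And>k. p k \<in> {0<..} \<times> {0<..} \<times> {0<..}" "p0 \<in> {0<..} \<times> {0<..} \<times> {0<..}" "p \<longlonglongrightarrow> p0"
    for p :: "nat \<Rightarrow> real \<times> real \<times> real" and p0
  proof -
    obtain w0 BL0 BR0 where p0: "p0 = (w0, BL0, BR0)" by (cases p0)
    define w BL BR where "w k = fst (p k)" and "BL k = fst (snd (p k))" and "BR k = snd (snd (p k))" for k
    have pk: "p k = (w k, BL k, BR k)" for k by (simp add: w_def BL_def BR_def)
    have pos: "0 < w k" "0 < BL k" "0 < BR k" for k using p(1)[of k] by (auto simp: pk)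
    have pos0: "0 < w0" "0 < BL0" "0 < BR0" using p(2) by (auto simp: p0)
    have lim: "w \<longlonglongrightarrow> w0" "BL \<longlonglongrightarrow> BL0" "BR \<longlonglongrightarrow> BR0"
      using tendsto_fst[OF p(3)] tendsto_fst[OF tendsto_snd[OF p(3)]] tendsto_snd[OF tendsto_snd[OF p(3)]]
      by (simp_all add: p0 w_def[abs_def] BL_def[abs_def] BR_def[abs_def])
    have "(\<lambda>k. wave (w k) (- BL k) (BR k) y) \<longlonglongrightarrow> wave w0 (- BL0) BR0 y" if "- BL0 < y" for y
    proof (rule wave_continuous)
      show "- BL k < BR k" for k using pos[of k] by simp
    qed (use pos pos0 lim that in \<open>auto intro!: tendsto_intros\<close>)
    moreover have "(w k, BL k, BR k, wave (w k) (- BL k) (BR k)) \<in> Gamma_space" for k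
      using in_Gamma[OF p(1)[of k]] pos[of k] by (simp add: pk framed_wave_def tw)
    moreover have "(w0, BL0, BR0, wave w0 (- BL0) BR0) \<in> Gamma_space"
      using in_Gamma[OF p(2)] pos0 by (simp add: p0 framed_wave_def tw)
    ultimately show ?thesis
      using lim pos pos0 unfolding Gamma_converges_def by (simp add: pk p0 framed_wave_def tw)
  qed
  \<comment> \<open>The stochastic order reverses the pointwise order of distribution functions, so
    the stochastically larger law takes the place of \<open>f\<close> in
    \<open>wave_comparison\<close>.\<close>
  have monotone_w: "traveling_wave \<eta> J w' BL BR \<preceq> traveling_wave \<eta> J w BL BR"
    if "0 < w" "w \<le> w'" "0 < BL" "0 < BR" for w w' BL BR
    using that wave_comparison[OF is_wave is_wave, of w BL BR w' BL BR] by (simp add: stoch_le_def tw)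
  have monotone_BL: "traveling_wave \<eta> J w BL' BR \<preceq> traveling_wave \<eta> J w BL BR"
    if "0 < w" "0 < BL" "BL \<le> BL'" "0 < BR" for w BL BL' BR
    using that wave_comparison[OF is_wave is_wave, of w BL BR w BL' BR] by (simp add: stoch_le_def tw)
  have monotone_BR: "traveling_wave \<eta> J w BL BR \<preceq> traveling_wave \<eta> J w BL BR'"
    if "0 < w" "0 < BL" "0 < BR" "BR \<le> BR'" for w BL BR BR'
    using that wave_comparison[OF is_wave is_wave, of w BL BR' w BL BR] by (simp add: stoch_le_def tw)
  have cdf_wave: "cdf (interval_measure (traveling_wave \<eta> J w BL BR)) = wave w (- BL) BR"
    if "0 < w" "0 < BL" "0 < BR" for w BL BR
    using distribution_function_measure(2)[of "wave w (- BL) BR"] is_wave[OF that] tw[OF that] by (simp add: is_wave_def)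
  have cdf_return: "cdf (return borel c) x = (if c \<le> x then 1 else 0)" for c x :: real
    by (simp add: cdf_def measure_return)
  have large_w: "weak_conv_m (\<lambda>k. interval_measure (traveling_wave \<eta> J (w k) BL BR)) (return borel (- BL))"
    if w: "\<And>k. 0 < w k" "filterlim w at_top sequentially" and pos: "0 < BL" "0 < BR" for w :: "nat \<Rightarrow> real" and BL BR
    unfolding weak_conv_m_def weak_conv_def
  proof (intro allI impI)
    fix x
    show "(\<lambda>k. cdf (interval_measure (traveling_wave \<eta> J (w k) BL BR)) x) \<longlonglongrightarrow> cdf (return borel (- BL)) x"
    proof (cases "x < - BL")
      case True
      then show ?thesis using is_wave[OF w(1) pos] by (simp add: cdf_wave[OF w(1) pos] cdf_return is_wave_def)
    next
      case False
      then show ?thesis using wave_tendsto_1[OF w, of "- BL" BR x] pos by (simp add: cdf_wave[OF w(1) pos] cdf_return)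
    qed
  qed
  have small_w: "weak_conv_m (\<lambda>k. interval_measure (traveling_wave \<eta> J (w k) BL BR)) (return borel BR)"
    if w: "\<And>k. 0 < w k" "w \<longlonglongrightarrow> 0" and pos: "0 < BL" "0 < BR" for w :: "nat \<Rightarrow> real" and BL BR
    unfolding weak_conv_m_def weak_conv_def
  proof (intro allI impI)
    fix x
    show "(\<lambda>k. cdf (interval_measure (traveling_wave \<eta> J (w k) BL BR)) x) \<longlonglongrightarrow> cdf (return borel BR) x"
    proof (cases "BR \<le> x")
      case True
      then show ?thesis using is_wave[OF w(1) pos] by (simp add: cdf_wave[OF w(1) pos] cdf_return is_wave_def)
    next
      case False
      then show ?thesis using wave_tendsto_0[OF w, of "- BL" BR x] pos by (simp add: cdf_wave[OF w(1) pos] cdf_return)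
    qed
  qed
  have quantiles: "\<exists>w>0. quantile (traveling_wave \<eta> J w BL BR) \<nu> = y"
    if "0 < BL" "0 < BR" "y \<in> {- BL<..<BR}" "\<nu> \<in> {0<..<1}" for BL BR y \<nu>
    using ex_wave_quantile[of "- BL" y BR \<nu>] that tw by force
  \<comment> \<open>The shifted frame may have endpoints of any sign, so
    \<open>traveling_wave_eq\<close> is used here instead of \<open>tw\<close>.\<close>
  have translate_wave: "translate c (traveling_wave \<eta> J w BL BR) = traveling_wave \<eta> J w (BL - c) (BR + c)"
    if "0 < w" "- BL < BR" for w BL BR c
    using that wave_translate[of w "- BL" c BR] by (simp add: traveling_wave_eq translate_def fun_eq_iff)
  show ?thesis
  proof (intro conjI allI impI ballI; (elim conjE)?)
    fix p :: "nat \<Rightarrow> real \<times> real \<times> real" and p0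
    assume "\<forall>k. p k \<in> {0<..} \<times> {0<..} \<times> {0<..}" "p0 \<in> {0<..} \<times> {0<..} \<times> {0<..}" "p \<longlonglongrightarrow> p0"
    then show "Gamma_converges (\<lambda>k. framed_wave \<eta> J (p k)) (framed_wave \<eta> J p0)"
      by (intro continuity) simp_all
  next
    fix BL BR :: real and w :: "nat \<Rightarrow> real"
    assume "0 < BL" "0 < BR" "\<forall>k. 0 < w k" "filterlim w at_top sequentially"
    then show "weak_conv_m (\<lambda>k. interval_measure (traveling_wave \<eta> J (w k) BL BR)) (return borel (- BL))"
      by (intro large_w) simp_all
  next
    fix BL BR :: real and w :: "nat \<Rightarrow> real"
    assume "0 < BL" "0 < BR" "\<forall>k. 0 < w k" "w \<longlonglongrightarrow> 0"
    then show "weak_conv_m (\<lambda>k. interval_measure (traveling_wave \<eta> J (w k) BL BR)) (return borel BR)"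
      by (intro small_w) simp_all
  qed (simp_all only: monotone_w monotone_BL monotone_BR quantiles translate_wave)
qed

end
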